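(* Let $\mathcal{K}$ be a 2-category, let $\mathcal{D}$ be the class of all bicarrable 1-cells of $\mathcal{K}$ (or any class of display 1-cells in $\mathcal{K}$), and let $x\colon\overline x\to\underline x$ be a 1-cell of $\mathcal{K}$ belonging to $\mathcal{D}$. Then $x$ is a fibration in the sense of the Johnstone criterion if and only if $x$, regarded as a 0-cell of $\mathcal{K}_{\mathcal{D}}$, is fibrational for the 2-functor $\mathrm{cod}\colon\mathcal{K}_{\mathcal{D}}\to\mathcal{K}$.
   Context: **The 2-category $\mathcal{K}_{\mathcal{D}}$.** A bipullback of an opspan $A\xrightarrow{f}C\xleftarrow{g}B$ in $\mathcal{K}$ is an object $P$ with 1-cells $d_0\colon P\to A$, $d_1\colon P\to B$ and an invertible 2-cell $fd_0\Rightarrow gd_1$ such that for every $X$ the induced functor from $\mathcal{K}(X,P)$ to the isocomma category of $f_*\colon\mathcal{K}(X,A)\to\mathcal{K}(X,C)$ and $g_*\colon\mathcal{K}(X,B)\to\mathcal{K}(X,C)$ is an equivalence. A 1-cell $x\colon\overline x\to\underline x$ is bicarrable if a bipullback of $x$ along every 1-cell with codomain $\underline x$ exists. A class of display 1-cells is a class $\mathcal{D}$ of bicarrable 1-cells containing all identities and such that for $x\colon\overline x\to\underline x$ in $\mathcal{D}$ and $\underline f\colon\underline y\to\underline x$ in $\mathcal{K}$, some bipullback of $x$ along $\underline f$ is in $\mathcal{D}$. $\mathcal{K}_{\mathcal{D}}$ has as 0-cells the elements $x\colon\overline x\to\underline x$ of $\mathcal{D}$. A 1-cell $f\colon y\to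 x$ is a triple $(\overline f,f^{\triangledown},\underline f)$ with 1-cells $\overline f\colon\overline y\to\overline x$, $\underline f\colon\underline y\to\underline x$ of $\mathcal{K}$ and an invertible 2-cell $f^{\triangledown}\colon x\overline f\Rightarrow\underline f y$. A 2-cell $\alpha\colon f\Rightarrow g$ is a pair $(\overline\alpha\colon\overline f\Rightarrow\overline g,\ \underline\alpha\colon\underline f\Rightarrow\underline g)$ with $(\underline\alpha\cdot y)\circ f^{\triangledown}=g^{\triangledown}\circ(x\cdot\overline\alpha)$. Composition is by pasting. The 2-functor $\mathrm{cod}\colon\mathcal{K}_{\mathcal{D}}\to\mathcal{K}$ takes underlined parts; "over" refers to $\mathrm{cod}$. A 1-cell or 2-cell of $\mathcal{K}_{\mathcal{D}}$ is vertical if its image under $\mathrm{cod}$ is an identity. **Cartesianness.** Let $P\colon\mathcal{X}\to\mathcal{C}$ be a 2-functor. A 1-cell $f\colon y\to x$ of $\mathcal{X}$ is cartesian if for every 0-cell $w$ the functor $\langle P_{w,y},f_*\rangle\colon\mathcal{X}(w,y)\to P(f)_*\downarrow_{\cong}P_{w,x}$ into the isocomma category (objects: $h\colon Pw\to Py$, $g\colon w\to x$ and an isomorphism $P(f)h\cong P(g)$) is an equivalence. A 2-cell $\alpha\colon f\Rightarrow g\colon y\to x$ of $\mathcal{X}$ is cartesian if it is a cartesian morphism (in the usual 1-categorical sense) for the functor $P_{y,x}\colon\mathcal{X}(y,x)\to\mathcal{C}(Py,Px)$. **Fibrational objects.** Let $P\colon\mathcal{E}\to\mathcal{B}$ be a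 2-functor. An object $e$ of $\mathcal{E}$ is fibrational if: (B1) every 1-cell $f\colon b'\to P(e)$ has a cartesian lift (a cartesian 1-cell with codomain $e$ whose image under $P$ is $f$); (B2) for every 0-cell $e'$ of $\mathcal{E}$ the functor $P_{e',e}\colon\mathcal{E}(e',e)\to\mathcal{B}(P(e'),P(e))$ is a Grothendieck fibration; (B3) whiskering on the left preserves cartesianness of 2-cells between 1-cells with codomain $e$: if $\alpha\colon f\Rightarrow g\colon e'\to e$ is cartesian and $k\colon e''\to e'$ is a 1-cell, then $\alpha\cdot k$ is cartesian. **Johnstone criterion.** A 1-cell $x\in\mathcal{D}$ is a fibration in the sense of the Johnstone criterion if $x$ is bicarrable and, for all 1-cells $\underline f,\underline g\colon\underline y\to\underline x$, all cartesian 1-cells $f\colon x_f\to x$, $g\colon x_g\to x$ of $\mathcal{K}_{\mathcal{D}}$ over them (i.e. given bipullbacks of $x$ along $\underline f$ and $\underline g$), and each 2-cell $\underline\alpha\colon\underline f\Rightarrow\underline g$, there are assigned a vertical 1-cell $r_\alpha\colon x_g\to x_f$ and the data $\alpha$ below, satisfying: (J1) $\alpha=(\overline\alpha,\underline\alpha)\colon f r_\alpha\Rightarrow g$ is a 2-cell of $\mathcal{K}_{\mathcal{D}}$ over $\underline\alpha$. (J2) For $\underline\alpha\colon\underline f\Rightarrow\underline g$ and $\underline\beta\colon\underline g\Rightarrow\underline h$, with $\underline\gamma=\underline\beta\,\underline\alpha$ and assigned $\alpha,\beta,\gamma,r_\alpha,r_\beta,r_\gamma$, there is a vertical invertible 2-cell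 $\tau_{\alpha,\beta}\colon r_\alpha r_\beta\Rightarrow r_\gamma$ with $\beta\circ(\alpha\cdot r_\beta)\circ(f\cdot\tau_{\alpha,\beta}^{-1})=\gamma$. (J3) For each $\underline f$ there is a vertical invertible 2-cell $\tau_f\colon 1_{x_f}\Rightarrow r_{\mathrm{id}_{\underline f}}$ such that $f\cdot\tau_f^{-1}$ is the assigned 2-cell $f r_{\mathrm{id}_{\underline f}}\Rightarrow f$ over $\mathrm{id}_{\underline f}$. (J4) For $\underline\alpha\colon\underline f\Rightarrow\underline g\colon\underline y\to\underline x$ and $\underline k\colon\underline z\to\underline y$, let $f'\colon x_{f'}\to x$ and $g'\colon x_{g'}\to x$ be cartesian over $\underline f\,\underline k$ and $\underline g\,\underline k$, let $k_f\colon x_{f'}\to x_f$, $k_g\colon x_{g'}\to x_g$ over $\underline k$ with vertical invertible $\rho\colon f k_f\Rightarrow f'$, $\pi\colon g k_g\Rightarrow g'$ be obtained from cartesianness of $f,g$, and let $\alpha'\colon f' r_{\alpha'}\Rightarrow g'$ be assigned to $\underline\alpha\cdot\underline k$. Then there is a vertical invertible 2-cell $\sigma\colon k_f r_{\alpha'}\Rightarrow r_\alpha k_g$ with $\pi\circ(\alpha\cdot k_g)\circ(f\cdot\sigma)=\alpha'\circ(\rho\cdot r_{\alpha'})$. (J5) For vertical 1-cells $v_0\colon y\to x_f$, $v_1\colon y\to x_g$ and any 2-cell $\alpha_0\colon f v_0\Rightarrow g v_1$ over $\underline\alpha$, there is a unique vertical 2-cell $\mu\colon v_0\Rightarrow r_\alpha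 v_1$ with $(\alpha\cdot v_1)\circ(f\cdot\mu)=\alpha_0$. *)

theory Defs
  imports Main
begin

section \<open>Categories and functors\<close>

record ('o, 'm) cat =
  Obj :: "'o set"
  Arr :: "'m set"
  Dom :: "'m \<Rightarrow> 'o"
  Cod :: "'m \<Rightarrow> 'o"
  Ide :: "'o \<Rightarrow> 'm"
  Comp :: "'m \<Rightarrow> 'm \<Rightarrow> 'm"

definition hom :: "('o, 'm) cat \<Rightarrow> 'o \<Rightarrow> 'o \<Rightarrow> 'm set" where
  "hom C a b = {f \<in> Arr C. Dom C f = a \<and> Cod C f = b}"

text \<open>\<open>Comp C g f\<close> is the composite \<open>g \<circ> f\<close> (first \<open>f\<close>, then \<open>g\<close>); it is meaningful only when
  \<open>Cod C f = Dom C g\<close>.\<close>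

locale category =
  fixes C :: "('o, 'm) cat"
  assumes dom_Obj: "f \<in> Arr C \<Longrightarrow> Dom C f \<in> Obj C"
    and cod_Obj: "f \<in> Arr C \<Longrightarrow> Cod C f \<in> Obj C"
    and ide_hom: "a \<in> Obj C \<Longrightarrow> Ide C a \<in> hom C a a"
    and comp_hom: "\<lbrakk>f \<in> hom C a b; g \<in> hom C b c\<rbrakk> \<Longrightarrow> Comp C g f \<in> hom C a c"
    and comp_ide: "f \<in> hom C a b \<Longrightarrow> Comp C f (Ide C a) = f"
    and ide_comp: "f \<in> hom C a b \<Longrightarrow> Comp C (Ide C b) f = f"
    and comp_assoc: "\<lbrakk>f \<in> hom C a b; g \<in> hom C b c; h \<in> hom C c d\<rbrakk>
      \<Longrightarrow> Comp C h (Comp C g f) = Comp C (Comp C h g) f"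

definition inverse_arrs :: "('o, 'm) cat \<Rightarrow> 'm \<Rightarrow> 'm \<Rightarrow> bool" where
  "inverse_arrs C f g \<longleftrightarrow> f \<in> Arr C \<and> g \<in> hom C (Cod C f) (Dom C f)
    \<and> Comp C g f = Ide C (Dom C f) \<and> Comp C f g = Ide C (Cod C f)"

definition iso :: "('o, 'm) cat \<Rightarrow> 'm \<Rightarrow> bool" where
  "iso C f \<longleftrightarrow> (\<exists>g. inverse_arrs C f g)"

definition inv_arr :: "('o, 'm) cat \<Rightarrow> 'm \<Rightarrow> 'm" where
  "inv_arr C f = (THE g. inverse_arrs C f g)"

record ('o1, 'm1, 'o2, 'm2) fctr =
  FO :: "'o1 \<Rightarrow> 'o2"
  FA :: "'m1 \<Rightarrow> 'm2"

definition is_functor ::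
  "('o1, 'm1) cat \<Rightarrow> ('o2, 'm2) cat \<Rightarrow> ('o1, 'm1, 'o2, 'm2) fctr \<Rightarrow> bool" where
  "is_functor C D F \<longleftrightarrow>
     (\<forall>a\<in>Obj C. FO F a \<in> Obj D)
   \<and> (\<forall>a b. \<forall>f\<in>hom C a b. FA F f \<in> hom D (FO F a) (FO F b))
   \<and> (\<forall>a\<in>Obj C. FA F (Ide C a) = Ide D (FO F a))
   \<and> (\<forall>a b c. \<forall>f\<in>hom C a b. \<forall>g\<in>hom C b c. FA F (Comp C g f) = Comp D (FA F g) (FA F f))"

definition id_fctr :: "('o, 'm, 'o, 'm) fctr" where
  "id_fctr = \<lparr>FO = \<lambda>a. a, FA = \<lambda>f. f\<rparr>"

definition comp_fctr :: "('o2, 'm2, 'o3, 'm3) fctr \<Rightarrow> ('o1, 'm1, 'o2, 'm2) fctr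
    \<Rightarrow> ('o1, 'm1, 'o3, 'm3) fctr" where
  "comp_fctr G F = \<lparr>FO = \<lambda>a. FO G (FO F a), FA = \<lambda>f. FA G (FA F f)\<rparr>"

definition natural_iso :: "('o1, 'm1) cat \<Rightarrow> ('o2, 'm2) cat \<Rightarrow> ('o1, 'm1, 'o2, 'm2) fctr
    \<Rightarrow> ('o1, 'm1, 'o2, 'm2) fctr \<Rightarrow> ('o1 \<Rightarrow> 'm2) \<Rightarrow> bool" where
  "natural_iso C D F G \<eta> \<longleftrightarrow>
     (\<forall>a\<in>Obj C. \<eta> a \<in> hom D (FO F a) (FO G a) \<and> iso D (\<eta> a))
   \<and> (\<forall>a b. \<forall>f\<in>hom C a b. Comp D (\<eta> b) (FA F f) = Comp D (FA G f) (\<eta> a))"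

definition is_equivalence ::
  "('o1, 'm1) cat \<Rightarrow> ('o2, 'm2) cat \<Rightarrow> ('o1, 'm1, 'o2, 'm2) fctr \<Rightarrow> bool" where
  "is_equivalence C D F \<longleftrightarrow> is_functor C D F \<and>
     (\<exists>G. is_functor D C G
        \<and> (\<exists>\<eta>. natural_iso C C id_fctr (comp_fctr G F) \<eta>)
        \<and> (\<exists>\<epsilon>. natural_iso D D (comp_fctr F G) id_fctr \<epsilon>))"

definition cartesian_arr ::
  "('o1, 'm1) cat \<Rightarrow> ('o2, 'm2) cat \<Rightarrow> ('o1, 'm1, 'o2, 'm2) fctr \<Rightarrow> 'm1 \<Rightarrow> bool" where
  "cartesian_arr X B P f \<longleftrightarrow> f \<in> Arr X \<and>
     (\<forall>c\<in>Obj X. \<forall>g\<in>hom X c (Cod X f). \<forall>h\<in>hom B (FO P c) (FO P (Dom X f)).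
        Comp B (FA P f) h = FA P g
        \<longrightarrow> (\<exists>!k. k \<in> hom X c (Dom X f) \<and> FA P k = h \<and> Comp X f k = g))"

definition grothendieck_fibration ::
  "('o1, 'm1) cat \<Rightarrow> ('o2, 'm2) cat \<Rightarrow> ('o1, 'm1, 'o2, 'm2) fctr \<Rightarrow> bool" where
  "grothendieck_fibration X B P \<longleftrightarrow> is_functor X B P \<and>
     (\<forall>e\<in>Obj X. \<forall>f\<in>Arr B. Cod B f = FO P e
        \<longrightarrow> (\<exists>g. cartesian_arr X B P g \<and> Cod X g = e \<and> FA P g = f))"

text \<open>In the isocomma category of \<open>F : A \<rightarrow> C\<close> and \<open>G : B \<rightarrow> C\<close>, an object is a triple
  \<open>(a, b, \<phi> : F a \<cong> G b)\<close>; an arrow carries its domain and its codomain along with its two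
  components.\<close>

type_synonym ('oa, 'ob, 'mc) isocomma_ob = "'oa \<times> 'ob \<times> 'mc"
type_synonym ('oa, 'ob, 'ma, 'mb, 'mc) isocomma_arr =
  "('oa, 'ob, 'mc) isocomma_ob \<times> ('oa, 'ob, 'mc) isocomma_ob \<times> 'ma \<times> 'mb"

definition isocomma :: "('oa, 'ma) cat \<Rightarrow> ('ob, 'mb) cat \<Rightarrow> ('oc, 'mc) cat
    \<Rightarrow> ('oa, 'ma, 'oc, 'mc) fctr \<Rightarrow> ('ob, 'mb, 'oc, 'mc) fctr
    \<Rightarrow> (('oa, 'ob, 'mc) isocomma_ob, ('oa, 'ob, 'ma, 'mb, 'mc) isocomma_arr) cat" where
  "isocomma A B C F G =
    (let Ob = {(a, b, \<phi>). a \<in> Obj A \<and> b \<in> Obj B \<and> \<phi> \<in> hom C (FO F a) (FO G b) \<and> iso C \<phi>}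
     in \<lparr>Obj = Ob,
         Arr = {((a, b, \<phi>), (a', b', \<phi>'), u, v).
                  (a, b, \<phi>) \<in> Ob \<and> (a', b', \<phi>') \<in> Ob \<and> u \<in> hom A a a' \<and> v \<in> hom B b b'
                  \<and> Comp C (FA G v) \<phi> = Comp C \<phi>' (FA F u)},
         Dom = \<lambda>(s, t, u, v). s,
         Cod = \<lambda>(s, t, u, v). t,
         Ide = \<lambda>(a, b, \<phi>). ((a, b, \<phi>), (a, b, \<phi>), Ide A a, Ide B b),
         Comp = \<lambda>(s', t', u', v') (s, t, u, v). (s, t', Comp A u' u, Comp B v' v)\<rparr>)"

text \<open>The functor \<open>S \<rightarrow> isocomma A B C F G\<close> induced by \<open>U : S \<rightarrow> A\<close>, \<open>V : S \<rightarrow> B\<close> and a natural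
  isomorphism \<open>\<gamma> : F U \<cong> G V\<close>.\<close>

definition isocomma_pairing :: "('os, 'ms) cat \<Rightarrow> ('os, 'ms, 'oa, 'ma) fctr
    \<Rightarrow> ('os, 'ms, 'ob, 'mb) fctr \<Rightarrow> ('os \<Rightarrow> 'mc)
    \<Rightarrow> ('os, 'ms, ('oa, 'ob, 'mc) isocomma_ob, ('oa, 'ob, 'ma, 'mb, 'mc) isocomma_arr) fctr" where
  "isocomma_pairing S U V \<gamma> =
    (let ob = (\<lambda>s. (FO U s, FO V s, \<gamma> s))
     in \<lparr>FO = ob, FA = \<lambda>m. (ob (Dom S m), ob (Cod S m), FA U m, FA V m)\<rparr>)"


section \<open>Strict 2-categories\<close>

text \<open>\<open>C1\<close> is the category of 0-cells and 1-cells, \<open>C2\<close> the category of 1-cells and 2-cells under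
  vertical composition, and \<open>HComp K \<beta> \<alpha>\<close> is the horizontal composite of \<open>\<alpha>\<close> followed by \<open>\<beta>\<close>.\<close>

record ('o, 'a, 't) two_cat =
  C1 :: "('o, 'a) cat"
  C2 :: "('a, 't) cat"
  HComp :: "'t \<Rightarrow> 't \<Rightarrow> 't"

abbreviation hom1 where "hom1 K \<equiv> hom (C1 K)"
abbreviation hom2 where "hom2 K \<equiv> hom (C2 K)"
abbreviation id1 where "id1 K \<equiv> Ide (C1 K)"
abbreviation id2 where "id2 K \<equiv> Ide (C2 K)"

abbreviation comp1 (infixr "\<cdot>\<index>" 75) where "g \<cdot>\<^bsub>K\<^esub> f \<equiv> Comp (C1 K) g f"
abbreviation vcomp (infixr "\<bullet>\<index>" 65) where "\<beta> \<bullet>\<^bsub>K\<^esub> \<alpha> \<equiv> Comp (C2 K) \<beta> \<alpha>"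
abbreviation hcomp (infixr "\<star>\<index>" 75) where "\<beta> \<star>\<^bsub>K\<^esub> \<alpha> \<equiv> HComp K \<beta> \<alpha>"

text \<open>Whiskering of a 2-cell by a 1-cell: \<open>f \<lhd> \<alpha>\<close> postcomposes \<open>\<alpha>\<close> with \<open>f\<close>, and \<open>\<alpha> \<rhd> k\<close>
  precomposes \<open>\<alpha>\<close> with \<open>k\<close>.\<close>

abbreviation postwhisker (infixr "\<lhd>\<index>" 75) where "f \<lhd>\<^bsub>K\<^esub> \<alpha> \<equiv> HComp K (Ide (C2 K) f) \<alpha>"
abbreviation prewhisker (infixl "\<rhd>\<index>" 75) where "\<alpha> \<rhd>\<^bsub>K\<^esub> k \<equiv> HComp K \<alpha> (Ide (C2 K) k)"

locale two_category =
  fixes K :: "('o, 'a, 't) two_cat"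
  assumes category_C1: "category (C1 K)"
    and category_C2: "category (C2 K)"
    and Obj_C2: "Obj (C2 K) = Arr (C1 K)"
    and parallel: "\<alpha> \<in> hom2 K f g \<Longrightarrow> Dom (C1 K) f = Dom (C1 K) g \<and> Cod (C1 K) f = Cod (C1 K) g"
    and hcomp_hom: "\<lbrakk>f \<in> hom1 K a b; g \<in> hom1 K b c; \<alpha> \<in> hom2 K f f'; \<beta> \<in> hom2 K g g'\<rbrakk>
      \<Longrightarrow> \<beta> \<star>\<^bsub>K\<^esub> \<alpha> \<in> hom2 K (g \<cdot>\<^bsub>K\<^esub> f) (g' \<cdot>\<^bsub>K\<^esub> f')"
    and hcomp_id2: "\<lbrakk>f \<in> hom1 K a b; g \<in> hom1 K b c\<rbrakk>
      \<Longrightarrow> id2 K g \<star>\<^bsub>K\<^esub> id2 K f = id2 K (g \<cdot>\<^bsub>K\<^esub> f)"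
    and interchange: "\<lbrakk>f \<in> hom1 K a b; g \<in> hom1 K b c;
        \<alpha> \<in> hom2 K f f'; \<alpha>' \<in> hom2 K f' f''; \<beta> \<in> hom2 K g g'; \<beta>' \<in> hom2 K g' g''\<rbrakk>
      \<Longrightarrow> (\<beta>' \<bullet>\<^bsub>K\<^esub> \<beta>) \<star>\<^bsub>K\<^esub> (\<alpha>' \<bullet>\<^bsub>K\<^esub> \<alpha>) = (\<beta>' \<star>\<^bsub>K\<^esub> \<alpha>') \<bullet>\<^bsub>K\<^esub> (\<beta> \<star>\<^bsub>K\<^esub> \<alpha>)"
    and hcomp_unit_right: "\<lbrakk>f \<in> hom1 K a b; \<alpha> \<in> hom2 K f f'\<rbrakk> \<Longrightarrow> \<alpha> \<star>\<^bsub>K\<^esub> id2 K (id1 K a) = \<alpha>"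
    and hcomp_unit_left: "\<lbrakk>f \<in> hom1 K a b; \<alpha> \<in> hom2 K f f'\<rbrakk> \<Longrightarrow> id2 K (id1 K b) \<star>\<^bsub>K\<^esub> \<alpha> = \<alpha>"
    and hcomp_assoc: "\<lbrakk>f \<in> hom1 K a b; g \<in> hom1 K b c; h \<in> hom1 K c d;
        \<alpha> \<in> hom2 K f f'; \<beta> \<in> hom2 K g g'; \<gamma> \<in> hom2 K h h'\<rbrakk>
      \<Longrightarrow> \<gamma> \<star>\<^bsub>K\<^esub> (\<beta> \<star>\<^bsub>K\<^esub> \<alpha>) = (\<gamma> \<star>\<^bsub>K\<^esub> \<beta>) \<star>\<^bsub>K\<^esub> \<alpha>"

definition homcat :: "('o, 'a, 't) two_cat \<Rightarrow> 'o \<Rightarrow> 'o \<Rightarrow> ('a, 't) cat" where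
  "homcat K a b = \<lparr>Obj = hom1 K a b,
     Arr = {\<alpha> \<in> Arr (C2 K). Dom (C2 K) \<alpha> \<in> hom1 K a b \<and> Cod (C2 K) \<alpha> \<in> hom1 K a b},
     Dom = Dom (C2 K), Cod = Cod (C2 K), Ide = Ide (C2 K), Comp = Comp (C2 K)\<rparr>"

definition postcomp :: "('o, 'a, 't) two_cat \<Rightarrow> 'a \<Rightarrow> ('a, 't, 'a, 't) fctr" where
  "postcomp K f = \<lparr>FO = \<lambda>h. f \<cdot>\<^bsub>K\<^esub> h, FA = \<lambda>\<theta>. f \<lhd>\<^bsub>K\<^esub> \<theta>\<rparr>"

record ('o1, 'a1, 't1, 'o2, 'a2, 't2) two_fctr =
  F0 :: "'o1 \<Rightarrow> 'o2"
  F1 :: "'a1 \<Rightarrow> 'a2"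
  F2 :: "'t1 \<Rightarrow> 't2"

text \<open>The functor induced by a 2-functor on any one of the hom-categories.\<close>

definition hom_fctr ::
  "('o1, 'a1, 't1, 'o2, 'a2, 't2) two_fctr \<Rightarrow> ('a1, 't1, 'a2, 't2) fctr" where
  "hom_fctr P = \<lparr>FO = F1 P, FA = F2 P\<rparr>"


section \<open>Bipullbacks and display 1-cells\<close>

definition bipullback ::
  "('o, 'a, 't) two_cat \<Rightarrow> 'a \<Rightarrow> 'a \<Rightarrow> 'o \<Rightarrow> 'a \<Rightarrow> 'a \<Rightarrow> 't \<Rightarrow> bool" where
  "bipullback K f g p d0 d1 \<phi> \<longleftrightarrow>
     f \<in> Arr (C1 K) \<and> g \<in> Arr (C1 K) \<and> Cod (C1 K) f = Cod (C1 K) g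
   \<and> p \<in> Obj (C1 K) \<and> d0 \<in> hom1 K p (Dom (C1 K) f) \<and> d1 \<in> hom1 K p (Dom (C1 K) g)
   \<and> \<phi> \<in> hom2 K (f \<cdot>\<^bsub>K\<^esub> d0) (g \<cdot>\<^bsub>K\<^esub> d1) \<and> iso (C2 K) \<phi>
   \<and> (\<forall>X\<in>Obj (C1 K).
        is_equivalence (homcat K X p)
          (isocomma (homcat K X (Dom (C1 K) f)) (homcat K X (Dom (C1 K) g))
             (homcat K X (Cod (C1 K) f)) (postcomp K f) (postcomp K g))
          (isocomma_pairing (homcat K X p) (postcomp K d0) (postcomp K d1) (\<lambda>h. \<phi> \<rhd>\<^bsub>K\<^esub> h)))"

definition bicarrable :: "('o, 'a, 't) two_cat \<Rightarrow> 'a \<Rightarrow> bool" where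
  "bicarrable K x \<longleftrightarrow> x \<in> Arr (C1 K) \<and>
     (\<forall>f\<in>Arr (C1 K). Cod (C1 K) f = Cod (C1 K) x \<longrightarrow> (\<exists>p d0 d1 \<phi>. bipullback K x f p d0 d1 \<phi>))"

text \<open>The bipullback of \<open>x\<close> along \<open>f\<close>, regarded as a 1-cell, is the projection \<open>d1\<close> to the domain
  of \<open>f\<close>.\<close>

definition display_class :: "('o, 'a, 't) two_cat \<Rightarrow> 'a set \<Rightarrow> bool" where
  "display_class K D \<longleftrightarrow>
     (\<forall>x\<in>D. bicarrable K x)
   \<and> (\<forall>a\<in>Obj (C1 K). id1 K a \<in> D)
   \<and> (\<forall>x\<in>D. \<forall>f\<in>Arr (C1 K). Cod (C1 K) f = Cod (C1 K) x
        \<longrightarrow> (\<exists>p d0 d1 \<phi>. bipullback K x f p d0 d1 \<phi> \<and> d1 \<in> D))"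


section \<open>The 2-category of display 1-cells\<close>

text \<open>A 1-cell \<open>f : y \<rightarrow> x\<close> is \<open>Sq y x f_over f_tri f_under\<close> with \<open>f_tri : x f_over \<cong> f_under y\<close>.\<close>

datatype ('a, 't) sq =
  Sq (sq_dom: 'a) (sq_cod: 'a) (over1: 'a) (tri: 't) (under1: 'a)

text \<open>A 2-cell \<open>\<alpha> : f \<Rightarrow> g\<close> is \<open>Cyl f g \<alpha>_over \<alpha>_under\<close>.\<close>

datatype ('a, 't) cyl =
  Cyl (cyl_dom: "('a, 't) sq") (cyl_cod: "('a, 't) sq") (over2: 't) (under2: 't)

definition KD1 :: "('o, 'a, 't) two_cat \<Rightarrow> 'a set \<Rightarrow> ('a, ('a, 't) sq) cat" where
  "KD1 K D = \<lparr>Obj = D,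
     Arr = {f. sq_dom f \<in> D \<and> sq_cod f \<in> D
         \<and> over1 f \<in> hom1 K (Dom (C1 K) (sq_dom f)) (Dom (C1 K) (sq_cod f))
         \<and> under1 f \<in> hom1 K (Cod (C1 K) (sq_dom f)) (Cod (C1 K) (sq_cod f))
         \<and> tri f \<in> hom2 K (sq_cod f \<cdot>\<^bsub>K\<^esub> over1 f) (under1 f \<cdot>\<^bsub>K\<^esub> sq_dom f)
         \<and> iso (C2 K) (tri f)},
     Dom = sq_dom, Cod = sq_cod,
     Ide = \<lambda>x. Sq x x (id1 K (Dom (C1 K) x)) (id2 K x) (id1 K (Cod (C1 K) x)),
     Comp = \<lambda>g f. Sq (sq_dom f) (sq_cod g) (over1 g \<cdot>\<^bsub>K\<^esub> over1 f)
         ((under1 g \<lhd>\<^bsub>K\<^esub> tri f) \<bullet>\<^bsub>K\<^esub> (tri g \<rhd>\<^bsub>K\<^esub> over1 f)) (under1 g \<cdot>\<^bsub>K\<^esub> under1 f)\<rparr>"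

definition KD2 :: "('o, 'a, 't) two_cat \<Rightarrow> 'a set \<Rightarrow> (('a, 't) sq, ('a, 't) cyl) cat" where
  "KD2 K D = \<lparr>Obj = Arr (KD1 K D),
     Arr = {\<alpha>. cyl_dom \<alpha> \<in> Arr (KD1 K D) \<and> cyl_cod \<alpha> \<in> Arr (KD1 K D)
         \<and> sq_dom (cyl_dom \<alpha>) = sq_dom (cyl_cod \<alpha>) \<and> sq_cod (cyl_dom \<alpha>) = sq_cod (cyl_cod \<alpha>)
         \<and> over2 \<alpha> \<in> hom2 K (over1 (cyl_dom \<alpha>)) (over1 (cyl_cod \<alpha>))
         \<and> under2 \<alpha> \<in> hom2 K (under1 (cyl_dom \<alpha>)) (under1 (cyl_cod \<alpha>))
         \<and> (under2 \<alpha> \<rhd>\<^bsub>K\<^esub> sq_dom (cyl_dom \<alpha>)) \<bullet>\<^bsub>K\<^esub> tri (cyl_dom \<alpha>)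
            = tri (cyl_cod \<alpha>) \<bullet>\<^bsub>K\<^esub> (sq_cod (cyl_dom \<alpha>) \<lhd>\<^bsub>K\<^esub> over2 \<alpha>)},
     Dom = cyl_dom, Cod = cyl_cod,
     Ide = \<lambda>f. Cyl f f (id2 K (over1 f)) (id2 K (under1 f)),
     Comp = \<lambda>\<beta> \<alpha>. Cyl (cyl_dom \<alpha>) (cyl_cod \<beta>) (over2 \<beta> \<bullet>\<^bsub>K\<^esub> over2 \<alpha>) (under2 \<beta> \<bullet>\<^bsub>K\<^esub> under2 \<alpha>)\<rparr>"

definition KD :: "('o, 'a, 't) two_cat \<Rightarrow> 'a set \<Rightarrow> ('a, ('a, 't) sq, ('a, 't) cyl) two_cat" where
  "KD K D = \<lparr>C1 = KD1 K D, C2 = KD2 K D,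
     HComp = \<lambda>\<beta> \<alpha>. Cyl (Comp (KD1 K D) (cyl_dom \<beta>) (cyl_dom \<alpha>))
                       (Comp (KD1 K D) (cyl_cod \<beta>) (cyl_cod \<alpha>))
                       (over2 \<beta> \<star>\<^bsub>K\<^esub> over2 \<alpha>) (under2 \<beta> \<star>\<^bsub>K\<^esub> under2 \<alpha>)\<rparr>"

definition cod_fctr ::
  "('o, 'a, 't) two_cat \<Rightarrow> ('a, ('a, 't) sq, ('a, 't) cyl, 'o, 'a, 't) two_fctr" where
  "cod_fctr K = \<lparr>F0 = Cod (C1 K), F1 = under1, F2 = under2\<rparr>"


section \<open>Cartesian cells and fibrational objects\<close>

definition vertical1 :: "('o2, 'a2, 't2) two_cat
    \<Rightarrow> ('o1, 'a1, 't1, 'o2, 'a2, 't2) two_fctr \<Rightarrow> 'a1 \<Rightarrow> bool" where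
  "vertical1 B P f \<longleftrightarrow> (\<exists>b\<in>Obj (C1 B). F1 P f = id1 B b)"

definition vertical2 :: "('o2, 'a2, 't2) two_cat
    \<Rightarrow> ('o1, 'a1, 't1, 'o2, 'a2, 't2) two_fctr \<Rightarrow> 't1 \<Rightarrow> bool" where
  "vertical2 B P \<alpha> \<longleftrightarrow> (\<exists>h\<in>Arr (C1 B). F2 P \<alpha> = id2 B h)"

definition cartesian1 :: "('o1, 'a1, 't1) two_cat \<Rightarrow> ('o2, 'a2, 't2) two_cat
    \<Rightarrow> ('o1, 'a1, 't1, 'o2, 'a2, 't2) two_fctr \<Rightarrow> 'a1 \<Rightarrow> bool" where
  "cartesian1 E B P f \<longleftrightarrow> f \<in> Arr (C1 E) \<and>
     (let y = Dom (C1 E) f; x = Cod (C1 E) f in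
      \<forall>w\<in>Obj (C1 E).
        is_equivalence (homcat E w y)
          (isocomma (homcat B (F0 P w) (F0 P y)) (homcat E w x) (homcat B (F0 P w) (F0 P x))
             (postcomp B (F1 P f)) (hom_fctr P))
          (isocomma_pairing (homcat E w y) (hom_fctr P) (postcomp E f)
             (\<lambda>h. id2 B (F1 P (f \<cdot>\<^bsub>E\<^esub> h)))))"

definition cartesian2 :: "('o1, 'a1, 't1) two_cat \<Rightarrow> ('o2, 'a2, 't2) two_cat
    \<Rightarrow> ('o1, 'a1, 't1, 'o2, 'a2, 't2) two_fctr \<Rightarrow> 't1 \<Rightarrow> bool" where
  "cartesian2 E B P \<alpha> \<longleftrightarrow> \<alpha> \<in> Arr (C2 E) \<and>
     (let y = Dom (C1 E) (Dom (C2 E) \<alpha>); x = Cod (C1 E) (Dom (C2 E) \<alpha>) in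
      cartesian_arr (homcat E y x) (homcat B (F0 P y) (F0 P x)) (hom_fctr P) \<alpha>)"

definition fibrational :: "('o1, 'a1, 't1) two_cat \<Rightarrow> ('o2, 'a2, 't2) two_cat
    \<Rightarrow> ('o1, 'a1, 't1, 'o2, 'a2, 't2) two_fctr \<Rightarrow> 'o1 \<Rightarrow> bool" where
  "fibrational E B P e \<longleftrightarrow> e \<in> Obj (C1 E)
   \<and> (\<forall>f\<in>Arr (C1 B). Cod (C1 B) f = F0 P e
        \<longrightarrow> (\<exists>g. cartesian1 E B P g \<and> Cod (C1 E) g = e \<and> F1 P g = f))
   \<and> (\<forall>e'\<in>Obj (C1 E).
        grothendieck_fibration (homcat E e' e) (homcat B (F0 P e') (F0 P e)) (hom_fctr P))
   \<and> (\<forall>e' e''. \<forall>f\<in>hom1 E e' e. \<forall>g\<in>hom1 E e' e. \<forall>\<alpha>\<in>hom2 E f g. \<forall>k\<in>hom1 E e'' e'.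
        cartesian2 E B P \<alpha> \<longrightarrow> cartesian2 E B P (\<alpha> \<rhd>\<^bsub>E\<^esub> k))"


section \<open>The Johnstone criterion\<close>

definition cart_to :: "('o1, 'a1, 't1) two_cat \<Rightarrow> ('o2, 'a2, 't2) two_cat
    \<Rightarrow> ('o1, 'a1, 't1, 'o2, 'a2, 't2) two_fctr \<Rightarrow> 'o1 \<Rightarrow> 'a1 set" where
  "cart_to E B P x = {f. cartesian1 E B P f \<and> Cod (C1 E) f = x}"

definition vert_hom1 :: "('o1, 'a1, 't1) two_cat \<Rightarrow> ('o2, 'a2, 't2) two_cat
    \<Rightarrow> ('o1, 'a1, 't1, 'o2, 'a2, 't2) two_fctr \<Rightarrow> 'o1 \<Rightarrow> 'o1 \<Rightarrow> 'a1 set" where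
  "vert_hom1 E B P y x = {v \<in> hom1 E y x. vertical1 B P v}"

definition vert_hom2 :: "('o1, 'a1, 't1) two_cat \<Rightarrow> ('o2, 'a2, 't2) two_cat
    \<Rightarrow> ('o1, 'a1, 't1, 'o2, 'a2, 't2) two_fctr \<Rightarrow> 'a1 \<Rightarrow> 'a1 \<Rightarrow> 't1 set" where
  "vert_hom2 E B P f g = {\<mu> \<in> hom2 E f g. vertical2 B P \<mu>}"

definition vert_iso2 :: "('o1, 'a1, 't1) two_cat \<Rightarrow> ('o2, 'a2, 't2) two_cat
    \<Rightarrow> ('o1, 'a1, 't1, 'o2, 'a2, 't2) two_fctr \<Rightarrow> 'a1 \<Rightarrow> 'a1 \<Rightarrow> 't1 set" where
  "vert_iso2 E B P f g = {\<tau> \<in> vert_hom2 E B P f g. iso (C2 E) \<tau>}"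

text \<open>The criterion is stated for a 2-functor \<open>P : E \<rightarrow> B\<close>, which below is \<open>cod : KD K D \<rightarrow> K\<close>.
  For cartesian \<open>f\<close>, \<open>g\<close> into \<open>x\<close> and a 2-cell \<open>a : P f \<Rightarrow> P g\<close> of \<open>B\<close>, the assigned 1-cell \<open>r\<^sub>\<alpha>\<close>
  and 2-cell \<open>\<alpha>\<close> over \<open>a\<close> are \<open>r f g a\<close> and \<open>A f g a\<close>; thus they may depend on \<open>f\<close> and \<open>g\<close>, and
  not only on \<open>a\<close>.\<close>

locale johnstone_data =
  fixes E :: "('o1, 'a1, 't1) two_cat"
    and B :: "('o2, 'a2, 't2) two_cat"
    and P :: "('o1, 'a1, 't1, 'o2, 'a2, 't2) two_fctr"
    and x :: 'o1
    and r :: "'a1 \<Rightarrow> 'a1 \<Rightarrow> 't2 \<Rightarrow> 'a1"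
    and A :: "'a1 \<Rightarrow> 'a1 \<Rightarrow> 't2 \<Rightarrow> 't1"
  assumes J0: "\<lbrakk>f \<in> cart_to E B P x; g \<in> cart_to E B P x; a \<in> hom2 B (F1 P f) (F1 P g)\<rbrakk>
      \<Longrightarrow> r f g a \<in> vert_hom1 E B P (Dom (C1 E) g) (Dom (C1 E) f)"
    and J1: "\<lbrakk>f \<in> cart_to E B P x; g \<in> cart_to E B P x; a \<in> hom2 B (F1 P f) (F1 P g)\<rbrakk>
      \<Longrightarrow> A f g a \<in> hom2 E (f \<cdot>\<^bsub>E\<^esub> r f g a) g \<and> F2 P (A f g a) = a"
    and J2: "\<lbrakk>f \<in> cart_to E B P x; g \<in> cart_to E B P x; h \<in> cart_to E B P x;
        a \<in> hom2 B (F1 P f) (F1 P g); b \<in> hom2 B (F1 P g) (F1 P h)\<rbrakk>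
      \<Longrightarrow> \<exists>\<tau>\<in>vert_iso2 E B P (r f g a \<cdot>\<^bsub>E\<^esub> r g h b) (r f h (b \<bullet>\<^bsub>B\<^esub> a)).
            A g h b \<bullet>\<^bsub>E\<^esub> (A f g a \<rhd>\<^bsub>E\<^esub> r g h b) \<bullet>\<^bsub>E\<^esub> (f \<lhd>\<^bsub>E\<^esub> inv_arr (C2 E) \<tau>)
              = A f h (b \<bullet>\<^bsub>B\<^esub> a)"
    and J3: "f \<in> cart_to E B P x
      \<Longrightarrow> \<exists>\<tau>\<in>vert_iso2 E B P (id1 E (Dom (C1 E) f)) (r f f (id2 B (F1 P f))).
            f \<lhd>\<^bsub>E\<^esub> inv_arr (C2 E) \<tau> = A f f (id2 B (F1 P f))"
    and J4: "\<lbrakk>f \<in> cart_to E B P x; g \<in> cart_to E B P x; a \<in> hom2 B (F1 P f) (F1 P g);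
        k \<in> hom1 B z (Dom (C1 B) (F1 P f));
        f' \<in> cart_to E B P x; F1 P f' = F1 P f \<cdot>\<^bsub>B\<^esub> k;
        g' \<in> cart_to E B P x; F1 P g' = F1 P g \<cdot>\<^bsub>B\<^esub> k;
        kf \<in> hom1 E (Dom (C1 E) f') (Dom (C1 E) f); F1 P kf = k;
        kg \<in> hom1 E (Dom (C1 E) g') (Dom (C1 E) g); F1 P kg = k;
        \<rho> \<in> vert_iso2 E B P (f \<cdot>\<^bsub>E\<^esub> kf) f'; \<pi> \<in> vert_iso2 E B P (g \<cdot>\<^bsub>E\<^esub> kg) g'\<rbrakk>
      \<Longrightarrow> \<exists>\<sigma>\<in>vert_iso2 E B P (kf \<cdot>\<^bsub>E\<^esub> r f' g' (a \<rhd>\<^bsub>B\<^esub> k)) (r f g a \<cdot>\<^bsub>E\<^esub> kg).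
            \<pi> \<bullet>\<^bsub>E\<^esub> (A f g a \<rhd>\<^bsub>E\<^esub> kg) \<bullet>\<^bsub>E\<^esub> (f \<lhd>\<^bsub>E\<^esub> \<sigma>)
              = A f' g' (a \<rhd>\<^bsub>B\<^esub> k) \<bullet>\<^bsub>E\<^esub> (\<rho> \<rhd>\<^bsub>E\<^esub> r f' g' (a \<rhd>\<^bsub>B\<^esub> k))"
    and J5: "\<lbrakk>f \<in> cart_to E B P x; g \<in> cart_to E B P x; a \<in> hom2 B (F1 P f) (F1 P g);
        v0 \<in> vert_hom1 E B P y (Dom (C1 E) f); v1 \<in> vert_hom1 E B P y (Dom (C1 E) g);
        \<alpha>0 \<in> hom2 E (f \<cdot>\<^bsub>E\<^esub> v0) (g \<cdot>\<^bsub>E\<^esub> v1); F2 P \<alpha>0 = a\<rbrakk>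
      \<Longrightarrow> \<exists>!\<mu>. \<mu> \<in> vert_hom2 E B P v0 (r f g a \<cdot>\<^bsub>E\<^esub> v1)
            \<and> (A f g a \<rhd>\<^bsub>E\<^esub> v1) \<bullet>\<^bsub>E\<^esub> (f \<lhd>\<^bsub>E\<^esub> \<mu>) = \<alpha>0"

definition johnstone_fibration :: "('o, 'a, 't) two_cat \<Rightarrow> 'a set \<Rightarrow> 'a \<Rightarrow> bool" where
  "johnstone_fibration K D x \<longleftrightarrow> bicarrable K x
     \<and> (\<exists>r A. johnstone_data (KD K D) K (cod_fctr K) x r A)"

end

theory Submission
  imports Defs
begin

text \<open>Both sides of the equivalence amount to cartesian lifts of 2-cells, stable under whiskering. Let
  \<open>f\<close> and \<open>g\<close> be cartesian 1-cells into \<open>x\<close> and \<open>a : P f \<Rightarrow> P g\<close>, where \<open>P\<close> is the codomain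
  2-functor. The criterion assigns to \<open>a\<close> a 2-cell \<open>\<alpha> : f r\<^sub>\<alpha> \<Rightarrow> g\<close> with \<open>r\<^sub>\<alpha>\<close> vertical.

  If \<open>x\<close> is fibrational, take a cartesian lift of \<open>a\<close> along \<open>g\<close>. Its domain lies over \<open>P f\<close>, so it is
  isomorphic to \<open>f r\<^sub>\<alpha>\<close> for some vertical \<open>r\<^sub>\<alpha>\<close>. The coherence isomorphisms of the criterion
  compare two cartesian lifts of one 2-cell, and its universal property combines those of \<open>\<alpha>\<close>
  and \<open>f\<close> (\<open>fibrational_imp_johnstone_data\<close>).

  Conversely, every 1-cell into \<open>x\<close> is, up to a vertical isomorphism, a cartesian 1-cell after a
  vertical one. Hence \<open>J5\<close>, which by itself only describes 2-cells over \<open>a\<close>, gives together with \<open>J2\<close>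
  the factorization of 2-cells over \<open>a b\<close> that makes \<open>\<alpha> \<rhd> v\<close> cartesian for every vertical \<open>v\<close>
  (\<open>cartesian2_assigned_vertical\<close>). By \<open>J4\<close> the same follows for all 1-cells in place of \<open>v\<close>
  (\<open>cartesian2_assigned\<close>). Up to isomorphism, all cartesian 2-cells over \<open>x\<close> are of this form, which
  yields both the local fibrations and stability under whiskering (\<open>fibrational\<close>).

  Two facts about \<open>P\<close> enter. Invertible 2-cells out of the image of a 1-cell lift, so that
  factorizations can be chosen strictly over a given 1-cell (\<open>locally_isofibrant_cod\<close>). And every
  1-cell into the codomain of \<open>x\<close> has a cartesian lift, namely the square of a bipullback of \<open>x\<close>
  (\<open>bipullback_cartesian1\<close>) whose projection is again in \<open>D\<close>. For a display class this closure
  is part of the definition; for the class of all bicarrable 1-cells it is the pasting lemma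
  (\<open>bicarrable_stable\<close>).\<close>

section \<open>Inverses and equivalences of categories\<close>

text \<open>The category axioms are recast as rewrite rules whose premises compute domains and codomains, so
  that the simplifier decides which composites are defined; composites are associated to the right.\<close>

lemma hom_iff [simp]: "f \<in> hom C a b \<longleftrightarrow> f \<in> Arr C \<and> Dom C f = a \<and> Cod C f = b"
  by (simp add: hom_def)

context category
begin

lemma dom_Obj' [simp]: "f \<in> Arr C \<Longrightarrow> Dom C f \<in> Obj C"
  by (rule dom_Obj)

lemma cod_Obj' [simp]: "f \<in> Arr C \<Longrightarrow> Cod C f \<in> Obj C"
  by (rule cod_Obj)

lemma comp_simps [simp]:
  assumes "f \<in> Arr C" "g \<in> Arr C" "Cod C f = Dom C g"
  shows "Comp C g f \<in> Arr C" "Dom C (Comp C g f) = Dom C f" "Cod C (Comp C g f) = Cod C g"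
  using comp_hom [of f "Dom C f" "Cod C f" g "Cod C g"] assms by auto

lemma ide_simps [simp]:
  assumes "a \<in> Obj C"
  shows "Ide C a \<in> Arr C" "Dom C (Ide C a) = a" "Cod C (Ide C a) = a"
  using ide_hom [OF assms] by auto

lemma comp_ide' [simp]: "f \<in> Arr C \<Longrightarrow> Dom C f = a \<Longrightarrow> Comp C f (Ide C a) = f"
  using comp_ide [of f a "Cod C f"] by auto

lemma ide_comp' [simp]: "f \<in> Arr C \<Longrightarrow> Cod C f = a \<Longrightarrow> Comp C (Ide C a) f = f"
  using ide_comp [of f "Dom C f" a] by auto

lemma assoc [simp]:
  assumes "f \<in> Arr C" "g \<in> Arr C" "h \<in> Arr C" "Cod C f = Dom C g" "Cod C g = Dom C h"
  shows "Comp C (Comp C h g) f = Comp C h (Comp C g f)"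
  using comp_assoc [of f "Dom C f" "Dom C g" g "Dom C h" h "Cod C h"] assms by auto

text \<open>Once composites are associated to the right, an equation between composites of two arrows no
  longer matches inside a longer composite. This rule and the next apply it there.\<close>

lemma comp_extend:
  assumes "Comp C g f = Comp C k h" "f \<in> Arr C" "g \<in> Arr C" "h \<in> Arr C" "k \<in> Arr C" "e \<in> Arr C"
    "Cod C f = Dom C g" "Cod C h = Dom C k" "Cod C e = Dom C f" "Dom C h = Dom C f"
  shows "Comp C g (Comp C f e) = Comp C k (Comp C h e)"
proof -
  have "Comp C g (Comp C f e) = Comp C (Comp C g f) e" using assms(2-) by simp
  also have "\<dots> = Comp C k (Comp C h e)" unfolding assms(1) using assms(2-) by simp
  finally show ?thesis .
qed

lemma comp_extend1:
  assumes "Comp C g f = k" "f \<in> Arr C" "g \<in> Arr C" "e \<in> Arr C" "Cod C f = Dom C g" "Cod C e = Dom C f"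
  shows "Comp C g (Comp C f e) = Comp C k e"
  using assms assoc [of e f g] by simp

lemma inverse_unique:
  assumes "inverse_arrs C f g" "inverse_arrs C f g'"
  shows "g = g'"
proof -
  have "Comp C (Comp C g' f) g = Comp C g' (Comp C f g)"
    using assms by (intro assoc) (auto simp: inverse_arrs_def)
  then show ?thesis using assms by (auto simp: inverse_arrs_def)
qed

lemma inverse_inv:
  assumes "iso C f" shows "inverse_arrs C f (inv_arr C f)"
  using assms theI [of "inverse_arrs C f"] inverse_unique
  unfolding iso_def inv_arr_def by blast

lemma inv_eqI: "inverse_arrs C f g \<Longrightarrow> inv_arr C f = g"
  using inverse_inv inverse_unique iso_def by metis

lemma iso_arr: "iso C f \<Longrightarrow> f \<in> Arr C"
  by (auto simp: iso_def inverse_arrs_def)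

lemma inv_simps [simp]:
  assumes "iso C f"
  shows "inv_arr C f \<in> Arr C" "Dom C (inv_arr C f) = Cod C f" "Cod C (inv_arr C f) = Dom C f"
    "Comp C (inv_arr C f) f = Ide C (Dom C f)" "Comp C f (inv_arr C f) = Ide C (Cod C f)"
  using inverse_inv [OF assms] by (auto simp: inverse_arrs_def)

lemma inv_cancel [simp]:
  assumes "iso C f" "g \<in> Arr C"
  shows "Cod C g = Dom C f \<Longrightarrow> Comp C (inv_arr C f) (Comp C f g) = g"
    "Cod C g = Cod C f \<Longrightarrow> Comp C f (Comp C (inv_arr C f) g) = g"
  by (use assms iso_arr [OF assms(1)] in \<open>simp_all flip: assoc\<close>)

lemma isoI:
  assumes "f \<in> Arr C" "g \<in> Arr C" "Dom C g = Cod C f" "Cod C g = Dom C f"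
    "Comp C g f = Ide C (Dom C f)" "Comp C f g = Ide C (Cod C f)"
  shows "iso C f"
  using assms by (auto simp: iso_def inverse_arrs_def)

lemma iso_ide [simp]: "a \<in> Obj C \<Longrightarrow> iso C (Ide C a)"
  by (rule isoI [of _ "Ide C a"]) auto

lemma inv_ide [simp]: "a \<in> Obj C \<Longrightarrow> inv_arr C (Ide C a) = Ide C a"
  by (rule inv_eqI) (auto simp: inverse_arrs_def)

lemma iso_inv [simp]: "iso C f \<Longrightarrow> iso C (inv_arr C f)"
  by (rule isoI [of _ f]) (auto simp: iso_arr)

lemma iso_comp [simp]:
  assumes "iso C f" "iso C g" "Cod C f = Dom C g"
  shows "iso C (Comp C g f)"
  using assms iso_arr [OF assms(1)] iso_arr [OF assms(2)]
  by (intro isoI [of _ "Comp C (inv_arr C f) (inv_arr C g)"]) auto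

lemma iso_cancel_left:
  assumes "iso C f" "g \<in> Arr C" "h \<in> Arr C" "Cod C g = Dom C f" "Cod C h = Dom C f"
    "Comp C f g = Comp C f h"
  shows "g = h"
  by (metis assms inv_cancel(1))

lemma iso_cancel_right:
  assumes "iso C f" "g \<in> Arr C" "h \<in> Arr C" "Dom C g = Cod C f" "Dom C h = Cod C f"
    "Comp C g f = Comp C h f"
  shows "g = h"
proof -
  have "g = Comp C (Comp C g f) (inv_arr C f)"
    using assms iso_arr [OF assms(1)] by (subst assoc) auto
  also have "\<dots> = h"
    using assms iso_arr [OF assms(1)] by (simp only: assms(6)) (subst assoc, auto)
  finally show ?thesis .
qed

lemma inv_comp_eq:
  assumes "iso C f" "g \<in> Arr C" "h \<in> Arr C" "Cod C g = Cod C f" "Cod C h = Dom C f"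
  shows "Comp C (inv_arr C f) g = h \<longleftrightarrow> g = Comp C f h"
  using assms iso_arr [OF assms(1)] by auto

end

lemma functor_simps:
  assumes "is_functor C D F"
  shows "a \<in> Obj C \<Longrightarrow> FO F a \<in> Obj D"
    "f \<in> Arr C \<Longrightarrow> FA F f \<in> Arr D" 
    "f \<in> Arr C \<Longrightarrow> Dom D (FA F f) = FO F (Dom C f)"
    "f \<in> Arr C \<Longrightarrow> Cod D (FA F f) = FO F (Cod C f)"
    "a \<in> Obj C \<Longrightarrow> FA F (Ide C a) = Ide D (FO F a)"
    "f \<in> Arr C \<Longrightarrow> g \<in> Arr C \<Longrightarrow> Cod C f = Dom C g
      \<Longrightarrow> FA F (Comp C g f) = Comp D (FA F g) (FA F f)"
  using assms unfolding is_functor_def by (auto simp: hom_def)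

lemma functorI:
  assumes "\<And>a. a \<in> Obj C \<Longrightarrow> FO F a \<in> Obj D"
    "\<And>f. f \<in> Arr C \<Longrightarrow> FA F f \<in> Arr D \<and> Dom D (FA F f) = FO F (Dom C f)
      \<and> Cod D (FA F f) = FO F (Cod C f)"
    "\<And>a. a \<in> Obj C \<Longrightarrow> FA F (Ide C a) = Ide D (FO F a)"
    "\<And>f g. f \<in> Arr C \<Longrightarrow> g \<in> Arr C \<Longrightarrow> Cod C f = Dom C g
      \<Longrightarrow> FA F (Comp C g f) = Comp D (FA F g) (FA F f)"
  shows "is_functor C D F"
  using assms unfolding is_functor_def by (auto simp: hom_def)

lemma functor_preserves_iso:
  assumes "category C" "category D" "is_functor C D F" "iso C f"
  shows "iso D (FA F f)"
proof -
  interpret C: category C by fact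
  interpret D: category D by fact
  note [simp] = functor_simps(1-5) [OF assms(3)] C.iso_arr
  show ?thesis
    using assms(4) functor_simps(6) [OF assms(3), symmetric]
    by (intro D.isoI [of _ "FA F (inv_arr C f)"]) auto
qed

definition fully_faithful ::
  "('o1, 'm1) cat \<Rightarrow> ('o2, 'm2) cat \<Rightarrow> ('o1, 'm1, 'o2, 'm2) fctr \<Rightarrow> bool" where
  "fully_faithful C D F \<longleftrightarrow> (\<forall>a\<in>Obj C. \<forall>b\<in>Obj C. \<forall>n\<in>hom D (FO F a) (FO F b).
     \<exists>!m. m \<in> hom C a b \<and> FA F m = n)"

definition ess_surjective ::
  "('o1, 'm1) cat \<Rightarrow> ('o2, 'm2) cat \<Rightarrow> ('o1, 'm1, 'o2, 'm2) fctr \<Rightarrow> bool" where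
  "ess_surjective C D F \<longleftrightarrow> (\<forall>d\<in>Obj D. \<exists>c\<in>Obj C. \<exists>e\<in>hom D (FO F c) d. iso D e)"

text \<open>The unit is invertible and natural, so composing with it recovers an arrow from its image under
  \<open>G F\<close>, hence from its image under \<open>F\<close>.\<close>

lemma unit_imp_faithful:
  assumes "category C" "category D" "is_functor C D F" "is_functor D C G"
    "natural_iso C C id_fctr (comp_fctr G F) \<eta>"
    "m \<in> hom C a b" "m' \<in> hom C a b" "FA F m = FA F m'"
  shows "m = m'"
proof -
  interpret C: category C by fact
  have ab: "a \<in> Obj C" "b \<in> Obj C" using assms(6) by auto
  have eta: "\<eta> b \<in> Arr C" "Dom C (\<eta> b) = b" "iso C (\<eta> b)"
    "Comp C (\<eta> b) m = Comp C (\<eta> b) m'"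
    using assms(5-8) ab unfolding natural_iso_def by (auto simp: id_fctr_def comp_fctr_def)
  show ?thesis
    using C.iso_cancel_left [OF eta(3) _ _ _ _ eta(4)] eta(2) assms(6,7) by auto
qed

lemma counit_imp_faithful:
  assumes "category C" "category D" "is_functor C D F" "is_functor D C G"
    "natural_iso D D (comp_fctr F G) id_fctr \<epsilon>"
    "n \<in> hom D a b" "n' \<in> hom D a b" "FA G n = FA G n'"
  shows "n = n'"
proof -
  interpret D: category D by fact
  have ab: "a \<in> Obj D" "b \<in> Obj D" using assms(6) by auto
  have eps: "\<epsilon> a \<in> Arr D" "Cod D (\<epsilon> a) = a" "iso D (\<epsilon> a)"
    "Comp D n (\<epsilon> a) = Comp D n' (\<epsilon> a)"
    using assms(5-8) ab unfolding natural_iso_def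
    by (simp_all add: id_fctr_def comp_fctr_def) (metis hom_iff)
  show ?thesis
    using D.iso_cancel_right [OF eps(3) _ _ _ _ eps(4)] eps(2) assms(6,7) by auto
qed

lemma ex1_eq: "\<exists>!z. P z \<Longrightarrow> P a \<Longrightarrow> P b \<Longrightarrow> a = b"
  by blast

text \<open>For fullness, conjugating \<open>G n\<close> by the unit gives an arrow \<open>m\<close> with \<open>G (F m) = G n\<close>; the counit
  makes \<open>G\<close> faithful, whence \<open>F m = n\<close>. Essential surjectivity is witnessed by the counit.\<close>

lemma equivalence_imp_ff_es:
  assumes "category C" "category D" "is_equivalence C D F"
  shows "fully_faithful C D F" "ess_surjective C D F"
proof -
  interpret C: category C by fact
  interpret D: category D by fact
  obtain G \<eta> \<epsilon> where F: "is_functor C D F" and G: "is_functor D C G"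
    and eta: "natural_iso C C id_fctr (comp_fctr G F) \<eta>"
    and eps: "natural_iso D D (comp_fctr F G) id_fctr \<epsilon>"
    using assms(3) unfolding is_equivalence_def by blast
  note [simp] = functor_simps [OF F] functor_simps [OF G] C.iso_arr
  have eta': "\<eta> a \<in> Arr C \<and> Dom C (\<eta> a) = a \<and> Cod C (\<eta> a) = FO G (FO F a) \<and> iso C (\<eta> a)"
    if "a \<in> Obj C" for a
    using eta that by (auto simp: natural_iso_def id_fctr_def comp_fctr_def)
  show "fully_faithful C D F"
    unfolding fully_faithful_def
  proof (intro ballI ex_ex1I)
    fix a b n assume a: "a \<in> Obj C" and b: "b \<in> Obj C" and n: "n \<in> hom D (FO F a) (FO F b)"
    note [simp] = eta' [OF a] eta' [OF b]
    let ?m = "Comp C (inv_arr C (\<eta> b)) (Comp C (FA G n) (\<eta> a))"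
    have m: "?m \<in> hom C a b" using a b n by simp
    have "Comp C (FA G (FA F ?m)) (\<eta> a) = Comp C (\<eta> b) ?m"
      using eta m unfolding natural_iso_def id_fctr_def comp_fctr_def by auto
    also have "\<dots> = Comp C (FA G n) (\<eta> a)" using n by simp
    finally have "FA G (FA F ?m) = FA G n"
      using C.iso_cancel_right [of "\<eta> a"] m n by simp
    then have "FA F ?m = n"
      using counit_imp_faithful [OF assms(1,2) F G eps _ n] m n by simp
    then show "\<exists>m. m \<in> hom C a b \<and> FA F m = n" using m by blast
  next
    fix a b n m m'
    assume "m \<in> hom C a b \<and> FA F m = n" "m' \<in> hom C a b \<and> FA F m' = n"
    then show "m = m'" using unit_imp_faithful [OF assms(1,2) F G eta] by metis
  qed
  show "ess_surjective C D F"
    unfolding ess_surjective_def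
  proof
    fix d assume "d \<in> Obj D"
    then have "FO G d \<in> Obj C" "\<epsilon> d \<in> hom D (FO F (FO G d)) d" "iso D (\<epsilon> d)"
      using eps by (auto simp: natural_iso_def id_fctr_def comp_fctr_def)
    then show "\<exists>c\<in>Obj C. \<exists>e\<in>hom D (FO F c) d. iso D e" by blast
  qed
qed

text \<open>The arrow over the inverse of \<open>F m\<close> is inverse to \<open>m\<close>, because both composites and the
  identities have the same images.\<close>

lemma ff_reflects_iso:
  assumes "category C" "category D" "is_functor C D F" "fully_faithful C D F"
    "m \<in> hom C a b" "iso D (FA F m)"
  shows "iso C m"
proof -
  interpret C: category C by fact
  interpret D: category D by fact
  note [simp] = functor_simps [OF assms(3)]
  have a: "a \<in> Obj C" and b: "b \<in> Obj C" using assms(5) by auto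
  have ff: "\<And>a b n. \<lbrakk>a \<in> Obj C; b \<in> Obj C; n \<in> hom D (FO F a) (FO F b)\<rbrakk>
      \<Longrightarrow> \<exists>!m. m \<in> hom C a b \<and> FA F m = n"
    using assms(4) by (auto simp: fully_faithful_def)
  obtain m' where m': "m' \<in> hom C b a" "FA F m' = inv_arr D (FA F m)"
    using ff [OF b a, of "inv_arr D (FA F m)"] assms(5,6) by auto
  have "Comp C m' m = Ide C a"
    by (rule ex1_eq [OF ff [OF a a, of "Ide D (FO F a)"]])
      (use a m' assms(5,6) in auto)
  moreover have "Comp C m m' = Ide C b"
    by (rule ex1_eq [OF ff [OF b b, of "Ide D (FO F b)"]])
      (use b m' assms(5,6) in auto)
  ultimately show ?thesis
    using m' assms(5) by (intro C.isoI [of _ m']) auto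
qed

lemma ff_es_imp_equivalence:
  assumes "category C" "category D" and F: "is_functor C D F"
    and "fully_faithful C D F" and es: "ess_surjective C D F"
  shows "is_equivalence C D F"
proof -
  interpret C: category C by fact
  interpret D: category D by fact
  note Fs [simp] = functor_simps [OF F]
  have ff: "\<And>a b n. \<lbrakk>a \<in> Obj C; b \<in> Obj C; n \<in> hom D (FO F a) (FO F b)\<rbrakk>
      \<Longrightarrow> \<exists>!m. m \<in> hom C a b \<and> FA F m = n"
    using assms(4) by (auto simp: fully_faithful_def)
  have ff_eq: "m = m'" if "FA F m = FA F m'" "m \<in> hom C a b" "m' \<in> hom C a b" for a b m m'
    using ff [of a b "FA F m"] that by (auto simp: hom_def)
  have "\<forall>d\<in>Obj D. \<exists>c e. c \<in> Obj C \<and> e \<in> hom D (FO F c) d \<and> iso D e"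
    using es unfolding ess_surjective_def by blast
  then obtain g \<epsilon> where g0: "\<forall>d\<in>Obj D. g d \<in> Obj C \<and> \<epsilon> d \<in> hom D (FO F (g d)) d \<and> iso D (\<epsilon> d)"
    by metis
  then have g [simp]: "g d \<in> Obj C" "\<epsilon> d \<in> Arr D" "Dom D (\<epsilon> d) = FO F (g d)"
      "Cod D (\<epsilon> d) = d" "iso D (\<epsilon> d)" if "d \<in> Obj D" for d
    using that by auto
  \<comment> \<open>the quasi-inverse transports an arrow along the chosen isomorphisms and then lifts it\<close>
  define t where "t n = Comp D (inv_arr D (\<epsilon> (Cod D n))) (Comp D n (\<epsilon> (Dom D n)))" for n
  define u where "u n = (THE m. m \<in> hom C (g (Dom D n)) (g (Cod D n)) \<and> FA F m = t n)" for n
  have t [simp]: "t n \<in> Arr D" "Dom D (t n) = FO F (g (Dom D n))" "Cod D (t n) = FO F (g (Cod D n))"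
    if "n \<in> Arr D" for n
    using that by (simp_all add: t_def)
  have u0: "u n \<in> hom C (g (Dom D n)) (g (Cod D n)) \<and> FA F (u n) = t n" if "n \<in> Arr D" for n
    unfolding u_def by (rule theI', rule ff) (use that in auto)
  then have u [simp]: "u n \<in> Arr C" "Dom C (u n) = g (Dom D n)" "Cod C (u n) = g (Cod D n)"
      "FA F (u n) = t n" if "n \<in> Arr D" for n
    using that by auto
  define G where "G = \<lparr>FO = g, FA = u\<rparr>"
  have G: "is_functor D C G"
  proof (rule functorI, goal_cases)
    case (3 a) then show ?case
      unfolding G_def by simp (rule ff_eq [of _ _ "g a" "g a"], simp_all add: t_def)
  next
    case (4 f h) then show ?case
      unfolding G_def
      by simp (rule ff_eq [of _ _ "g (Dom D f)" "g (Cod D h)"], simp_all add: t_def)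
  qed (auto simp: G_def)
  have eps: "natural_iso D D (comp_fctr F G) id_fctr \<epsilon>"
    by (auto simp: natural_iso_def G_def comp_fctr_def id_fctr_def t_def)
  define \<eta> where "\<eta> c = (THE m. m \<in> hom C c (g (FO F c)) \<and> FA F m = inv_arr D (\<epsilon> (FO F c)))" for c
  have eta0: "\<eta> c \<in> hom C c (g (FO F c)) \<and> FA F (\<eta> c) = inv_arr D (\<epsilon> (FO F c))" 
    if "c \<in> Obj C" for c
    unfolding \<eta>_def by (rule theI', rule ff) (use that in auto)
  then have eta [simp]: "\<eta> c \<in> Arr C" "Dom C (\<eta> c) = c" "Cod C (\<eta> c) = g (FO F c)"
      "FA F (\<eta> c) = inv_arr D (\<epsilon> (FO F c))" if "c \<in> Obj C" for c
    using that by auto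
  have "iso C (\<eta> c)" if "c \<in> Obj C" for c
    using ff_reflects_iso [OF assms(1-4), of "\<eta> c"] that by auto
  moreover have "Comp C (\<eta> (Cod C f)) f = Comp C (u (FA F f)) (\<eta> (Dom C f))" if "f \<in> Arr C" for f
    by (rule ff_eq [of _ _ "Dom C f" "g (FO F (Cod C f))"]) (use that in \<open>simp_all add: t_def\<close>)
  ultimately have "natural_iso C C id_fctr (comp_fctr G F) \<eta>"
    by (auto simp: natural_iso_def G_def comp_fctr_def id_fctr_def)
  then show ?thesis
    unfolding is_equivalence_def using F G eps by blast
qed

lemma equivalence_iff_ff_es:
  assumes "category C" "category D"
  shows "is_equivalence C D F \<longleftrightarrow> is_functor C D F \<and> fully_faithful C D F \<and> ess_surjective C D F"
  using equivalence_imp_ff_es [OF assms] ff_es_imp_equivalence [OF assms]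
  unfolding is_equivalence_def by blast

section \<open>Isocomma categories\<close>

lemma isocomma_simps:
  "(a, b, \<phi>) \<in> Obj (isocomma A B C F G) \<longleftrightarrow>
     a \<in> Obj A \<and> b \<in> Obj B \<and> \<phi> \<in> hom C (FO F a) (FO G b) \<and> iso C \<phi>"
  "(s, t, u, v) \<in> Arr (isocomma A B C F G) \<longleftrightarrow>
     s \<in> Obj (isocomma A B C F G) \<and> t \<in> Obj (isocomma A B C F G)
     \<and> u \<in> hom A (fst s) (fst t) \<and> v \<in> hom B (fst (snd s)) (fst (snd t))
     \<and> Comp C (FA G v) (snd (snd s)) = Comp C (snd (snd t)) (FA F u)"
  "Dom (isocomma A B C F G) (s, t, u, v) = s"
  "Cod (isocomma A B C F G) (s, t, u, v) = t"
  "Ide (isocomma A B C F G) s = (s, s, Ide A (fst s), Ide B (fst (snd s)))"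
  "Comp (isocomma A B C F G) (s', t', u', v') (s, t, u, v) = (s, t', Comp A u' u, Comp B v' v)"
  by (auto simp: isocomma_def Let_def split: prod.splits)

lemma pairing_simps:
  "FO (isocomma_pairing S U V \<gamma>) s = (FO U s, FO V s, \<gamma> s)"
  "FA (isocomma_pairing S U V \<gamma>) m =
     ((FO U (Dom S m), FO V (Dom S m), \<gamma> (Dom S m)), (FO U (Cod S m), FO V (Cod S m), \<gamma> (Cod S m)),
      FA U m, FA V m)"
  by (auto simp: isocomma_pairing_def Let_def)

locale functor_cospan =
  A: category A + B: category B + C: category C
  for A :: "('oa, 'ma) cat" and B :: "('ob, 'mb) cat" and C :: "('oc, 'mc) cat" +
  fixes F :: "('oa, 'ma, 'oc, 'mc) fctr" and G :: "('ob, 'mb, 'oc, 'mc) fctr"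
  assumes F: "is_functor A C F" and G: "is_functor B C G"
begin

lemmas F_simps [simp] = functor_simps [OF F]
lemmas G_simps [simp] = functor_simps [OF G]

lemma category_isocomma: "category (isocomma A B C F G)"
proof (standard, goal_cases)
  case (4 f a b g c)
  obtain a1 a2 a3 b1 b2 b3 u v where f: "f = ((a1, a2, a3), (b1, b2, b3), u, v)"
    by (metis prod.exhaust)
  obtain b1' b2' b3' c1 c2 c3 u' v' where g: "g = ((b1', b2', b3'), (c1, c2, c3), u', v')"
    by (metis prod.exhaust)
  have *: "b1' = b1" "b2' = b2" "b3' = b3" "a = (a1, a2, a3)" "c = (c1, c2, c3)"
    using 4 f g by (auto simp: isocomma_simps)
  note typed = 4 [unfolded f g *, unfolded hom_iff isocomma_simps, simplified]
  have "Comp C (FA G (Comp B v' v)) a3 = Comp C (FA G v') (Comp C (FA G v) a3)"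
    using typed by simp
  also have "\<dots> = Comp C (FA G v') (Comp C b3 (FA F u))"
    using typed by simp
  also have "\<dots> = Comp C c3 (Comp C (FA F u') (FA F u))"
    using typed by (intro C.comp_extend) auto
  also have "\<dots> = Comp C c3 (FA F (Comp A u' u))"
    using typed by simp
  finally show ?case
    using typed by (simp add: f g * isocomma_simps)
qed (auto simp: isocomma_simps)

sublocale I: category "isocomma A B C F G"
  by (rule category_isocomma)

text \<open>If both components are invertible, their inverses again form an arrow: the images of the
  components can be cancelled on either side of the square that they make commute.\<close>

lemma isocomma_iso_iff:
  assumes arr: "((a, b, \<phi>), (a', b', \<phi>'), u, v) \<in> Arr (isocomma A B C F G)"
  shows "iso (isocomma A B C F G) ((a, b, \<phi>), (a', b', \<phi>'), u, v) \<longleftrightarrow> iso A u \<and> iso B v"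
proof
  assume *: "iso (isocomma A B C F G) ((a, b, \<phi>), (a', b', \<phi>'), u, v)"
  obtain s t u' v' where inv: "inv_arr (isocomma A B C F G) ((a, b, \<phi>), (a', b', \<phi>'), u, v)
     = (s, t, u', v')"
    by (metis prod.exhaust)
  show "iso A u \<and> iso B v"
    using I.inv_simps [OF *] arr
    by (auto simp: inv isocomma_simps intro!: A.isoI [of _ u'] B.isoI [of _ v'])
next
  assume iso: "iso A u \<and> iso B v"
  have typed: "u \<in> hom A a a'" "v \<in> hom B b b'" "\<phi> \<in> hom C (FO F a) (FO G b)"
    "\<phi>' \<in> hom C (FO F a') (FO G b')" "iso C \<phi>" "iso C \<phi>'" "a \<in> Obj A" "a' \<in> Obj A"
    "b \<in> Obj B" "b' \<in> Obj B"
    "Comp C (FA G v) \<phi> = Comp C \<phi>' (FA F u)"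
    using arr by (auto simp: isocomma_simps)
  have "iso C (FA F u)" "iso C (FA G v)"
    using iso functor_preserves_iso [OF A.category_axioms C.category_axioms F]
      functor_preserves_iso [OF B.category_axioms C.category_axioms G] by auto
  have "Comp C (FA G v) (Comp C \<phi> (FA F (inv_arr A u)))
      = Comp C (Comp C (FA G v) \<phi>) (FA F (inv_arr A u))"
    using typed(1-10) iso by simp
  also have "\<dots> = Comp C \<phi>' (FA F (Comp A u (inv_arr A u)))"
    unfolding typed(11) using typed(1-10) iso by (subst F_simps(6)) auto
  also have "\<dots> = Comp C (FA G (Comp B v (inv_arr B v))) \<phi>'"
    using typed(1-10) iso by simp
  also have "\<dots> = Comp C (FA G v) (Comp C (FA G (inv_arr B v)) \<phi>')"
    using typed(1-10) iso by (subst G_simps(6)) auto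
  finally have "Comp C \<phi> (FA F (inv_arr A u)) = Comp C (FA G (inv_arr B v)) \<phi>'"
    by (rule C.iso_cancel_left [OF \<open>iso C (FA G v)\<close>, rotated -1]) (use typed(1-10) iso in auto)
  then show "iso (isocomma A B C F G) ((a, b, \<phi>), (a', b', \<phi>'), u, v)"
    using typed iso
    by (intro I.isoI [of _ "((a', b', \<phi>'), (a, b, \<phi>), inv_arr A u, inv_arr B v)"])
       (auto simp: isocomma_simps)
qed

text \<open>Bipullbacks and cartesian 1-cells are both defined by requiring a functor of this form to be an
  equivalence. The right-hand side, which speaks of components only, is the form in which the two
  universal properties are used below: objects lift up to isomorphism, and compatible pairs of
  arrows lift uniquely.\<close>

lemma pairing_equivalence_iff:
  assumes S: "category S" and U: "is_functor S A U" and V: "is_functor S B V"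
    and \<gamma>: "natural_iso S C (comp_fctr F U) (comp_fctr G V) \<gamma>"
  shows "is_equivalence S (isocomma A B C F G) (isocomma_pairing S U V \<gamma>) \<longleftrightarrow>
    (\<forall>a\<in>Obj A. \<forall>b\<in>Obj B. \<forall>\<psi>\<in>hom C (FO F a) (FO G b). iso C \<psi> \<longrightarrow>
       (\<exists>s\<in>Obj S. \<exists>u\<in>hom A (FO U s) a. \<exists>v\<in>hom B (FO V s) b. iso A u \<and> iso B v
          \<and> Comp C (FA G v) (\<gamma> s) = Comp C \<psi> (FA F u))) \<and>
    (\<forall>s\<in>Obj S. \<forall>t\<in>Obj S. \<forall>u\<in>hom A (FO U s) (FO U t). \<forall>v\<in>hom B (FO V s) (FO V t).
       Comp C (FA G v) (\<gamma> s) = Comp C (\<gamma> t) (FA F u) \<longrightarrow>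
       (\<exists>!m. m \<in> hom S s t \<and> FA U m = u \<and> FA V m = v))" (is "?L \<longleftrightarrow> ?ES \<and> ?FF")
proof -
  interpret S: category S by fact
  note [simp] = functor_simps [OF U] functor_simps [OF V]
  have gs [simp]: "\<gamma> s \<in> Arr C" "Dom C (\<gamma> s) = FO F (FO U s)" "Cod C (\<gamma> s) = FO G (FO V s)"
    "iso C (\<gamma> s)" if "s \<in> Obj S" for s
    using \<gamma> that by (auto simp: natural_iso_def comp_fctr_def)
  have gn [simp]: "Comp C (FA G (FA V m)) (\<gamma> (Dom S m)) = Comp C (\<gamma> (Cod S m)) (FA F (FA U m))"
    if "m \<in> Arr S" for m
    using \<gamma> that by (auto simp: natural_iso_def comp_fctr_def)
  have P: "is_functor S (isocomma A B C F G) (isocomma_pairing S U V \<gamma>)"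
    by (rule functorI) (auto simp: pairing_simps isocomma_simps)
  have "ess_surjective S (isocomma A B C F G) (isocomma_pairing S U V \<gamma>) \<longleftrightarrow> ?ES"
  proof
    assume es: "ess_surjective S (isocomma A B C F G) (isocomma_pairing S U V \<gamma>)"
    show ?ES
    proof (intro ballI impI)
      fix a b \<psi> assume *: "a \<in> Obj A" "b \<in> Obj B" "\<psi> \<in> hom C (FO F a) (FO G b)" "iso C \<psi>"
      then have "(a, b, \<psi>) \<in> Obj (isocomma A B C F G)" by (simp add: isocomma_simps)
      then obtain s e where s: "s \<in> Obj S" and e: "e \<in> hom (isocomma A B C F G)
          (FO (isocomma_pairing S U V \<gamma>) s) (a, b, \<psi>)" "iso (isocomma A B C F G) e"
        using es unfolding ess_surjective_def by blast
      obtain e1 e2 u v where e': "e = (e1, e2, u, v)" by (metis prod.exhaust)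
      have e'': "e = ((FO U s, FO V s, \<gamma> s), (a, b, \<psi>), u, v)"
        using e(1) by (auto simp: e' isocomma_simps pairing_simps)
      have "iso A u \<and> iso B v"
        using isocomma_iso_iff e unfolding e'' by auto
      then show "\<exists>s\<in>Obj S. \<exists>u\<in>hom A (FO U s) a. \<exists>v\<in>hom B (FO V s) b. iso A u \<and> iso B v
          \<and> Comp C (FA G v) (\<gamma> s) = Comp C \<psi> (FA F u)"
        using e(1) s unfolding e'' by (intro bexI [of _ s] bexI [of _ u] bexI [of _ v])
          (auto simp: isocomma_simps)
    qed
  next
    assume es: ?ES
    show "ess_surjective S (isocomma A B C F G) (isocomma_pairing S U V \<gamma>)"
      unfolding ess_surjective_def
    proof
      fix d assume d: "d \<in> Obj (isocomma A B C F G)"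
      obtain a b \<psi> where d': "d = (a, b, \<psi>)" by (metis prod.exhaust)
      have *: "a \<in> Obj A" "b \<in> Obj B" "\<psi> \<in> hom C (FO F a) (FO G b)" "iso C \<psi>"
        using d by (auto simp: d' isocomma_simps)
      obtain s u v where suv: "s \<in> Obj S" "u \<in> hom A (FO U s) a" "v \<in> hom B (FO V s) b"
          "iso A u" "iso B v" "Comp C (FA G v) (\<gamma> s) = Comp C \<psi> (FA F u)"
        using es * by blast
      then have "((FO U s, FO V s, \<gamma> s), (a, b, \<psi>), u, v) \<in> Arr (isocomma A B C F G)"
        using * by (auto simp: isocomma_simps)
      moreover from this have "iso (isocomma A B C F G) ((FO U s, FO V s, \<gamma> s), (a, b, \<psi>), u, v)"
        using isocomma_iso_iff suv by blast
      ultimately show "\<exists>c\<in>Obj S. \<exists>e\<in>hom (isocomma A B C F G) (FO (isocomma_pairing S U V \<gamma>) c) d.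
          iso (isocomma A B C F G) e"
        using suv(1) by (intro bexI [of _ s] bexI [of _ "((FO U s, FO V s, \<gamma> s), (a, b, \<psi>), u, v)"])
          (auto simp: isocomma_simps pairing_simps d')
    qed
  qed
  moreover have "fully_faithful S (isocomma A B C F G) (isocomma_pairing S U V \<gamma>) \<longleftrightarrow> ?FF"
  proof -
    have eq: "(\<exists>!m. m \<in> hom S s t \<and> FA (isocomma_pairing S U V \<gamma>) m
          = ((FO U s, FO V s, \<gamma> s), (FO U t, FO V t, \<gamma> t), u, v))
        \<longleftrightarrow> (\<exists>!m. m \<in> hom S s t \<and> FA U m = u \<and> FA V m = v)" for s t u v
      by (rule arg_cong [of _ _ Ex1]) (auto simp: pairing_simps)
    have ar: "n \<in> hom (isocomma A B C F G) (FO (isocomma_pairing S U V \<gamma>) s)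
          (FO (isocomma_pairing S U V \<gamma>) t) \<longleftrightarrow>
        (\<exists>u v. n = ((FO U s, FO V s, \<gamma> s), (FO U t, FO V t, \<gamma> t), u, v) \<and>
          u \<in> hom A (FO U s) (FO U t) \<and> v \<in> hom B (FO V s) (FO V t) \<and>
          Comp C (FA G v) (\<gamma> s) = Comp C (\<gamma> t) (FA F u))"
      if "s \<in> Obj S" "t \<in> Obj S" for s t n
      using that by (cases n) (auto simp: isocomma_simps pairing_simps)
    show ?thesis
      unfolding fully_faithful_def
    proof (intro ball_cong refl, goal_cases)
      case (1 s t)
      show ?case (is "(\<forall>n\<in>?H. ?X n) \<longleftrightarrow> ?Y")
      proof
        assume X: "\<forall>n\<in>?H. ?X n"
        show ?Y
        proof (intro ballI impI)
          fix u v assume "u \<in> hom A (FO U s) (FO U t)" "v \<in> hom B (FO V s) (FO V t)"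
            "Comp C (FA G v) (\<gamma> s) = Comp C (\<gamma> t) (FA F u)"
          then have "((FO U s, FO V s, \<gamma> s), (FO U t, FO V t, \<gamma> t), u, v) \<in> ?H"
            unfolding ar [OF 1] by blast
          with X show "\<exists>!m. m \<in> hom S s t \<and> FA U m = u \<and> FA V m = v"
            unfolding eq [symmetric] by (rule bspec)
        qed
      next
        assume Y: ?Y
        show "\<forall>n\<in>?H. ?X n"
        proof
          fix n assume "n \<in> ?H"
          then obtain u v where n: "n = ((FO U s, FO V s, \<gamma> s), (FO U t, FO V t, \<gamma> t), u, v)"
            and uv: "u \<in> hom A (FO U s) (FO U t)" "v \<in> hom B (FO V s) (FO V t)"
              "Comp C (FA G v) (\<gamma> s) = Comp C (\<gamma> t) (FA F u)"
            unfolding ar [OF 1] by blast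
          show "?X n" unfolding n eq by (rule Y [rule_format, OF uv])
        qed
      qed
    qed
  qed
  ultimately show ?thesis
    unfolding equivalence_iff_ff_es [OF S category_isocomma] using P by blast
qed

end

section \<open>Whiskering in a strict 2-category\<close>

text \<open>The rewrite rules bring a pasting diagram into the normal form of a vertical composite,
  associated to the right, whose factors are 2-cells under iterated whiskering. The interchange
  law remains as an explicit step. The 0-cells bounding a 2-cell are read off from its domain.\<close>

context two_category
begin

sublocale H: category "C1 K" by (rule category_C1)
sublocale V: category "C2 K" by (rule category_C2)

lemma Obj_C2' [simp]: "Obj (C2 K) = Arr (C1 K)" by (rule Obj_C2)

lemma arr_dom2 [simp]: "\<alpha> \<in> Arr (C2 K) \<Longrightarrow> Dom (C2 K) \<alpha> \<in> Arr (C1 K)"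
  and arr_cod2 [simp]: "\<alpha> \<in> Arr (C2 K) \<Longrightarrow> Cod (C2 K) \<alpha> \<in> Arr (C1 K)"
  using V.dom_Obj V.cod_Obj by simp_all

lemma parallel' [simp]:
  assumes "\<alpha> \<in> Arr (C2 K)"
  shows "Dom (C1 K) (Cod (C2 K) \<alpha>) = Dom (C1 K) (Dom (C2 K) \<alpha>)"
    "Cod (C1 K) (Cod (C2 K) \<alpha>) = Cod (C1 K) (Dom (C2 K) \<alpha>)"
  using parallel [of \<alpha>] assms by simp_all

lemma hcomp_simps [simp]:
  assumes "\<alpha> \<in> Arr (C2 K)" "\<beta> \<in> Arr (C2 K)"
    "Cod (C1 K) (Dom (C2 K) \<alpha>) = Dom (C1 K) (Dom (C2 K) \<beta>)"
  shows "\<beta> \<star>\<^bsub>K\<^esub> \<alpha> \<in> Arr (C2 K)"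
    "Dom (C2 K) (\<beta> \<star>\<^bsub>K\<^esub> \<alpha>) = Dom (C2 K) \<beta> \<cdot>\<^bsub>K\<^esub> Dom (C2 K) \<alpha>"
    "Cod (C2 K) (\<beta> \<star>\<^bsub>K\<^esub> \<alpha>) = Cod (C2 K) \<beta> \<cdot>\<^bsub>K\<^esub> Cod (C2 K) \<alpha>"
  using hcomp_hom [of "Dom (C2 K) \<alpha>" _ _ "Dom (C2 K) \<beta>" _ \<alpha> "Cod (C2 K) \<alpha>" \<beta> "Cod (C2 K) \<beta>"] assms
  by simp_all

lemma hcomp_id2' [simp]:
  assumes "f \<in> Arr (C1 K)" "g \<in> Arr (C1 K)" "Cod (C1 K) f = Dom (C1 K) g"
  shows "g \<lhd>\<^bsub>K\<^esub> id2 K f = id2 K (g \<cdot>\<^bsub>K\<^esub> f)"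
  using hcomp_id2 [of f _ _ g] assms by simp

lemma interchange':
  assumes "\<alpha> \<in> Arr (C2 K)" "\<alpha>' \<in> Arr (C2 K)" "\<beta> \<in> Arr (C2 K)" "\<beta>' \<in> Arr (C2 K)"
    "Cod (C2 K) \<alpha> = Dom (C2 K) \<alpha>'" "Cod (C2 K) \<beta> = Dom (C2 K) \<beta>'"
    "Cod (C1 K) (Dom (C2 K) \<alpha>) = Dom (C1 K) (Dom (C2 K) \<beta>)"
  shows "(\<beta>' \<star>\<^bsub>K\<^esub> \<alpha>') \<bullet>\<^bsub>K\<^esub> (\<beta> \<star>\<^bsub>K\<^esub> \<alpha>) = (\<beta>' \<bullet>\<^bsub>K\<^esub> \<beta>) \<star>\<^bsub>K\<^esub> (\<alpha>' \<bullet>\<^bsub>K\<^esub> \<alpha>)"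
  using assms
  by (intro interchange [of "Dom (C2 K) \<alpha>" _ _ "Dom (C2 K) \<beta>", symmetric]) auto

lemma hcomp_unit [simp]:
  assumes "\<alpha> \<in> Arr (C2 K)"
  shows "a = Dom (C1 K) (Dom (C2 K) \<alpha>) \<Longrightarrow> \<alpha> \<rhd>\<^bsub>K\<^esub> id1 K a = \<alpha>"
    "b = Cod (C1 K) (Dom (C2 K) \<alpha>) \<Longrightarrow> id1 K b \<lhd>\<^bsub>K\<^esub> \<alpha> = \<alpha>"
  using hcomp_unit_right [of "Dom (C2 K) \<alpha>"] hcomp_unit_left [of "Dom (C2 K) \<alpha>"] assms by simp_all

lemma hcomp_assoc' [simp]:
  assumes "\<alpha> \<in> Arr (C2 K)" "\<beta> \<in> Arr (C2 K)" "\<gamma> \<in> Arr (C2 K)"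
    "Cod (C1 K) (Dom (C2 K) \<alpha>) = Dom (C1 K) (Dom (C2 K) \<beta>)"
    "Cod (C1 K) (Dom (C2 K) \<beta>) = Dom (C1 K) (Dom (C2 K) \<gamma>)"
  shows "(\<gamma> \<star>\<^bsub>K\<^esub> \<beta>) \<star>\<^bsub>K\<^esub> \<alpha> = \<gamma> \<star>\<^bsub>K\<^esub> \<beta> \<star>\<^bsub>K\<^esub> \<alpha>"
  using assms
  by (intro hcomp_assoc [of "Dom (C2 K) \<alpha>" _ _ "Dom (C2 K) \<beta>" _ "Dom (C2 K) \<gamma>", symmetric]) auto

lemma postwhisker_assoc [simp]:
  assumes "\<alpha> \<in> Arr (C2 K)" "f \<in> Arr (C1 K)" "g \<in> Arr (C1 K)"
    "Cod (C1 K) (Dom (C2 K) \<alpha>) = Dom (C1 K) f" "Cod (C1 K) f = Dom (C1 K) g"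
  shows "(g \<cdot>\<^bsub>K\<^esub> f) \<lhd>\<^bsub>K\<^esub> \<alpha> = g \<lhd>\<^bsub>K\<^esub> f \<lhd>\<^bsub>K\<^esub> \<alpha>"
  using assms by (simp flip: hcomp_id2')

lemma postwhisker_vcomp [simp]:
  assumes "\<alpha> \<in> Arr (C2 K)" "\<beta> \<in> Arr (C2 K)" "Cod (C2 K) \<alpha> = Dom (C2 K) \<beta>" "f \<in> Arr (C1 K)"
    "Cod (C1 K) (Dom (C2 K) \<alpha>) = Dom (C1 K) f"
  shows "f \<lhd>\<^bsub>K\<^esub> (\<beta> \<bullet>\<^bsub>K\<^esub> \<alpha>) = (f \<lhd>\<^bsub>K\<^esub> \<beta>) \<bullet>\<^bsub>K\<^esub> (f \<lhd>\<^bsub>K\<^esub> \<alpha>)"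
  using assms by (simp add: interchange')

lemma prewhisker_vcomp [simp]:
  assumes "\<alpha> \<in> Arr (C2 K)" "\<beta> \<in> Arr (C2 K)" "Cod (C2 K) \<alpha> = Dom (C2 K) \<beta>" "f \<in> Arr (C1 K)"
    "Dom (C1 K) (Dom (C2 K) \<alpha>) = Cod (C1 K) f"
  shows "(\<beta> \<bullet>\<^bsub>K\<^esub> \<alpha>) \<rhd>\<^bsub>K\<^esub> f = (\<beta> \<rhd>\<^bsub>K\<^esub> f) \<bullet>\<^bsub>K\<^esub> (\<alpha> \<rhd>\<^bsub>K\<^esub> f)"
  using assms by (simp add: interchange')

text \<open>The form in which interchange is used: it slides one 2-cell past another in a normal form.\<close>

lemma whisker_exchange:
  assumes "\<alpha> \<in> Arr (C2 K)" "\<beta> \<in> Arr (C2 K)"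
    "Cod (C1 K) (Dom (C2 K) \<alpha>) = Dom (C1 K) (Dom (C2 K) \<beta>)"
    "Dom (C2 K) \<alpha> = f" "Cod (C2 K) \<alpha> = f'" "Dom (C2 K) \<beta> = g" "Cod (C2 K) \<beta> = g'"
  shows "(\<beta> \<rhd>\<^bsub>K\<^esub> f') \<bullet>\<^bsub>K\<^esub> (g \<lhd>\<^bsub>K\<^esub> \<alpha>) = (g' \<lhd>\<^bsub>K\<^esub> \<alpha>) \<bullet>\<^bsub>K\<^esub> (\<beta> \<rhd>\<^bsub>K\<^esub> f)"
  unfolding assms(4-7) [symmetric] using assms(1-3) by (simp add: interchange')

lemma postwhisker_iso [simp]:
  assumes "iso (C2 K) \<alpha>" "f \<in> Arr (C1 K)" "Cod (C1 K) (Dom (C2 K) \<alpha>) = Dom (C1 K) f"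
  shows "iso (C2 K) (f \<lhd>\<^bsub>K\<^esub> \<alpha>)" "inv_arr (C2 K) (f \<lhd>\<^bsub>K\<^esub> \<alpha>) = f \<lhd>\<^bsub>K\<^esub> inv_arr (C2 K) \<alpha>"
proof -
  have "inverse_arrs (C2 K) (f \<lhd>\<^bsub>K\<^esub> \<alpha>) (f \<lhd>\<^bsub>K\<^esub> inv_arr (C2 K) \<alpha>)"
    using assms V.iso_arr [OF assms(1)] by (simp add: inverse_arrs_def interchange')
  then show "iso (C2 K) (f \<lhd>\<^bsub>K\<^esub> \<alpha>)" "inv_arr (C2 K) (f \<lhd>\<^bsub>K\<^esub> \<alpha>) = f \<lhd>\<^bsub>K\<^esub> inv_arr (C2 K) \<alpha>"
    using V.inv_eqI by (auto simp: iso_def)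
qed

lemma prewhisker_iso [simp]:
  assumes "iso (C2 K) \<alpha>" "f \<in> Arr (C1 K)" "Dom (C1 K) (Dom (C2 K) \<alpha>) = Cod (C1 K) f"
  shows "iso (C2 K) (\<alpha> \<rhd>\<^bsub>K\<^esub> f)" "inv_arr (C2 K) (\<alpha> \<rhd>\<^bsub>K\<^esub> f) = inv_arr (C2 K) \<alpha> \<rhd>\<^bsub>K\<^esub> f"
proof -
  have "inverse_arrs (C2 K) (\<alpha> \<rhd>\<^bsub>K\<^esub> f) (inv_arr (C2 K) \<alpha> \<rhd>\<^bsub>K\<^esub> f)"
    using assms V.iso_arr [OF assms(1)] by (simp add: inverse_arrs_def interchange')
  then show "iso (C2 K) (\<alpha> \<rhd>\<^bsub>K\<^esub> f)" "inv_arr (C2 K) (\<alpha> \<rhd>\<^bsub>K\<^esub> f) = inv_arr (C2 K) \<alpha> \<rhd>\<^bsub>K\<^esub> f"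
    using V.inv_eqI by (auto simp: iso_def)
qed

lemma homcat_simps [simp]:
  "Obj (homcat K a b) = hom1 K a b"
  "\<alpha> \<in> Arr (homcat K a b) \<longleftrightarrow> \<alpha> \<in> Arr (C2 K) \<and> Dom (C1 K) (Dom (C2 K) \<alpha>) = a \<and>
     Cod (C1 K) (Dom (C2 K) \<alpha>) = b"
  "Dom (homcat K a b) = Dom (C2 K)" "Cod (homcat K a b) = Cod (C2 K)"
  "Ide (homcat K a b) = id2 K" "Comp (homcat K a b) = Comp (C2 K)"
  by (auto simp: homcat_def)

lemma category_homcat: "category (homcat K a b)"
  by standard auto

lemma iso_homcat_iff [simp]:
  "iso (homcat K a b) \<alpha> \<longleftrightarrow> iso (C2 K) \<alpha> \<and> Dom (C1 K) (Dom (C2 K) \<alpha>) = a \<and>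
     Cod (C1 K) (Dom (C2 K) \<alpha>) = b"
proof
  interpret L: category "homcat K a b" by (rule category_homcat)
  assume *: "iso (homcat K a b) \<alpha>"
  show "iso (C2 K) \<alpha> \<and> Dom (C1 K) (Dom (C2 K) \<alpha>) = a \<and> Cod (C1 K) (Dom (C2 K) \<alpha>) = b"
    using L.iso_arr [OF *] L.inv_simps [OF *] by (auto intro: V.isoI)
next
  interpret L: category "homcat K a b" by (rule category_homcat)
  assume *: "iso (C2 K) \<alpha> \<and> Dom (C1 K) (Dom (C2 K) \<alpha>) = a \<and> Cod (C1 K) (Dom (C2 K) \<alpha>) = b"
  then show "iso (homcat K a b) \<alpha>"
    using V.iso_arr [of \<alpha>] parallel' [of "inv_arr (C2 K) \<alpha>"]
    by (intro L.isoI [of _ "inv_arr (C2 K) \<alpha>"]) auto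
qed

lemma postcomp_functor:
  assumes "f \<in> Arr (C1 K)" "Dom (C1 K) f = a" "Cod (C1 K) f = b"
  shows "is_functor (homcat K w a) (homcat K w b) (postcomp K f)"
  by (rule functorI) (use assms in \<open>auto simp: postcomp_def\<close>)

end

section \<open>Bipullbacks\<close>

context two_category
begin

lemma hom_homcat [simp]:
  "f \<in> hom1 K a b \<Longrightarrow> hom (homcat K a b) f g = hom2 K f g"
  by (auto simp: hom_def)

lemma bipullback_iff:
  "bipullback K f g p d0 d1 \<phi> \<longleftrightarrow>
     f \<in> Arr (C1 K) \<and> g \<in> Arr (C1 K) \<and> Cod (C1 K) f = Cod (C1 K) g
   \<and> p \<in> Obj (C1 K) \<and> d0 \<in> hom1 K p (Dom (C1 K) f) \<and> d1 \<in> hom1 K p (Dom (C1 K) g)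
   \<and> \<phi> \<in> hom2 K (f \<cdot>\<^bsub>K\<^esub> d0) (g \<cdot>\<^bsub>K\<^esub> d1) \<and> iso (C2 K) \<phi>
   \<and> (\<forall>X\<in>Obj (C1 K).
       (\<forall>a\<in>hom1 K X (Dom (C1 K) f). \<forall>b\<in>hom1 K X (Dom (C1 K) g).
        \<forall>\<psi>\<in>hom2 K (f \<cdot>\<^bsub>K\<^esub> a) (g \<cdot>\<^bsub>K\<^esub> b). iso (C2 K) \<psi> \<longrightarrow>
          (\<exists>h\<in>hom1 K X p. \<exists>u\<in>hom2 K (d0 \<cdot>\<^bsub>K\<^esub> h) a. \<exists>v\<in>hom2 K (d1 \<cdot>\<^bsub>K\<^esub> h) b.
             iso (C2 K) u \<and> iso (C2 K) v \<and> (g \<lhd>\<^bsub>K\<^esub> v) \<bullet>\<^bsub>K\<^esub> (\<phi> \<rhd>\<^bsub>K\<^esub> h) = \<psi> \<bullet>\<^bsub>K\<^esub> (f \<lhd>\<^bsub>K\<^esub> u))) \<and>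
       (\<forall>h\<in>hom1 K X p. \<forall>h'\<in>hom1 K X p.
        \<forall>u\<in>hom2 K (d0 \<cdot>\<^bsub>K\<^esub> h) (d0 \<cdot>\<^bsub>K\<^esub> h'). \<forall>v\<in>hom2 K (d1 \<cdot>\<^bsub>K\<^esub> h) (d1 \<cdot>\<^bsub>K\<^esub> h').
          (g \<lhd>\<^bsub>K\<^esub> v) \<bullet>\<^bsub>K\<^esub> (\<phi> \<rhd>\<^bsub>K\<^esub> h) = (\<phi> \<rhd>\<^bsub>K\<^esub> h') \<bullet>\<^bsub>K\<^esub> (f \<lhd>\<^bsub>K\<^esub> u) \<longrightarrow>
          (\<exists>!m. m \<in> hom2 K h h' \<and> d0 \<lhd>\<^bsub>K\<^esub> m = u \<and> d1 \<lhd>\<^bsub>K\<^esub> m = v)))"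
  (is "_ \<longleftrightarrow> ?T1 \<and> ?T2 \<and> ?T3 \<and> ?T4 \<and> ?T5 \<and> ?T6 \<and> ?T7 \<and> ?T8 \<and> (\<forall>X\<in>Obj (C1 K). ?ES X \<and> ?FF X)")
proof -
  have *: "is_equivalence (homcat K X p)
          (isocomma (homcat K X (Dom (C1 K) f)) (homcat K X (Dom (C1 K) g))
             (homcat K X (Cod (C1 K) f)) (postcomp K f) (postcomp K g))
          (isocomma_pairing (homcat K X p) (postcomp K d0) (postcomp K d1) (\<lambda>h. \<phi> \<rhd>\<^bsub>K\<^esub> h))
        \<longleftrightarrow> ?ES X \<and> ?FF X"
    if ty: "?T1" "?T2" "?T3" "?T4" "?T5" "?T6" "?T7" "?T8" and X: "X \<in> Obj (C1 K)" for X
  proof -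
    interpret functor_cospan "homcat K X (Dom (C1 K) f)" "homcat K X (Dom (C1 K) g)"
        "homcat K X (Cod (C1 K) f)" "postcomp K f" "postcomp K g"
      using ty by (auto intro!: functor_cospan.intro functor_cospan_axioms.intro
          category_homcat postcomp_functor)
    have nat: "natural_iso (homcat K X p) (homcat K X (Cod (C1 K) f))
        (comp_fctr (postcomp K f) (postcomp K d0)) (comp_fctr (postcomp K g) (postcomp K d1))
        (\<lambda>h. \<phi> \<rhd>\<^bsub>K\<^esub> h)"
      using ty by (auto simp: natural_iso_def comp_fctr_def postcomp_def whisker_exchange
          simp flip: postwhisker_assoc)
    show ?thesis
      apply (subst pairing_equivalence_iff [OF category_homcat _ _ nat])
        apply (use ty in \<open>simp add: postcomp_functor\<close>)
       apply (use ty in \<open>simp add: postcomp_functor\<close>)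
      unfolding postcomp_def fctr.select_convs homcat_simps
      by (intro refl conj_cong ball_cong bex_cong imp_cong) (use ty in simp_all)
  qed
  show ?thesis
    unfolding bipullback_def by (intro conj_cong ball_cong refl) (rule *)
qed

lemma bipullback_typing:
  assumes "bipullback K f g p d0 d1 \<phi>"
  shows "f \<in> Arr (C1 K)" "g \<in> Arr (C1 K)" "Cod (C1 K) f = Cod (C1 K) g" "p \<in> Obj (C1 K)"
    "d0 \<in> Arr (C1 K)" "Dom (C1 K) d0 = p" "Cod (C1 K) d0 = Dom (C1 K) f"
    "d1 \<in> Arr (C1 K)" "Dom (C1 K) d1 = p" "Cod (C1 K) d1 = Dom (C1 K) g"
    "\<phi> \<in> Arr (C2 K)" "Dom (C2 K) \<phi> = f \<cdot>\<^bsub>K\<^esub> d0" "Cod (C2 K) \<phi> = g \<cdot>\<^bsub>K\<^esub> d1" "iso (C2 K) \<phi>"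
  using assms by (auto simp: bipullback_iff)

lemma bipullback_lift:
  assumes "bipullback K f g p d0 d1 \<phi>" "a \<in> hom1 K X (Dom (C1 K) f)" "b \<in> hom1 K X (Dom (C1 K) g)"
    "\<psi> \<in> hom2 K (f \<cdot>\<^bsub>K\<^esub> a) (g \<cdot>\<^bsub>K\<^esub> b)" "iso (C2 K) \<psi>"
  obtains h u v where "h \<in> hom1 K X p" "u \<in> hom2 K (d0 \<cdot>\<^bsub>K\<^esub> h) a" "v \<in> hom2 K (d1 \<cdot>\<^bsub>K\<^esub> h) b"
    "iso (C2 K) u" "iso (C2 K) v" "(g \<lhd>\<^bsub>K\<^esub> v) \<bullet>\<^bsub>K\<^esub> (\<phi> \<rhd>\<^bsub>K\<^esub> h) = \<psi> \<bullet>\<^bsub>K\<^esub> (f \<lhd>\<^bsub>K\<^esub> u)"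
proof -
  have "X \<in> Obj (C1 K)" using assms(2) by auto
  then show ?thesis
    using assms(1) [unfolded bipullback_iff, THEN conjunct2, THEN conjunct2, THEN conjunct2,
        THEN conjunct2, THEN conjunct2, THEN conjunct2, THEN conjunct2, THEN conjunct2, THEN bspec,
        THEN conjunct1, rule_format, OF _ assms(2-5)] that by blast
qed

lemma bipullback_ex1:
  assumes "bipullback K f g p d0 d1 \<phi>" "h \<in> hom1 K X p" "h' \<in> hom1 K X p"
    "u \<in> hom2 K (d0 \<cdot>\<^bsub>K\<^esub> h) (d0 \<cdot>\<^bsub>K\<^esub> h')" "v \<in> hom2 K (d1 \<cdot>\<^bsub>K\<^esub> h) (d1 \<cdot>\<^bsub>K\<^esub> h')"
    "(g \<lhd>\<^bsub>K\<^esub> v) \<bullet>\<^bsub>K\<^esub> (\<phi> \<rhd>\<^bsub>K\<^esub> h) = (\<phi> \<rhd>\<^bsub>K\<^esub> h') \<bullet>\<^bsub>K\<^esub> (f \<lhd>\<^bsub>K\<^esub> u)"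
  shows "\<exists>!m. m \<in> hom2 K h h' \<and> d0 \<lhd>\<^bsub>K\<^esub> m = u \<and> d1 \<lhd>\<^bsub>K\<^esub> m = v"
proof -
  have "X \<in> Obj (C1 K)" using assms(2) by auto
  then show ?thesis
    by (rule assms(1) [unfolded bipullback_iff, THEN conjunct2, THEN conjunct2, THEN conjunct2,
        THEN conjunct2, THEN conjunct2, THEN conjunct2, THEN conjunct2, THEN conjunct2, THEN bspec,
        THEN conjunct2, rule_format, OF _ assms(2-6)])
qed

text \<open>The pair of whiskered 2-cells satisfies the compatibility condition automatically, by
  interchange with \<open>\<phi>\<close>, so the uniqueness half of the universal property applies to it.\<close>

lemma bipullback_faithful:
  assumes bp: "bipullback K f g p d0 d1 \<phi>" and h: "h \<in> hom1 K X p" "h' \<in> hom1 K X p"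
    and m: "m \<in> hom2 K h h'" "m' \<in> hom2 K h h'"
    and eq: "d0 \<lhd>\<^bsub>K\<^esub> m = d0 \<lhd>\<^bsub>K\<^esub> m'" "d1 \<lhd>\<^bsub>K\<^esub> m = d1 \<lhd>\<^bsub>K\<^esub> m'"
  shows "m = m'"
proof -
  note [simp] = bipullback_typing [OF bp]
  have "(g \<lhd>\<^bsub>K\<^esub> d1 \<lhd>\<^bsub>K\<^esub> m) \<bullet>\<^bsub>K\<^esub> (\<phi> \<rhd>\<^bsub>K\<^esub> h) = (\<phi> \<rhd>\<^bsub>K\<^esub> h') \<bullet>\<^bsub>K\<^esub> (f \<lhd>\<^bsub>K\<^esub> d0 \<lhd>\<^bsub>K\<^esub> m)"
    using h m whisker_exchange [of m \<phi> h h' "f \<cdot>\<^bsub>K\<^esub> d0" "g \<cdot>\<^bsub>K\<^esub> d1"] by simp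
  then have "\<exists>!n. n \<in> hom2 K h h' \<and> d0 \<lhd>\<^bsub>K\<^esub> n = d0 \<lhd>\<^bsub>K\<^esub> m \<and> d1 \<lhd>\<^bsub>K\<^esub> n = d1 \<lhd>\<^bsub>K\<^esub> m"
    using h m by (intro bipullback_ex1 [OF bp h]) auto
  then show ?thesis
    using m eq by (metis (no_types, lifting))
qed

lemma bipullback_lift2:
  assumes "bipullback K f g p d0 d1 \<phi>" "h \<in> hom1 K X p" "h' \<in> hom1 K X p"
    "u \<in> hom2 K (d0 \<cdot>\<^bsub>K\<^esub> h) (d0 \<cdot>\<^bsub>K\<^esub> h')" "v \<in> hom2 K (d1 \<cdot>\<^bsub>K\<^esub> h) (d1 \<cdot>\<^bsub>K\<^esub> h')"
    "(g \<lhd>\<^bsub>K\<^esub> v) \<bullet>\<^bsub>K\<^esub> (\<phi> \<rhd>\<^bsub>K\<^esub> h) = (\<phi> \<rhd>\<^bsub>K\<^esub> h') \<bullet>\<^bsub>K\<^esub> (f \<lhd>\<^bsub>K\<^esub> u)"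
  obtains m where "m \<in> hom2 K h h'" "d0 \<lhd>\<^bsub>K\<^esub> m = u" "d1 \<lhd>\<^bsub>K\<^esub> m = v"
  using bipullback_ex1 [OF assms] by blast

lemma bipullback_reflects_iso:
  assumes bp: "bipullback K f g p d0 d1 \<phi>" and h: "h \<in> hom1 K X p" "h' \<in> hom1 K X p"
    and m: "m \<in> hom2 K h h'" and "iso (C2 K) (d0 \<lhd>\<^bsub>K\<^esub> m)" "iso (C2 K) (d1 \<lhd>\<^bsub>K\<^esub> m)"
  shows "iso (C2 K) m"
proof -
  note [simp] = bipullback_typing [OF bp] V.iso_arr
  have hm [simp]: "h \<in> Arr (C1 K)" "Dom (C1 K) h = X" "Cod (C1 K) h = p"
    "h' \<in> Arr (C1 K)" "Dom (C1 K) h' = X" "Cod (C1 K) h' = p"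
    "m \<in> Arr (C2 K)" "Dom (C2 K) m = h" "Cod (C2 K) m = h'"
    using h m by auto
  let ?u = "inv_arr (C2 K) (d0 \<lhd>\<^bsub>K\<^esub> m)" and ?v = "inv_arr (C2 K) (d1 \<lhd>\<^bsub>K\<^esub> m)"
  have ex: "(\<phi> \<rhd>\<^bsub>K\<^esub> h') \<bullet>\<^bsub>K\<^esub> (f \<lhd>\<^bsub>K\<^esub> d0 \<lhd>\<^bsub>K\<^esub> m) = (g \<lhd>\<^bsub>K\<^esub> d1 \<lhd>\<^bsub>K\<^esub> m) \<bullet>\<^bsub>K\<^esub> (\<phi> \<rhd>\<^bsub>K\<^esub> h)"
    using whisker_exchange [of m \<phi> h h' "f \<cdot>\<^bsub>K\<^esub> d0" "g \<cdot>\<^bsub>K\<^esub> d1"] by simp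
  have inv: "(f \<lhd>\<^bsub>K\<^esub> d0 \<lhd>\<^bsub>K\<^esub> m) \<bullet>\<^bsub>K\<^esub> (f \<lhd>\<^bsub>K\<^esub> ?u) = id2 K (f \<cdot>\<^bsub>K\<^esub> d0 \<cdot>\<^bsub>K\<^esub> h')"
    "(g \<lhd>\<^bsub>K\<^esub> ?v) \<bullet>\<^bsub>K\<^esub> (g \<lhd>\<^bsub>K\<^esub> d1 \<lhd>\<^bsub>K\<^esub> m) = id2 K (g \<cdot>\<^bsub>K\<^esub> d1 \<cdot>\<^bsub>K\<^esub> h)"
    using assms(5,6) by (simp_all flip: postwhisker_vcomp)
  have "(g \<lhd>\<^bsub>K\<^esub> ?v) \<bullet>\<^bsub>K\<^esub> (\<phi> \<rhd>\<^bsub>K\<^esub> h')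
      = (g \<lhd>\<^bsub>K\<^esub> ?v) \<bullet>\<^bsub>K\<^esub> ((\<phi> \<rhd>\<^bsub>K\<^esub> h') \<bullet>\<^bsub>K\<^esub> (f \<lhd>\<^bsub>K\<^esub> d0 \<lhd>\<^bsub>K\<^esub> m)) \<bullet>\<^bsub>K\<^esub> (f \<lhd>\<^bsub>K\<^esub> ?u)"
    using inv assms(5,6) by simp
  also have "\<dots> = ((g \<lhd>\<^bsub>K\<^esub> ?v) \<bullet>\<^bsub>K\<^esub> (g \<lhd>\<^bsub>K\<^esub> d1 \<lhd>\<^bsub>K\<^esub> m)) \<bullet>\<^bsub>K\<^esub> (\<phi> \<rhd>\<^bsub>K\<^esub> h) \<bullet>\<^bsub>K\<^esub> (f \<lhd>\<^bsub>K\<^esub> ?u)"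
    unfolding ex using assms(5,6) by simp
  also have "\<dots> = (\<phi> \<rhd>\<^bsub>K\<^esub> h) \<bullet>\<^bsub>K\<^esub> (f \<lhd>\<^bsub>K\<^esub> ?u)"
    unfolding inv using assms(5,6) by simp
  finally have "(g \<lhd>\<^bsub>K\<^esub> ?v) \<bullet>\<^bsub>K\<^esub> (\<phi> \<rhd>\<^bsub>K\<^esub> h') = (\<phi> \<rhd>\<^bsub>K\<^esub> h) \<bullet>\<^bsub>K\<^esub> (f \<lhd>\<^bsub>K\<^esub> ?u)" .
  then obtain n where n: "n \<in> hom2 K h' h" "d0 \<lhd>\<^bsub>K\<^esub> n = ?u" "d1 \<lhd>\<^bsub>K\<^esub> n = ?v"
    using assms(5,6) by (auto intro: bipullback_lift2 [OF bp h(2,1), of ?u ?v])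
  have "n \<bullet>\<^bsub>K\<^esub> m = id2 K h"
    by (rule bipullback_faithful [OF bp h(1,1)]) (use n assms(5,6) in simp_all)
  moreover have "m \<bullet>\<^bsub>K\<^esub> n = id2 K h'"
    by (rule bipullback_faithful [OF bp h(2,2)]) (use n assms(5,6) in simp_all)
  ultimately show ?thesis
    using n by (intro V.isoI [of _ n]) auto
qed

lemma bipullbackI:
  assumes "f \<in> Arr (C1 K)" "g \<in> Arr (C1 K)" "Cod (C1 K) f = Cod (C1 K) g"
    "p \<in> Obj (C1 K)" "d0 \<in> hom1 K p (Dom (C1 K) f)" "d1 \<in> hom1 K p (Dom (C1 K) g)"
    "\<phi> \<in> hom2 K (f \<cdot>\<^bsub>K\<^esub> d0) (g \<cdot>\<^bsub>K\<^esub> d1)" "iso (C2 K) \<phi>"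
    and es: "\<And>X a b \<psi>. \<lbrakk>a \<in> hom1 K X (Dom (C1 K) f); b \<in> hom1 K X (Dom (C1 K) g);
        \<psi> \<in> hom2 K (f \<cdot>\<^bsub>K\<^esub> a) (g \<cdot>\<^bsub>K\<^esub> b); iso (C2 K) \<psi>\<rbrakk> \<Longrightarrow>
          \<exists>h\<in>hom1 K X p. \<exists>u\<in>hom2 K (d0 \<cdot>\<^bsub>K\<^esub> h) a. \<exists>v\<in>hom2 K (d1 \<cdot>\<^bsub>K\<^esub> h) b.
             iso (C2 K) u \<and> iso (C2 K) v \<and> (g \<lhd>\<^bsub>K\<^esub> v) \<bullet>\<^bsub>K\<^esub> (\<phi> \<rhd>\<^bsub>K\<^esub> h) = \<psi> \<bullet>\<^bsub>K\<^esub> (f \<lhd>\<^bsub>K\<^esub> u)"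
    and ff: "\<And>X h h' u v. \<lbrakk>h \<in> hom1 K X p; h' \<in> hom1 K X p;
        u \<in> hom2 K (d0 \<cdot>\<^bsub>K\<^esub> h) (d0 \<cdot>\<^bsub>K\<^esub> h'); v \<in> hom2 K (d1 \<cdot>\<^bsub>K\<^esub> h) (d1 \<cdot>\<^bsub>K\<^esub> h');
        (g \<lhd>\<^bsub>K\<^esub> v) \<bullet>\<^bsub>K\<^esub> (\<phi> \<rhd>\<^bsub>K\<^esub> h) = (\<phi> \<rhd>\<^bsub>K\<^esub> h') \<bullet>\<^bsub>K\<^esub> (f \<lhd>\<^bsub>K\<^esub> u)\<rbrakk> \<Longrightarrow>
          \<exists>!m. m \<in> hom2 K h h' \<and> d0 \<lhd>\<^bsub>K\<^esub> m = u \<and> d1 \<lhd>\<^bsub>K\<^esub> m = v"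
  shows "bipullback K f g p d0 d1 \<phi>"
  unfolding bipullback_iff by (intro conjI ballI impI assms(1-8); (rule es ff; assumption))

text \<open>Half of the pasting lemma: if the rectangle over \<open>f g\<close> and the square over \<open>f\<close> are
  bipullbacks, then so is the square over \<open>g\<close> that remains. The comparison \<open>h : q \<rightarrow> p\<close> comes
  from the square over \<open>f\<close>, together with isomorphisms \<open>u\<close> and \<open>v\<close> that exhibit the rectangle as
  the pasting of the two squares. Existence of lifts: a cone over \<open>d1\<close> and \<open>g\<close> is extended by \<open>\<phi>\<close>
  to a cone over the rectangle, lifted there, and compared with the given one in \<open>p\<close>. Unique
  lifting of 2-cells: under \<open>u\<close> and \<open>v\<close>, a pair \<open>(m, t)\<close> for the new square corresponds to the
  pair \<open>(s, t)\<close> for the rectangle in which \<open>s\<close> is the conjugate of \<open>d0 \<lhd> m\<close> by \<open>u\<close>.\<close>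

lemma bipullback_cancel:
  assumes P: "bipullback K x f p d0 d1 \<phi>" and Q: "bipullback K x (f \<cdot>\<^bsub>K\<^esub> g) q e0 e1 \<psi>"
    and g: "g \<in> Arr (C1 K)" "Cod (C1 K) g = Dom (C1 K) f"
  shows "\<exists>h v. bipullback K d1 g q h e1 v"
proof -
  note Pt [simp] = bipullback_typing [OF P]
  note Qt = bipullback_typing [OF Q]
  note [simp] = g Qt(4-14) V.iso_arr
  have [simp]: "Cod (C1 K) e1 = Dom (C1 K) g" "Dom (C2 K) \<psi> = x \<cdot>\<^bsub>K\<^esub> e0"
    "Cod (C2 K) \<psi> = f \<cdot>\<^bsub>K\<^esub> g \<cdot>\<^bsub>K\<^esub> e1"
    using Qt(10,12,13) by simp_all
  obtain h u v where h: "h \<in> hom1 K q p" and u: "u \<in> hom2 K (d0 \<cdot>\<^bsub>K\<^esub> h) e0" "iso (C2 K) u"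
    and v: "v \<in> hom2 K (d1 \<cdot>\<^bsub>K\<^esub> h) (g \<cdot>\<^bsub>K\<^esub> e1)" "iso (C2 K) v"
    and uv: "(f \<lhd>\<^bsub>K\<^esub> v) \<bullet>\<^bsub>K\<^esub> (\<phi> \<rhd>\<^bsub>K\<^esub> h) = \<psi> \<bullet>\<^bsub>K\<^esub> (x \<lhd>\<^bsub>K\<^esub> u)"
    by (rule bipullback_lift [OF P, of e0 q "g \<cdot>\<^bsub>K\<^esub> e1" \<psi>]) simp_all
  have [simp]: "h \<in> Arr (C1 K)" "Dom (C1 K) h = q" "Cod (C1 K) h = p"
    "u \<in> Arr (C2 K)" "Dom (C2 K) u = d0 \<cdot>\<^bsub>K\<^esub> h" "Cod (C2 K) u = e0" "iso (C2 K) u"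
    "v \<in> Arr (C2 K)" "Dom (C2 K) v = d1 \<cdot>\<^bsub>K\<^esub> h" "Cod (C2 K) v = g \<cdot>\<^bsub>K\<^esub> e1" "iso (C2 K) v"
    using h u v by auto
  have uvl: "(f \<lhd>\<^bsub>K\<^esub> (v \<rhd>\<^bsub>K\<^esub> l)) \<bullet>\<^bsub>K\<^esub> (\<phi> \<rhd>\<^bsub>K\<^esub> (h \<cdot>\<^bsub>K\<^esub> l)) = (\<psi> \<rhd>\<^bsub>K\<^esub> l) \<bullet>\<^bsub>K\<^esub> (x \<lhd>\<^bsub>K\<^esub> (u \<rhd>\<^bsub>K\<^esub> l))"
    if "l \<in> Arr (C1 K)" "Cod (C1 K) l = q" for l
    using arg_cong [OF uv, of "\<lambda>\<alpha>. \<alpha> \<rhd>\<^bsub>K\<^esub> l"] that by simp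
  have "bipullback K d1 g q h e1 v"
  proof (rule bipullbackI)
    fix X a b \<omega>
    assume a0: "a \<in> hom1 K X (Dom (C1 K) d1)" and b0: "b \<in> hom1 K X (Dom (C1 K) g)"
      and om0: "\<omega> \<in> hom2 K (d1 \<cdot>\<^bsub>K\<^esub> a) (g \<cdot>\<^bsub>K\<^esub> b)" "iso (C2 K) \<omega>"
    have [simp]: "a \<in> Arr (C1 K)" "Dom (C1 K) a = X" "Cod (C1 K) a = p"
      "b \<in> Arr (C1 K)" "Dom (C1 K) b = X" "Cod (C1 K) b = Dom (C1 K) g"
      "\<omega> \<in> Arr (C2 K)" "Dom (C2 K) \<omega> = d1 \<cdot>\<^bsub>K\<^esub> a" "Cod (C2 K) \<omega> = g \<cdot>\<^bsub>K\<^esub> b" "iso (C2 K) \<omega>"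
      using a0 b0 om0 by simp_all
    obtain l s t where l0: "l \<in> hom1 K X q" "s \<in> hom2 K (e0 \<cdot>\<^bsub>K\<^esub> l) (d0 \<cdot>\<^bsub>K\<^esub> a)" "iso (C2 K) s"
        "t \<in> hom2 K (e1 \<cdot>\<^bsub>K\<^esub> l) b" "iso (C2 K) t"
      and st: "((f \<cdot>\<^bsub>K\<^esub> g) \<lhd>\<^bsub>K\<^esub> t) \<bullet>\<^bsub>K\<^esub> (\<psi> \<rhd>\<^bsub>K\<^esub> l)
        = ((f \<lhd>\<^bsub>K\<^esub> \<omega>) \<bullet>\<^bsub>K\<^esub> (\<phi> \<rhd>\<^bsub>K\<^esub> a)) \<bullet>\<^bsub>K\<^esub> (x \<lhd>\<^bsub>K\<^esub> s)"
      by (rule bipullback_lift [OF Q, of "d0 \<cdot>\<^bsub>K\<^esub> a" X b "(f \<lhd>\<^bsub>K\<^esub> \<omega>) \<bullet>\<^bsub>K\<^esub> (\<phi> \<rhd>\<^bsub>K\<^esub> a)"])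
        simp_all
    have [simp]: "l \<in> Arr (C1 K)" "Dom (C1 K) l = X" "Cod (C1 K) l = q"
      "s \<in> Arr (C2 K)" "Dom (C2 K) s = e0 \<cdot>\<^bsub>K\<^esub> l" "Cod (C2 K) s = d0 \<cdot>\<^bsub>K\<^esub> a" "iso (C2 K) s"
      "t \<in> Arr (C2 K)" "Dom (C2 K) t = e1 \<cdot>\<^bsub>K\<^esub> l" "Cod (C2 K) t = b" "iso (C2 K) t"
      using l0 by simp_all
    \<comment> \<open>The two components, in \<open>p\<close>, of the comparison of \<open>h l\<close> with the given \<open>a\<close>.\<close>
    let ?v = "inv_arr (C2 K) \<omega> \<bullet>\<^bsub>K\<^esub> (g \<lhd>\<^bsub>K\<^esub> t) \<bullet>\<^bsub>K\<^esub> (v \<rhd>\<^bsub>K\<^esub> l)" and ?u = "s \<bullet>\<^bsub>K\<^esub> (u \<rhd>\<^bsub>K\<^esub> l)"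
    have "(f \<lhd>\<^bsub>K\<^esub> g \<lhd>\<^bsub>K\<^esub> t) \<bullet>\<^bsub>K\<^esub> (f \<lhd>\<^bsub>K\<^esub> (v \<rhd>\<^bsub>K\<^esub> l)) \<bullet>\<^bsub>K\<^esub> (\<phi> \<rhd>\<^bsub>K\<^esub> (h \<cdot>\<^bsub>K\<^esub> l))
        = (f \<lhd>\<^bsub>K\<^esub> g \<lhd>\<^bsub>K\<^esub> t) \<bullet>\<^bsub>K\<^esub> (\<psi> \<rhd>\<^bsub>K\<^esub> l) \<bullet>\<^bsub>K\<^esub> (x \<lhd>\<^bsub>K\<^esub> (u \<rhd>\<^bsub>K\<^esub> l))"
      by (simp only: uvl [of l] \<open>l \<in> Arr (C1 K)\<close> \<open>Cod (C1 K) l = q\<close>)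
    also have "\<dots> = (((f \<cdot>\<^bsub>K\<^esub> g) \<lhd>\<^bsub>K\<^esub> t) \<bullet>\<^bsub>K\<^esub> (\<psi> \<rhd>\<^bsub>K\<^esub> l)) \<bullet>\<^bsub>K\<^esub> (x \<lhd>\<^bsub>K\<^esub> (u \<rhd>\<^bsub>K\<^esub> l))"
      by simp
    also have "\<dots> = (f \<lhd>\<^bsub>K\<^esub> \<omega>) \<bullet>\<^bsub>K\<^esub> (\<phi> \<rhd>\<^bsub>K\<^esub> a) \<bullet>\<^bsub>K\<^esub> (x \<lhd>\<^bsub>K\<^esub> ?u)"
      unfolding st by simp
    finally have eq: "(f \<lhd>\<^bsub>K\<^esub> ?v) \<bullet>\<^bsub>K\<^esub> (\<phi> \<rhd>\<^bsub>K\<^esub> (h \<cdot>\<^bsub>K\<^esub> l)) = (\<phi> \<rhd>\<^bsub>K\<^esub> a) \<bullet>\<^bsub>K\<^esub> (x \<lhd>\<^bsub>K\<^esub> ?u)"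
      by (simp flip: postwhisker_iso(2))
    have "\<exists>!m. m \<in> hom2 K (h \<cdot>\<^bsub>K\<^esub> l) a \<and> d0 \<lhd>\<^bsub>K\<^esub> m = ?u \<and> d1 \<lhd>\<^bsub>K\<^esub> m = ?v"
      by (rule bipullback_ex1 [OF P _ _ _ _ eq, where X = X]) simp_all
    then obtain m where m: "m \<in> hom2 K (h \<cdot>\<^bsub>K\<^esub> l) a" "d0 \<lhd>\<^bsub>K\<^esub> m = ?u" "d1 \<lhd>\<^bsub>K\<^esub> m = ?v"
      by blast
    have "iso (C2 K) m"
      by (rule bipullback_reflects_iso [OF P _ _ m(1)]) (simp_all add: m(2,3))
    then show "\<exists>l\<in>hom1 K X q. \<exists>m\<in>hom2 K (h \<cdot>\<^bsub>K\<^esub> l) a. \<exists>t\<in>hom2 K (e1 \<cdot>\<^bsub>K\<^esub> l) b.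
        iso (C2 K) m \<and> iso (C2 K) t \<and> (g \<lhd>\<^bsub>K\<^esub> t) \<bullet>\<^bsub>K\<^esub> (v \<rhd>\<^bsub>K\<^esub> l) = \<omega> \<bullet>\<^bsub>K\<^esub> (d1 \<lhd>\<^bsub>K\<^esub> m)"
      using m by (intro bexI [of _ l] bexI [of _ m] bexI [of _ t]) simp_all
  next
    fix X l l' m t
    assume l0: "l \<in> hom1 K X q" "l' \<in> hom1 K X q"
      and m0: "m \<in> hom2 K (h \<cdot>\<^bsub>K\<^esub> l) (h \<cdot>\<^bsub>K\<^esub> l')" and t0: "t \<in> hom2 K (e1 \<cdot>\<^bsub>K\<^esub> l) (e1 \<cdot>\<^bsub>K\<^esub> l')"
      and mt: "(g \<lhd>\<^bsub>K\<^esub> t) \<bullet>\<^bsub>K\<^esub> (v \<rhd>\<^bsub>K\<^esub> l) = (v \<rhd>\<^bsub>K\<^esub> l') \<bullet>\<^bsub>K\<^esub> (d1 \<lhd>\<^bsub>K\<^esub> m)"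
    have [simp]: "l \<in> Arr (C1 K)" "Dom (C1 K) l = X" "Cod (C1 K) l = q"
      "l' \<in> Arr (C1 K)" "Dom (C1 K) l' = X" "Cod (C1 K) l' = q"
      "m \<in> Arr (C2 K)" "Dom (C2 K) m = h \<cdot>\<^bsub>K\<^esub> l" "Cod (C2 K) m = h \<cdot>\<^bsub>K\<^esub> l'"
      "t \<in> Arr (C2 K)" "Dom (C2 K) t = e1 \<cdot>\<^bsub>K\<^esub> l" "Cod (C2 K) t = e1 \<cdot>\<^bsub>K\<^esub> l'"
      using l0 m0 t0 by simp_all
    define s where "s = (u \<rhd>\<^bsub>K\<^esub> l') \<bullet>\<^bsub>K\<^esub> (d0 \<lhd>\<^bsub>K\<^esub> m) \<bullet>\<^bsub>K\<^esub> inv_arr (C2 K) (u \<rhd>\<^bsub>K\<^esub> l)"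
    have [simp]: "s \<in> Arr (C2 K)" "Dom (C2 K) s = e0 \<cdot>\<^bsub>K\<^esub> l" "Cod (C2 K) s = e0 \<cdot>\<^bsub>K\<^esub> l'"
      unfolding s_def by simp_all
    have su: "s \<bullet>\<^bsub>K\<^esub> (u \<rhd>\<^bsub>K\<^esub> l) = (u \<rhd>\<^bsub>K\<^esub> l') \<bullet>\<^bsub>K\<^esub> (d0 \<lhd>\<^bsub>K\<^esub> m)"
      unfolding s_def by (simp del: prewhisker_iso(2))
    have "((f \<lhd>\<^bsub>K\<^esub> g \<lhd>\<^bsub>K\<^esub> t) \<bullet>\<^bsub>K\<^esub> (\<psi> \<rhd>\<^bsub>K\<^esub> l)) \<bullet>\<^bsub>K\<^esub> (x \<lhd>\<^bsub>K\<^esub> (u \<rhd>\<^bsub>K\<^esub> l))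
        = (f \<lhd>\<^bsub>K\<^esub> ((g \<lhd>\<^bsub>K\<^esub> t) \<bullet>\<^bsub>K\<^esub> (v \<rhd>\<^bsub>K\<^esub> l))) \<bullet>\<^bsub>K\<^esub> (\<phi> \<rhd>\<^bsub>K\<^esub> (h \<cdot>\<^bsub>K\<^esub> l))"
      using uvl [of l] by simp
    also have "\<dots> = (f \<lhd>\<^bsub>K\<^esub> (v \<rhd>\<^bsub>K\<^esub> l')) \<bullet>\<^bsub>K\<^esub> ((f \<cdot>\<^bsub>K\<^esub> d1) \<lhd>\<^bsub>K\<^esub> m) \<bullet>\<^bsub>K\<^esub> (\<phi> \<rhd>\<^bsub>K\<^esub> (h \<cdot>\<^bsub>K\<^esub> l))"
      unfolding mt by simp
    also have "\<dots> = (f \<lhd>\<^bsub>K\<^esub> (v \<rhd>\<^bsub>K\<^esub> l')) \<bullet>\<^bsub>K\<^esub> (\<phi> \<rhd>\<^bsub>K\<^esub> (h \<cdot>\<^bsub>K\<^esub> l')) \<bullet>\<^bsub>K\<^esub> ((x \<cdot>\<^bsub>K\<^esub> d0) \<lhd>\<^bsub>K\<^esub> m)"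
      using whisker_exchange [of m \<phi>, OF _ _ _ refl refl refl refl] by simp
    also have "\<dots> = ((f \<lhd>\<^bsub>K\<^esub> (v \<rhd>\<^bsub>K\<^esub> l')) \<bullet>\<^bsub>K\<^esub> (\<phi> \<rhd>\<^bsub>K\<^esub> (h \<cdot>\<^bsub>K\<^esub> l'))) \<bullet>\<^bsub>K\<^esub> ((x \<cdot>\<^bsub>K\<^esub> d0) \<lhd>\<^bsub>K\<^esub> m)"
      by simp
    also have "\<dots> = (\<psi> \<rhd>\<^bsub>K\<^esub> l') \<bullet>\<^bsub>K\<^esub> (x \<lhd>\<^bsub>K\<^esub> (((u \<rhd>\<^bsub>K\<^esub> l')) \<bullet>\<^bsub>K\<^esub> (d0 \<lhd>\<^bsub>K\<^esub> m)))"
      by (subst uvl) simp_all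
    also have "\<dots> = ((\<psi> \<rhd>\<^bsub>K\<^esub> l') \<bullet>\<^bsub>K\<^esub> (x \<lhd>\<^bsub>K\<^esub> s)) \<bullet>\<^bsub>K\<^esub> (x \<lhd>\<^bsub>K\<^esub> (u \<rhd>\<^bsub>K\<^esub> l))"
      by (simp flip: su)
    finally have st: "(f \<lhd>\<^bsub>K\<^esub> g \<lhd>\<^bsub>K\<^esub> t) \<bullet>\<^bsub>K\<^esub> (\<psi> \<rhd>\<^bsub>K\<^esub> l) = (\<psi> \<rhd>\<^bsub>K\<^esub> l') \<bullet>\<^bsub>K\<^esub> (x \<lhd>\<^bsub>K\<^esub> s)"
      by (rule V.iso_cancel_right [rotated -1]) simp_all
    have ex: "\<exists>!n. n \<in> hom2 K l l' \<and> e0 \<lhd>\<^bsub>K\<^esub> n = s \<and> e1 \<lhd>\<^bsub>K\<^esub> n = t"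
      by (rule bipullback_ex1 [OF Q, where X = X]) (simp_all add: st)
    have iff: "h \<lhd>\<^bsub>K\<^esub> n = m \<longleftrightarrow> e0 \<lhd>\<^bsub>K\<^esub> n = s" if n0: "n \<in> hom2 K l l'" "e1 \<lhd>\<^bsub>K\<^esub> n = t" for n
    proof -
      have [simp]: "n \<in> Arr (C2 K)" "Dom (C2 K) n = l" "Cod (C2 K) n = l'" "e1 \<lhd>\<^bsub>K\<^esub> n = t"
        using n0 by simp_all
      have eu: "(e0 \<lhd>\<^bsub>K\<^esub> n) \<bullet>\<^bsub>K\<^esub> (u \<rhd>\<^bsub>K\<^esub> l) = (u \<rhd>\<^bsub>K\<^esub> l') \<bullet>\<^bsub>K\<^esub> (d0 \<lhd>\<^bsub>K\<^esub> h \<lhd>\<^bsub>K\<^esub> n)"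
        using whisker_exchange [of n u, OF _ _ _ refl refl refl refl] by simp
      have ev: "(g \<lhd>\<^bsub>K\<^esub> e1 \<lhd>\<^bsub>K\<^esub> n) \<bullet>\<^bsub>K\<^esub> (v \<rhd>\<^bsub>K\<^esub> l) = (v \<rhd>\<^bsub>K\<^esub> l') \<bullet>\<^bsub>K\<^esub> (d1 \<lhd>\<^bsub>K\<^esub> h \<lhd>\<^bsub>K\<^esub> n)"
        using whisker_exchange [of n v, OF _ _ _ refl refl refl refl, symmetric] by (simp del: \<open>e1 \<lhd>\<^bsub>K\<^esub> n = t\<close>)
      show ?thesis
      proof
        assume "h \<lhd>\<^bsub>K\<^esub> n = m"
        then have "(e0 \<lhd>\<^bsub>K\<^esub> n) \<bullet>\<^bsub>K\<^esub> (u \<rhd>\<^bsub>K\<^esub> l) = s \<bullet>\<^bsub>K\<^esub> (u \<rhd>\<^bsub>K\<^esub> l)"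
          by (simp only: eu su)
        then show "e0 \<lhd>\<^bsub>K\<^esub> n = s"
          by (rule V.iso_cancel_right [rotated -1]) simp_all
      next
        assume "e0 \<lhd>\<^bsub>K\<^esub> n = s"
        then have "(u \<rhd>\<^bsub>K\<^esub> l') \<bullet>\<^bsub>K\<^esub> (d0 \<lhd>\<^bsub>K\<^esub> h \<lhd>\<^bsub>K\<^esub> n) = (u \<rhd>\<^bsub>K\<^esub> l') \<bullet>\<^bsub>K\<^esub> (d0 \<lhd>\<^bsub>K\<^esub> m)"
          by (simp only: su flip: eu)
        then have 1: "d0 \<lhd>\<^bsub>K\<^esub> h \<lhd>\<^bsub>K\<^esub> n = d0 \<lhd>\<^bsub>K\<^esub> m"
          by (rule V.iso_cancel_left [rotated -1]) simp_all
        have "(v \<rhd>\<^bsub>K\<^esub> l') \<bullet>\<^bsub>K\<^esub> (d1 \<lhd>\<^bsub>K\<^esub> h \<lhd>\<^bsub>K\<^esub> n) = (v \<rhd>\<^bsub>K\<^esub> l') \<bullet>\<^bsub>K\<^esub> (d1 \<lhd>\<^bsub>K\<^esub> m)"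
          using ev mt by simp
        then have 2: "d1 \<lhd>\<^bsub>K\<^esub> h \<lhd>\<^bsub>K\<^esub> n = d1 \<lhd>\<^bsub>K\<^esub> m"
          by (rule V.iso_cancel_left [rotated -1]) simp_all
        show "h \<lhd>\<^bsub>K\<^esub> n = m"
          by (rule bipullback_faithful [OF P _ _ _ _ 1 2, where X = X]) simp_all
      qed
    qed
    have "(n \<in> hom2 K l l' \<and> e0 \<lhd>\<^bsub>K\<^esub> n = s \<and> e1 \<lhd>\<^bsub>K\<^esub> n = t) \<longleftrightarrow>
        (n \<in> hom2 K l l' \<and> h \<lhd>\<^bsub>K\<^esub> n = m \<and> e1 \<lhd>\<^bsub>K\<^esub> n = t)" for n
      using iff [of n] by blast
    then show "\<exists>!n. n \<in> hom2 K l l' \<and> h \<lhd>\<^bsub>K\<^esub> n = m \<and> e1 \<lhd>\<^bsub>K\<^esub> n = t"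
      using ex by simp
  qed simp_all
  then show ?thesis by blast
qed

text \<open>This makes the bicarrable 1-cells closed under bipullback, as display 1-cells are by definition:
  the bipullback of \<open>d1\<close> along \<open>g\<close> is cut out of the bipullback of \<open>x\<close> along \<open>f g\<close>.\<close>

lemma bicarrable_stable:
  assumes "bicarrable K x" "bipullback K x f p d0 d1 \<phi>"
  shows "bicarrable K d1"
  unfolding bicarrable_def
proof (intro conjI ballI impI)
  note [simp] = bipullback_typing [OF assms(2)]
  show "d1 \<in> Arr (C1 K)" by simp
  fix g assume g: "g \<in> Arr (C1 K)" "Cod (C1 K) g = Cod (C1 K) d1"
  have "f \<cdot>\<^bsub>K\<^esub> g \<in> Arr (C1 K)" "Cod (C1 K) (f \<cdot>\<^bsub>K\<^esub> g) = Cod (C1 K) x"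
    using g by simp_all
  then obtain q e0 e1 \<psi> where "bipullback K x (f \<cdot>\<^bsub>K\<^esub> g) q e0 e1 \<psi>"
    using assms(1) unfolding bicarrable_def by blast
  from bipullback_cancel [OF assms(2) this] g
  show "\<exists>p d0 d1' \<phi>. bipullback K d1 g p d0 d1' \<phi>" by auto
qed

end

section \<open>The 2-category of display 1-cells\<close>

locale display_cells = two_category K for K :: "('o, 'a, 't) two_cat" +
  fixes D :: "'a set"
  assumes D_arr [simp]: "x \<in> D \<Longrightarrow> x \<in> Arr (C1 K)"
begin

abbreviation "E \<equiv> KD K D"

lemma KD1_simps [simp]:
  "Obj (KD1 K D) = D" "Dom (KD1 K D) = sq_dom" "Cod (KD1 K D) = sq_cod"
  "Ide (KD1 K D) x = Sq x x (id1 K (Dom (C1 K) x)) (id2 K x) (id1 K (Cod (C1 K) x))"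
  "Comp (KD1 K D) g f = Sq (sq_dom f) (sq_cod g) (over1 g \<cdot>\<^bsub>K\<^esub> over1 f)
         ((under1 g \<lhd>\<^bsub>K\<^esub> tri f) \<bullet>\<^bsub>K\<^esub> (tri g \<rhd>\<^bsub>K\<^esub> over1 f)) (under1 g \<cdot>\<^bsub>K\<^esub> under1 f)"
  by (simp_all add: KD1_def)

lemma KD1_arr:
  "f \<in> Arr (KD1 K D) \<longleftrightarrow> sq_dom f \<in> D \<and> sq_cod f \<in> D
    \<and> over1 f \<in> hom1 K (Dom (C1 K) (sq_dom f)) (Dom (C1 K) (sq_cod f))
    \<and> under1 f \<in> hom1 K (Cod (C1 K) (sq_dom f)) (Cod (C1 K) (sq_cod f))
    \<and> tri f \<in> hom2 K (sq_cod f \<cdot>\<^bsub>K\<^esub> over1 f) (under1 f \<cdot>\<^bsub>K\<^esub> sq_dom f) \<and> iso (C2 K) (tri f)"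
  by (simp add: KD1_def)

lemma KD2_simps [simp]:
  "Obj (KD2 K D) = Arr (KD1 K D)" "Dom (KD2 K D) = cyl_dom" "Cod (KD2 K D) = cyl_cod"
  "Ide (KD2 K D) f = Cyl f f (id2 K (over1 f)) (id2 K (under1 f))"
  "Comp (KD2 K D) \<beta> \<alpha> = Cyl (cyl_dom \<alpha>) (cyl_cod \<beta>) (over2 \<beta> \<bullet>\<^bsub>K\<^esub> over2 \<alpha>) (under2 \<beta> \<bullet>\<^bsub>K\<^esub> under2 \<alpha>)"
  by (simp_all add: KD2_def)

lemma KD2_arr:
  "\<alpha> \<in> Arr (KD2 K D) \<longleftrightarrow> cyl_dom \<alpha> \<in> Arr (KD1 K D) \<and> cyl_cod \<alpha> \<in> Arr (KD1 K D)
    \<and> sq_dom (cyl_dom \<alpha>) = sq_dom (cyl_cod \<alpha>) \<and> sq_cod (cyl_dom \<alpha>) = sq_cod (cyl_cod \<alpha>)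
    \<and> over2 \<alpha> \<in> hom2 K (over1 (cyl_dom \<alpha>)) (over1 (cyl_cod \<alpha>))
    \<and> under2 \<alpha> \<in> hom2 K (under1 (cyl_dom \<alpha>)) (under1 (cyl_cod \<alpha>))
    \<and> (under2 \<alpha> \<rhd>\<^bsub>K\<^esub> sq_dom (cyl_dom \<alpha>)) \<bullet>\<^bsub>K\<^esub> tri (cyl_dom \<alpha>)
       = tri (cyl_cod \<alpha>) \<bullet>\<^bsub>K\<^esub> (sq_cod (cyl_dom \<alpha>) \<lhd>\<^bsub>K\<^esub> over2 \<alpha>)"
  by (simp add: KD2_def)

lemma KD_simps [simp]:
  "C1 E = KD1 K D" "C2 E = KD2 K D"
  "\<beta> \<star>\<^bsub>E\<^esub> \<alpha> = Cyl (Comp (KD1 K D) (cyl_dom \<beta>) (cyl_dom \<alpha>)) (Comp (KD1 K D) (cyl_cod \<beta>) (cyl_cod \<alpha>))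
                       (over2 \<beta> \<star>\<^bsub>K\<^esub> over2 \<alpha>) (under2 \<beta> \<star>\<^bsub>K\<^esub> under2 \<alpha>)"
  by (simp_all add: KD_def)

lemma KD1_arrD:
  assumes "f \<in> Arr (KD1 K D)" "sq_dom f = y" "sq_cod f = x"
  shows "y \<in> D" "x \<in> D" "over1 f \<in> Arr (C1 K)" "Dom (C1 K) (over1 f) = Dom (C1 K) y"
    "Cod (C1 K) (over1 f) = Dom (C1 K) x" "under1 f \<in> Arr (C1 K)"
    "Dom (C1 K) (under1 f) = Cod (C1 K) y" "Cod (C1 K) (under1 f) = Cod (C1 K) x"
    "tri f \<in> Arr (C2 K)" "Dom (C2 K) (tri f) = x \<cdot>\<^bsub>K\<^esub> over1 f" "Cod (C2 K) (tri f) = under1 f \<cdot>\<^bsub>K\<^esub> y"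
    "iso (C2 K) (tri f)"
  using assms by (auto simp: KD1_arr)

lemma KD2_arrD:
  assumes "\<alpha> \<in> Arr (KD2 K D)" "cyl_dom \<alpha> = f" "cyl_cod \<alpha> = g" "sq_dom f = y" "sq_cod f = x"
  shows "f \<in> Arr (KD1 K D)" "g \<in> Arr (KD1 K D)" "sq_dom g = y" "sq_cod g = x"
    "over2 \<alpha> \<in> Arr (C2 K)" "Dom (C2 K) (over2 \<alpha>) = over1 f" "Cod (C2 K) (over2 \<alpha>) = over1 g"
    "under2 \<alpha> \<in> Arr (C2 K)" "Dom (C2 K) (under2 \<alpha>) = under1 f" "Cod (C2 K) (under2 \<alpha>) = under1 g"
    "(under2 \<alpha> \<rhd>\<^bsub>K\<^esub> y) \<bullet>\<^bsub>K\<^esub> tri f = tri g \<bullet>\<^bsub>K\<^esub> (x \<lhd>\<^bsub>K\<^esub> over2 \<alpha>)"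
  using assms by (auto simp: KD2_arr)

lemma KD2_arrI:
  assumes "f \<in> Arr (KD1 K D)" "g \<in> Arr (KD1 K D)" "sq_dom f = sq_dom g" "sq_cod f = sq_cod g"
    "a \<in> Arr (C2 K)" "Dom (C2 K) a = over1 f" "Cod (C2 K) a = over1 g"
    "b \<in> Arr (C2 K)" "Dom (C2 K) b = under1 f" "Cod (C2 K) b = under1 g"
    "(b \<rhd>\<^bsub>K\<^esub> sq_dom f) \<bullet>\<^bsub>K\<^esub> tri f = tri g \<bullet>\<^bsub>K\<^esub> (sq_cod f \<lhd>\<^bsub>K\<^esub> a)"
  shows "Cyl f g a b \<in> Arr (KD2 K D)"
  using assms by (auto simp: KD2_arr)

lemma category_KD1: "category (KD1 K D)"
proof (standard, goal_cases)
  case (5 f a b) then show ?case by (intro sq.expand) (auto simp: KD1_arr)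
next
  case (6 f a b) then show ?case by (intro sq.expand) (auto simp: KD1_arr)
next
  case (4 f a b g c)
  then show ?case by (clarsimp simp add: KD1_arr)
next
  case (7 f a b g c h d)
  then show ?case by (clarsimp simp add: KD1_arr)
qed (simp_all add: KD1_arr V.iso_arr)

lemma category_KD2: "category (KD2 K D)"
proof (standard, goal_cases)
  case (4 \<alpha> f g \<beta> h)
  have \<alpha>: "\<alpha> \<in> Arr (KD2 K D)" "cyl_dom \<alpha> = f" "cyl_cod \<alpha> = g"
    and \<beta>: "\<beta> \<in> Arr (KD2 K D)" "cyl_dom \<beta> = g" "cyl_cod \<beta> = h"
    using 4 by simp_all
  obtain y x where yx: "sq_dom f = y" "sq_cod f = x" by simp
  note [simp] = \<alpha> \<beta> yx KD2_arrD [OF \<alpha> yx]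
  note [simp] = KD2_arrD [OF \<beta> KD2_arrD(3,4) [OF \<alpha> yx]]
  note [simp] = KD1_arrD [of f, OF _ yx] KD1_arrD [of g y x] KD1_arrD [of h y x]
  have "(under2 \<beta> \<rhd>\<^bsub>K\<^esub> y) \<bullet>\<^bsub>K\<^esub> (under2 \<alpha> \<rhd>\<^bsub>K\<^esub> y) \<bullet>\<^bsub>K\<^esub> tri f = (under2 \<beta> \<rhd>\<^bsub>K\<^esub> y) \<bullet>\<^bsub>K\<^esub> tri g \<bullet>\<^bsub>K\<^esub> (x \<lhd>\<^bsub>K\<^esub> over2 \<alpha>)"
    by simp
  also have "\<dots> = tri h \<bullet>\<^bsub>K\<^esub> (x \<lhd>\<^bsub>K\<^esub> over2 \<beta>) \<bullet>\<^bsub>K\<^esub> (x \<lhd>\<^bsub>K\<^esub> over2 \<alpha>)"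
    by (rule V.comp_extend) simp_all
  finally show ?case
    by (auto intro!: KD2_arrI)
next
  case (5 f a b) then show ?case by (intro cyl.expand) (simp add: KD2_arr)
next
  case (6 f a b) then show ?case by (intro cyl.expand) (simp add: KD2_arr)
next
  case (7 f a b g c h d)
  then show ?case by (simp add: KD2_arr)
qed (simp_all add: KD2_arr KD1_arr)

text \<open>Everything is inherited componentwise from \<open>K\<close>. What needs an argument is that the horizontal
  composite of two cylinders satisfies the cylinder condition; it is obtained by interchange from
  the conditions for the two factors, used one after the other.\<close>

lemma two_category_KD: "two_category E"
proof -
  interpret E1: category "KD1 K D" by (rule category_KD1)
  interpret E2: category "KD2 K D" by (rule category_KD2)
  show ?thesis
  proof (rule two_category.intro, unfold KD_simps, goal_cases)
    case 1 show ?case by (rule category_KD1)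
  next
    case 2 show ?case by (rule category_KD2)
  next
    case 3 show ?case by simp
  next
    case (4 \<alpha> f g) then show ?case by (auto simp: KD2_arr)
  next
    case (5 f y x g z \<alpha> f' \<beta> g')
    have \<alpha>: "\<alpha> \<in> Arr (KD2 K D)" "cyl_dom \<alpha> = f" "cyl_cod \<alpha> = f'"
      and \<beta>: "\<beta> \<in> Arr (KD2 K D)" "cyl_dom \<beta> = g" "cyl_cod \<beta> = g'"
      and yxz: "sq_dom f = y" "sq_cod f = x" "sq_dom g = x" "sq_cod g = z"
      using 5 by simp_all
    note [simp] = \<alpha> \<beta> yxz KD2_arrD [OF \<alpha> yxz(1,2)] KD2_arrD [OF \<beta> yxz(3,4)]
    note [simp] = KD1_arrD [of f, OF _ yxz(1,2)] KD1_arrD [of g, OF _ yxz(3,4)] KD1_arrD [of f' y x] KD1_arrD [of g' x z]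
    have "((under2 \<beta> \<star>\<^bsub>K\<^esub> under2 \<alpha>) \<rhd>\<^bsub>K\<^esub> y) \<bullet>\<^bsub>K\<^esub> (under1 g \<lhd>\<^bsub>K\<^esub> tri f) \<bullet>\<^bsub>K\<^esub> (tri g \<rhd>\<^bsub>K\<^esub> over1 f)
        = (under2 \<beta> \<star>\<^bsub>K\<^esub> (under2 \<alpha> \<rhd>\<^bsub>K\<^esub> y)) \<bullet>\<^bsub>K\<^esub> (under1 g \<lhd>\<^bsub>K\<^esub> tri f) \<bullet>\<^bsub>K\<^esub> (tri g \<rhd>\<^bsub>K\<^esub> over1 f)"
      by simp
    also have "\<dots> = ((under2 \<beta> \<star>\<^bsub>K\<^esub> (under2 \<alpha> \<rhd>\<^bsub>K\<^esub> y)) \<bullet>\<^bsub>K\<^esub> (under1 g \<lhd>\<^bsub>K\<^esub> tri f)) \<bullet>\<^bsub>K\<^esub> (tri g \<rhd>\<^bsub>K\<^esub> over1 f)"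
      by simp
    also have "\<dots> = (under2 \<beta> \<star>\<^bsub>K\<^esub> ((under2 \<alpha> \<rhd>\<^bsub>K\<^esub> y) \<bullet>\<^bsub>K\<^esub> tri f)) \<bullet>\<^bsub>K\<^esub> (tri g \<rhd>\<^bsub>K\<^esub> over1 f)"
      by (subst interchange') simp_all
    also have "\<dots> = (under2 \<beta> \<star>\<^bsub>K\<^esub> (tri f' \<bullet>\<^bsub>K\<^esub> (x \<lhd>\<^bsub>K\<^esub> over2 \<alpha>))) \<bullet>\<^bsub>K\<^esub> (tri g \<rhd>\<^bsub>K\<^esub> over1 f)"
      by simp
    also have "\<dots> = ((id2 K (under1 g') \<bullet>\<^bsub>K\<^esub> under2 \<beta>) \<star>\<^bsub>K\<^esub> (tri f' \<bullet>\<^bsub>K\<^esub> (x \<lhd>\<^bsub>K\<^esub> over2 \<alpha>))) \<bullet>\<^bsub>K\<^esub> (tri g \<rhd>\<^bsub>K\<^esub> over1 f)"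
      by simp
    also have "\<dots> = (under1 g' \<lhd>\<^bsub>K\<^esub> tri f') \<bullet>\<^bsub>K\<^esub> (under2 \<beta> \<star>\<^bsub>K\<^esub> (x \<lhd>\<^bsub>K\<^esub> over2 \<alpha>)) \<bullet>\<^bsub>K\<^esub> (tri g \<rhd>\<^bsub>K\<^esub> over1 f)"
      by (subst interchange' [symmetric]) simp_all
    also have "(under2 \<beta> \<star>\<^bsub>K\<^esub> (x \<lhd>\<^bsub>K\<^esub> over2 \<alpha>)) \<bullet>\<^bsub>K\<^esub> (tri g \<rhd>\<^bsub>K\<^esub> over1 f)
        = ((under2 \<beta> \<rhd>\<^bsub>K\<^esub> x) \<star>\<^bsub>K\<^esub> over2 \<alpha>) \<bullet>\<^bsub>K\<^esub> (tri g \<star>\<^bsub>K\<^esub> id2 K (over1 f))"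
      by simp
    also have "\<dots> = (tri g' \<bullet>\<^bsub>K\<^esub> (z \<lhd>\<^bsub>K\<^esub> over2 \<beta>)) \<star>\<^bsub>K\<^esub> (id2 K (over1 f') \<bullet>\<^bsub>K\<^esub> over2 \<alpha>)"
      by (subst interchange') simp_all
    also have "\<dots> = (tri g' \<rhd>\<^bsub>K\<^esub> over1 f') \<bullet>\<^bsub>K\<^esub> (z \<lhd>\<^bsub>K\<^esub> (over2 \<beta> \<star>\<^bsub>K\<^esub> over2 \<alpha>))"
      by (subst interchange' [symmetric]) simp_all
    finally have eq: "((under2 \<beta> \<star>\<^bsub>K\<^esub> under2 \<alpha>) \<rhd>\<^bsub>K\<^esub> y) \<bullet>\<^bsub>K\<^esub> (under1 g \<lhd>\<^bsub>K\<^esub> tri f) \<bullet>\<^bsub>K\<^esub> (tri g \<rhd>\<^bsub>K\<^esub> over1 f)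
        = (under1 g' \<lhd>\<^bsub>K\<^esub> tri f') \<bullet>\<^bsub>K\<^esub> (tri g' \<rhd>\<^bsub>K\<^esub> over1 f') \<bullet>\<^bsub>K\<^esub> (z \<lhd>\<^bsub>K\<^esub> (over2 \<beta> \<star>\<^bsub>K\<^esub> over2 \<alpha>))" .
    have "Comp (KD1 K D) g f \<in> Arr (KD1 K D)" "Comp (KD1 K D) g' f' \<in> Arr (KD1 K D)"
      by (intro E1.comp_simps(1); simp)+
    then have "Cyl (Comp (KD1 K D) g f) (Comp (KD1 K D) g' f') (over2 \<beta> \<star>\<^bsub>K\<^esub> over2 \<alpha>) (under2 \<beta> \<star>\<^bsub>K\<^esub> under2 \<alpha>)
        \<in> Arr (KD2 K D)"
      using eq by (intro KD2_arrI) simp_all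
    then show ?case by simp
  next
    case (6 f a b g c)
    then show ?case by (simp add: KD1_arr)
  next
    case (7 f y x g z \<alpha> f' \<alpha>' f'' \<beta> g' \<beta>' g'')
    have \<alpha>: "\<alpha> \<in> Arr (KD2 K D)" "cyl_dom \<alpha> = f" "cyl_cod \<alpha> = f'" "sq_dom f = y" "sq_cod f = x"
      and \<beta>: "\<beta> \<in> Arr (KD2 K D)" "cyl_dom \<beta> = g" "cyl_cod \<beta> = g'" "sq_dom g = x" "sq_cod g = z"
      and \<alpha>': "\<alpha>' \<in> Arr (KD2 K D)" "cyl_dom \<alpha>' = f'" "cyl_cod \<alpha>' = f''"
      and \<beta>': "\<beta>' \<in> Arr (KD2 K D)" "cyl_dom \<beta>' = g'" "cyl_cod \<beta>' = g''"
      using 7 by simp_all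
    note [simp] = KD1_arrD(3-8) [OF KD2_arrD(1) [OF \<alpha>] \<alpha>(4,5)] KD1_arrD(3-8) [OF KD2_arrD(1) [OF \<beta>] \<beta>(4,5)]
    show ?case
      using KD2_arrD(5-10) [OF \<alpha>] KD2_arrD(5-10) [OF \<beta>] KD2_arrD(5-10) [OF \<alpha>' KD2_arrD(3,4) [OF \<alpha>]]
        KD2_arrD(5-10) [OF \<beta>' KD2_arrD(3,4) [OF \<beta>]] \<alpha>(2,3) \<beta>(2,3) \<alpha>'(2,3) \<beta>'(2,3)
      by (simp add: interchange')
  next
    case (8 f y x \<alpha> f')
    then show ?case
      using E1.comp_ide' [of f y] E1.comp_ide' [of f' y] KD2_arrD [of \<alpha> f f' y]
      by (intro cyl.expand) (auto simp: KD1_arr)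
  next
    case (9 f y x \<alpha> f')
    then show ?case
      using E1.ide_comp' [of f x] E1.ide_comp' [of f' x] KD2_arrD [of \<alpha> f f' _ x]
      by (intro cyl.expand) (auto simp: KD1_arr)
  next
    case (10 f w y g x h z \<alpha> f' \<beta> g' \<gamma> h')
    have \<alpha>: "\<alpha> \<in> Arr (KD2 K D)" "cyl_dom \<alpha> = f" "cyl_cod \<alpha> = f'" "sq_dom f = w" "sq_cod f = y"
      and \<beta>: "\<beta> \<in> Arr (KD2 K D)" "cyl_dom \<beta> = g" "cyl_cod \<beta> = g'" "sq_dom g = y" "sq_cod g = x"
      and \<gamma>: "\<gamma> \<in> Arr (KD2 K D)" "cyl_dom \<gamma> = h" "cyl_cod \<gamma> = h'" "sq_dom h = x" "sq_cod h = z"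
      using 10 by simp_all
    note t = KD1_arrD(3-8) [OF KD2_arrD(1) [OF \<alpha>] \<alpha>(4,5)] KD1_arrD(3-8) [OF KD2_arrD(1) [OF \<beta>] \<beta>(4,5)]
      KD1_arrD(3-8) [OF KD2_arrD(1) [OF \<gamma>] \<gamma>(4,5)] KD2_arrD(5-10) [OF \<alpha>] KD2_arrD(5-10) [OF \<beta>] KD2_arrD(5-10) [OF \<gamma>]
    have "Comp (KD1 K D) h (Comp (KD1 K D) g f) = Comp (KD1 K D) (Comp (KD1 K D) h g) f"
      "Comp (KD1 K D) h' (Comp (KD1 K D) g' f') = Comp (KD1 K D) (Comp (KD1 K D) h' g') f'"
      using KD2_arrD(1-4) [OF \<alpha>] KD2_arrD(1-4) [OF \<beta>] KD2_arrD(1-4) [OF \<gamma>] \<alpha>(4,5) \<beta>(4,5) \<gamma>(4,5)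
      by (intro E1.assoc [symmetric]; simp)+
    moreover have "over2 \<gamma> \<star>\<^bsub>K\<^esub> over2 \<beta> \<star>\<^bsub>K\<^esub> over2 \<alpha> = (over2 \<gamma> \<star>\<^bsub>K\<^esub> over2 \<beta>) \<star>\<^bsub>K\<^esub> over2 \<alpha>"
      "under2 \<gamma> \<star>\<^bsub>K\<^esub> under2 \<beta> \<star>\<^bsub>K\<^esub> under2 \<alpha> = (under2 \<gamma> \<star>\<^bsub>K\<^esub> under2 \<beta>) \<star>\<^bsub>K\<^esub> under2 \<alpha>"
      by (simp_all add: t)
    ultimately show ?case
      using \<alpha>(2,3) \<beta>(2,3) \<gamma>(2,3) by (simp del: KD1_simps)
  qed
qed

end

section \<open>Cartesian 1-cells and 2-cells of a 2-functor\<close>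

text \<open>The comparison of the two notions of fibration takes place over a 2-functor \<open>P : E \<rightarrow> B\<close> that
  lifts invertible 2-cells; the codomain 2-functor enters only at the end.\<close>

locale two_functor = E: two_category E + B: two_category B
  for E :: "('o1, 'a1, 't1) two_cat" and B :: "('o2, 'a2, 't2) two_cat" +
  fixes P :: "('o1, 'a1, 't1, 'o2, 'a2, 't2) two_fctr"
  assumes F0_Obj [simp]: "y \<in> Obj (C1 E) \<Longrightarrow> F0 P y \<in> Obj (C1 B)"
    and F1_arr [simp]: "f \<in> Arr (C1 E) \<Longrightarrow> F1 P f \<in> Arr (C1 B)"
    and F1_dom [simp]: "f \<in> Arr (C1 E) \<Longrightarrow> Dom (C1 B) (F1 P f) = F0 P (Dom (C1 E) f)"
    and F1_cod [simp]: "f \<in> Arr (C1 E) \<Longrightarrow> Cod (C1 B) (F1 P f) = F0 P (Cod (C1 E) f)"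
    and F1_id [simp]: "y \<in> Obj (C1 E) \<Longrightarrow> F1 P (id1 E y) = id1 B (F0 P y)"
    and F1_comp [simp]: "\<lbrakk>f \<in> Arr (C1 E); g \<in> Arr (C1 E); Cod (C1 E) f = Dom (C1 E) g\<rbrakk>
      \<Longrightarrow> F1 P (g \<cdot>\<^bsub>E\<^esub> f) = F1 P g \<cdot>\<^bsub>B\<^esub> F1 P f"
    and F2_arr [simp]: "\<alpha> \<in> Arr (C2 E) \<Longrightarrow> F2 P \<alpha> \<in> Arr (C2 B)"
    and F2_dom [simp]: "\<alpha> \<in> Arr (C2 E) \<Longrightarrow> Dom (C2 B) (F2 P \<alpha>) = F1 P (Dom (C2 E) \<alpha>)"
    and F2_cod [simp]: "\<alpha> \<in> Arr (C2 E) \<Longrightarrow> Cod (C2 B) (F2 P \<alpha>) = F1 P (Cod (C2 E) \<alpha>)"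
    and F2_id [simp]: "f \<in> Arr (C1 E) \<Longrightarrow> F2 P (id2 E f) = id2 B (F1 P f)"
    and F2_vcomp [simp]: "\<lbrakk>\<alpha> \<in> Arr (C2 E); \<beta> \<in> Arr (C2 E); Cod (C2 E) \<alpha> = Dom (C2 E) \<beta>\<rbrakk>
      \<Longrightarrow> F2 P (\<beta> \<bullet>\<^bsub>E\<^esub> \<alpha>) = F2 P \<beta> \<bullet>\<^bsub>B\<^esub> F2 P \<alpha>"
    and F2_hcomp [simp]: "\<lbrakk>\<alpha> \<in> Arr (C2 E); \<beta> \<in> Arr (C2 E);
        Cod (C1 E) (Dom (C2 E) \<alpha>) = Dom (C1 E) (Dom (C2 E) \<beta>)\<rbrakk>
      \<Longrightarrow> F2 P (\<beta> \<star>\<^bsub>E\<^esub> \<alpha>) = F2 P \<beta> \<star>\<^bsub>B\<^esub> F2 P \<alpha>"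
begin

lemma hom_functor: "is_functor (homcat E y x) (homcat B (F0 P y) (F0 P x)) (hom_fctr P)"
  by (rule functorI) (auto simp: hom_fctr_def)

lemma F2_iso [simp]:
  assumes "iso (C2 E) \<alpha>"
  shows "iso (C2 B) (F2 P \<alpha>)" "F2 P (inv_arr (C2 E) \<alpha>) = inv_arr (C2 B) (F2 P \<alpha>)"
proof -
  have "inverse_arrs (C2 B) (F2 P \<alpha>) (F2 P (inv_arr (C2 E) \<alpha>))"
    using assms E.V.iso_arr [OF assms] by (simp add: inverse_arrs_def flip: F2_vcomp)
  then show "iso (C2 B) (F2 P \<alpha>)" "F2 P (inv_arr (C2 E) \<alpha>) = inv_arr (C2 B) (F2 P \<alpha>)"
    using B.V.inv_eqI by (auto simp: iso_def)
qed

text \<open>The identity over which a vertical cell lies is determined by the boundary of the cell; naming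
  it lets verticality be used as an equation.\<close>

lemma vert_hom1_iff:
  "v \<in> vert_hom1 E B P y x \<longleftrightarrow> v \<in> hom1 E y x \<and> F0 P y = F0 P x \<and> F1 P v = id1 B (F0 P x)"
proof
  assume "v \<in> vert_hom1 E B P y x"
  then obtain b where v: "v \<in> hom1 E y x" "b \<in> Obj (C1 B)" "F1 P v = id1 B b"
    unfolding vert_hom1_def vertical1_def by blast
  have "Dom (C1 B) (F1 P v) = F0 P y" "Cod (C1 B) (F1 P v) = F0 P x" using v(1) by simp_all
  with v show "v \<in> hom1 E y x \<and> F0 P y = F0 P x \<and> F1 P v = id1 B (F0 P x)" by simp
qed (auto simp: vert_hom1_def vertical1_def)

lemma vert_hom2_iff:
  "\<mu> \<in> vert_hom2 E B P f g \<longleftrightarrow> \<mu> \<in> hom2 E f g \<and> F1 P f = F1 P g \<and> F2 P \<mu> = id2 B (F1 P g)"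
proof
  assume "\<mu> \<in> vert_hom2 E B P f g"
  then obtain h where v: "\<mu> \<in> hom2 E f g" "h \<in> Arr (C1 B)" "F2 P \<mu> = id2 B h"
    unfolding vert_hom2_def vertical2_def by blast
  have "Dom (C2 B) (F2 P \<mu>) = F1 P f" "Cod (C2 B) (F2 P \<mu>) = F1 P g" using v(1) by simp_all
  with v show "\<mu> \<in> hom2 E f g \<and> F1 P f = F1 P g \<and> F2 P \<mu> = id2 B (F1 P g)" by simp
qed (auto simp: vert_hom2_def vertical2_def)

lemma vert_iso2_iff:
  "\<mu> \<in> vert_iso2 E B P f g \<longleftrightarrow>
     \<mu> \<in> hom2 E f g \<and> F1 P f = F1 P g \<and> F2 P \<mu> = id2 B (F1 P g) \<and> iso (C2 E) \<mu>"
  by (auto simp: vert_iso2_def vert_hom2_iff)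

lemma cartesian1_iff:
  "cartesian1 E B P f \<longleftrightarrow> f \<in> Arr (C1 E) \<and> (\<forall>w\<in>Obj (C1 E).
     (\<forall>a\<in>hom1 B (F0 P w) (F0 P (Dom (C1 E) f)). \<forall>b\<in>hom1 E w (Cod (C1 E) f).
      \<forall>\<psi>\<in>hom2 B (F1 P f \<cdot>\<^bsub>B\<^esub> a) (F1 P b). iso (C2 B) \<psi> \<longrightarrow>
        (\<exists>s\<in>hom1 E w (Dom (C1 E) f). \<exists>u\<in>hom2 B (F1 P s) a. \<exists>v\<in>hom2 E (f \<cdot>\<^bsub>E\<^esub> s) b.
           iso (C2 B) u \<and> iso (C2 E) v \<and> F2 P v = \<psi> \<bullet>\<^bsub>B\<^esub> (F1 P f \<lhd>\<^bsub>B\<^esub> u))) \<and>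
     (\<forall>s\<in>hom1 E w (Dom (C1 E) f). \<forall>t\<in>hom1 E w (Dom (C1 E) f).
      \<forall>u\<in>hom2 B (F1 P s) (F1 P t). \<forall>v\<in>hom2 E (f \<cdot>\<^bsub>E\<^esub> s) (f \<cdot>\<^bsub>E\<^esub> t).
        F2 P v = F1 P f \<lhd>\<^bsub>B\<^esub> u \<longrightarrow> (\<exists>!m. m \<in> hom2 E s t \<and> F2 P m = u \<and> f \<lhd>\<^bsub>E\<^esub> m = v)))"
  (is "_ \<longleftrightarrow> _ \<and> (\<forall>w\<in>_. ?ES w \<and> ?FF w)")
proof -
  have *: "is_equivalence (homcat E w (Dom (C1 E) f))
          (isocomma (homcat B (F0 P w) (F0 P (Dom (C1 E) f))) (homcat E w (Cod (C1 E) f))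
             (homcat B (F0 P w) (F0 P (Cod (C1 E) f))) (postcomp B (F1 P f)) (hom_fctr P))
          (isocomma_pairing (homcat E w (Dom (C1 E) f)) (hom_fctr P) (postcomp E f)
             (\<lambda>h. id2 B (F1 P (f \<cdot>\<^bsub>E\<^esub> h)))) \<longleftrightarrow> ?ES w \<and> ?FF w"
    if f: "f \<in> Arr (C1 E)" and w: "w \<in> Obj (C1 E)" for w
  proof -
    interpret functor_cospan "homcat B (F0 P w) (F0 P (Dom (C1 E) f))" "homcat E w (Cod (C1 E) f)"
        "homcat B (F0 P w) (F0 P (Cod (C1 E) f))" "postcomp B (F1 P f)" "hom_fctr P"
      using f by (auto intro!: functor_cospan.intro functor_cospan_axioms.intro
          E.category_homcat B.category_homcat B.postcomp_functor hom_functor)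
    have nat: "natural_iso (homcat E w (Dom (C1 E) f)) (homcat B (F0 P w) (F0 P (Cod (C1 E) f)))
        (comp_fctr (postcomp B (F1 P f)) (hom_fctr P)) (comp_fctr (hom_fctr P) (postcomp E f))
        (\<lambda>h. id2 B (F1 P (f \<cdot>\<^bsub>E\<^esub> h)))"
      using f by (auto simp: natural_iso_def comp_fctr_def postcomp_def hom_fctr_def)
    show ?thesis
      apply (subst pairing_equivalence_iff [OF E.category_homcat hom_functor _ nat])
       apply (use f in \<open>simp add: E.postcomp_functor\<close>)
      unfolding postcomp_def hom_fctr_def fctr.select_convs E.homcat_simps B.homcat_simps
      by (intro refl conj_cong ball_cong bex_cong imp_cong) (use f in simp_all)
  qed
  show ?thesis
    unfolding cartesian1_def Let_def by (intro conj_cong ball_cong refl) (rule *)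
qed

lemma cartesian1_lift:
  assumes "cartesian1 E B P f" "a \<in> hom1 B (F0 P w) (F0 P (Dom (C1 E) f))"
    "b \<in> hom1 E w (Cod (C1 E) f)" "\<psi> \<in> hom2 B (F1 P f \<cdot>\<^bsub>B\<^esub> a) (F1 P b)" "iso (C2 B) \<psi>"
  obtains s u v where "s \<in> hom1 E w (Dom (C1 E) f)" "u \<in> hom2 B (F1 P s) a"
    "v \<in> hom2 E (f \<cdot>\<^bsub>E\<^esub> s) b" "iso (C2 B) u" "iso (C2 E) v" "F2 P v = \<psi> \<bullet>\<^bsub>B\<^esub> (F1 P f \<lhd>\<^bsub>B\<^esub> u)"
proof -
  have "w \<in> Obj (C1 E)" using assms(3) by auto
  then show ?thesis
    using assms(1) [unfolded cartesian1_iff, THEN conjunct2, THEN bspec, THEN conjunct1,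
        rule_format, OF _ assms(2-5)] that by blast
qed

lemma cartesian1_ex1:
  assumes "cartesian1 E B P f" "s \<in> hom1 E w (Dom (C1 E) f)" "t \<in> hom1 E w (Dom (C1 E) f)"
    "u \<in> hom2 B (F1 P s) (F1 P t)" "v \<in> hom2 E (f \<cdot>\<^bsub>E\<^esub> s) (f \<cdot>\<^bsub>E\<^esub> t)" "F2 P v = F1 P f \<lhd>\<^bsub>B\<^esub> u"
  shows "\<exists>!m. m \<in> hom2 E s t \<and> F2 P m = u \<and> f \<lhd>\<^bsub>E\<^esub> m = v"
proof -
  have "w \<in> Obj (C1 E)" using assms(2) by auto
  then show ?thesis
    by (rule assms(1) [unfolded cartesian1_iff, THEN conjunct2, THEN bspec, THEN conjunct2,
        rule_format, OF _ assms(2-6)])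
qed

lemma cartesian1I:
  assumes "f \<in> Arr (C1 E)"
    and es: "\<And>w a b \<psi>. \<lbrakk>a \<in> hom1 B (F0 P w) (F0 P (Dom (C1 E) f)); b \<in> hom1 E w (Cod (C1 E) f);
      \<psi> \<in> hom2 B (F1 P f \<cdot>\<^bsub>B\<^esub> a) (F1 P b); iso (C2 B) \<psi>\<rbrakk> \<Longrightarrow>
        \<exists>s\<in>hom1 E w (Dom (C1 E) f). \<exists>u\<in>hom2 B (F1 P s) a. \<exists>v\<in>hom2 E (f \<cdot>\<^bsub>E\<^esub> s) b.
           iso (C2 B) u \<and> iso (C2 E) v \<and> F2 P v = \<psi> \<bullet>\<^bsub>B\<^esub> (F1 P f \<lhd>\<^bsub>B\<^esub> u)"
    and ff: "\<And>w s t u v. \<lbrakk>s \<in> hom1 E w (Dom (C1 E) f); t \<in> hom1 E w (Dom (C1 E) f);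
      u \<in> hom2 B (F1 P s) (F1 P t); v \<in> hom2 E (f \<cdot>\<^bsub>E\<^esub> s) (f \<cdot>\<^bsub>E\<^esub> t); F2 P v = F1 P f \<lhd>\<^bsub>B\<^esub> u\<rbrakk> \<Longrightarrow>
        \<exists>!m. m \<in> hom2 E s t \<and> F2 P m = u \<and> f \<lhd>\<^bsub>E\<^esub> m = v"
  shows "cartesian1 E B P f"
  unfolding cartesian1_iff by (intro conjI ballI impI assms(1); (rule es ff; assumption))

lemma cartesian1_arr: "cartesian1 E B P f \<Longrightarrow> f \<in> Arr (C1 E)"
  by (simp add: cartesian1_iff)

lemma cart_to_simps:
  assumes "f \<in> cart_to E B P x"
  shows "cartesian1 E B P f" "f \<in> Arr (C1 E)" "Cod (C1 E) f = x"
  using assms cartesian1_arr by (auto simp: cart_to_def)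

text \<open>A cartesian 1-cell is, in particular, fully faithful on vertical 2-cells. This is how the
  vertical 2-cells of the criterion are obtained from 2-cells between composites with \<open>f\<close>.\<close>

lemma cartesian1_lift_vertical_ex1:
  assumes "cartesian1 E B P f" "k \<in> hom1 E w (Dom (C1 E) f)" "k' \<in> hom1 E w (Dom (C1 E) f)"
    "F1 P k = F1 P k'" "n \<in> hom2 E (f \<cdot>\<^bsub>E\<^esub> k) (f \<cdot>\<^bsub>E\<^esub> k')" "F2 P n = id2 B (F1 P f \<cdot>\<^bsub>B\<^esub> F1 P k')"
  shows "\<exists>!m. m \<in> hom2 E k k' \<and> F2 P m = id2 B (F1 P k') \<and> f \<lhd>\<^bsub>E\<^esub> m = n"
  by (rule cartesian1_ex1 [OF assms(1-3)]) (use assms cartesian1_arr [OF assms(1)] in simp_all)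

lemma cartesian1_lift_vertical_iso:
  assumes f: "cartesian1 E B P f" and k: "k \<in> hom1 E w (Dom (C1 E) f)" "k' \<in> hom1 E w (Dom (C1 E) f)"
    and kk': "F1 P k = F1 P k'"
    and n: "n \<in> hom2 E (f \<cdot>\<^bsub>E\<^esub> k) (f \<cdot>\<^bsub>E\<^esub> k')" "F2 P n = id2 B (F1 P f \<cdot>\<^bsub>B\<^esub> F1 P k')" "iso (C2 E) n"
  obtains m where "m \<in> hom2 E k k'" "F2 P m = id2 B (F1 P k')" "f \<lhd>\<^bsub>E\<^esub> m = n" "iso (C2 E) m"
proof -
  note [simp] = cartesian1_arr [OF f]
  have [simp]: "k \<in> Arr (C1 E)" "Dom (C1 E) k = w" "Cod (C1 E) k = Dom (C1 E) f"
    "k' \<in> Arr (C1 E)" "Dom (C1 E) k' = w" "Cod (C1 E) k' = Dom (C1 E) f" "F1 P k = F1 P k'"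
    "n \<in> Arr (C2 E)" "Dom (C2 E) n = f \<cdot>\<^bsub>E\<^esub> k" "Cod (C2 E) n = f \<cdot>\<^bsub>E\<^esub> k'"
    "F2 P n = id2 B (F1 P f \<cdot>\<^bsub>B\<^esub> F1 P k')" "iso (C2 E) n"
    using k kk' n by simp_all
  obtain m where m: "m \<in> hom2 E k k'" "F2 P m = id2 B (F1 P k')" "f \<lhd>\<^bsub>E\<^esub> m = n"
    using cartesian1_lift_vertical_ex1 [OF f k kk' n(1,2)] by blast
  obtain m' where m': "m' \<in> hom2 E k' k" "F2 P m' = id2 B (F1 P k)" "f \<lhd>\<^bsub>E\<^esub> m' = inv_arr (C2 E) n"
    using cartesian1_lift_vertical_ex1 [OF f k(2,1) kk' [symmetric], of "inv_arr (C2 E) n"]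
    by auto
  have "m' \<bullet>\<^bsub>E\<^esub> m = id2 E k"
    by (rule ex1_eq [OF cartesian1_lift_vertical_ex1 [OF f k(1,1) refl, of "id2 E (f \<cdot>\<^bsub>E\<^esub> k)"]])
      (use m m' in simp_all)
  moreover have "m \<bullet>\<^bsub>E\<^esub> m' = id2 E k'"
    by (rule ex1_eq [OF cartesian1_lift_vertical_ex1 [OF f k(2,2) refl, of "id2 E (f \<cdot>\<^bsub>E\<^esub> k')"]])
      (use m m' in simp_all)
  ultimately have "iso (C2 E) m"
    using m m' by (intro E.V.isoI [of _ m']) simp_all
  with m show ?thesis by (rule that)
qed

text \<open>A 2-cell with the same codomain as \<open>\<alpha>\<close> is automatically parallel to it, so the hom-category in
  which \<open>\<alpha>\<close> is cartesian can be left out.\<close>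

lemma cartesian2_iff:
  "cartesian2 E B P \<alpha> \<longleftrightarrow> \<alpha> \<in> Arr (C2 E) \<and>
     (\<forall>\<gamma>\<in>Arr (C2 E). \<forall>h\<in>Arr (C2 B). Cod (C2 E) \<gamma> = Cod (C2 E) \<alpha> \<longrightarrow> Dom (C2 B) h = F1 P (Dom (C2 E) \<gamma>) \<longrightarrow>
        Cod (C2 B) h = F1 P (Dom (C2 E) \<alpha>) \<longrightarrow> F2 P \<alpha> \<bullet>\<^bsub>B\<^esub> h = F2 P \<gamma> \<longrightarrow>
        (\<exists>!k. k \<in> hom2 E (Dom (C2 E) \<gamma>) (Dom (C2 E) \<alpha>) \<and> F2 P k = h \<and> \<alpha> \<bullet>\<^bsub>E\<^esub> k = \<gamma>))"
  (is "?L \<longleftrightarrow> ?arr \<and> ?R")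
proof (cases "\<alpha> \<in> Arr (C2 E)")
  case True
  let ?y = "Dom (C1 E) (Dom (C2 E) \<alpha>)" and ?x = "Cod (C1 E) (Dom (C2 E) \<alpha>)"
  show ?thesis
  proof (intro iffI conjI ballI impI)
    fix \<gamma> h
    assume L: ?L and *: "\<gamma> \<in> Arr (C2 E)" "h \<in> Arr (C2 B)" "Cod (C2 E) \<gamma> = Cod (C2 E) \<alpha>"
      "Dom (C2 B) h = F1 P (Dom (C2 E) \<gamma>)" "Cod (C2 B) h = F1 P (Dom (C2 E) \<alpha>)" "F2 P \<alpha> \<bullet>\<^bsub>B\<^esub> h = F2 P \<gamma>"
    have [simp]: "Dom (C1 E) (Dom (C2 E) \<gamma>) = ?y" "Cod (C1 E) (Dom (C2 E) \<gamma>) = ?x"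
      using E.parallel' [OF *(1)] E.parallel' [OF True] *(3) by simp_all
    have "\<exists>!k. k \<in> hom (homcat E ?y ?x) (Dom (C2 E) \<gamma>) (Dom (C2 E) \<alpha>) \<and> F2 P k = h \<and> \<alpha> \<bullet>\<^bsub>E\<^esub> k = \<gamma>"
      using L unfolding cartesian2_def cartesian_arr_def Let_def hom_fctr_def
      using * True by simp
    then show "\<exists>!k. k \<in> hom2 E (Dom (C2 E) \<gamma>) (Dom (C2 E) \<alpha>) \<and> F2 P k = h \<and> \<alpha> \<bullet>\<^bsub>E\<^esub> k = \<gamma>"
      using * by simp
  next
    assume R: "?arr \<and> ?R"
    show ?L
      unfolding cartesian2_def cartesian_arr_def Let_def hom_fctr_def fctr.select_convs E.homcat_simps
    proof (intro conjI ballI impI)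
      fix c \<gamma> h
      assume c: "c \<in> hom1 E ?y ?x" and "\<gamma> \<in> hom (homcat E ?y ?x) c (Cod (C2 E) \<alpha>)"
        "h \<in> hom (homcat B (F0 P ?y) (F0 P ?x)) (F1 P c) (F1 P (Dom (C2 E) \<alpha>))"
        "Comp (homcat B (F0 P ?y) (F0 P ?x)) (F2 P \<alpha>) h = F2 P \<gamma>"
      then have "\<gamma> \<in> hom2 E c (Cod (C2 E) \<alpha>)" "h \<in> hom2 B (F1 P c) (F1 P (Dom (C2 E) \<alpha>))"
        "F2 P \<alpha> \<bullet>\<^bsub>B\<^esub> h = F2 P \<gamma>"
        by simp_all
      then have "\<exists>!k. k \<in> hom2 E c (Dom (C2 E) \<alpha>) \<and> F2 P k = h \<and> \<alpha> \<bullet>\<^bsub>E\<^esub> k = \<gamma>"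
        using R [THEN conjunct2, rule_format, of \<gamma> h] by simp
      then show "\<exists>!k. k \<in> hom (homcat E ?y ?x) c (Dom (C2 E) \<alpha>) \<and> F2 P k = h \<and> \<alpha> \<bullet>\<^bsub>E\<^esub> k = \<gamma>"
        using c by simp
    qed (use True in simp_all)
  qed (use True in simp)
qed (simp add: cartesian2_def)

lemma cartesian2_arr: "cartesian2 E B P \<alpha> \<Longrightarrow> \<alpha> \<in> Arr (C2 E)"
  by (simp add: cartesian2_iff)

lemma cartesian2_ex1:
  assumes "cartesian2 E B P \<alpha>" "\<gamma> \<in> Arr (C2 E)" "h \<in> Arr (C2 B)" "Cod (C2 E) \<gamma> = Cod (C2 E) \<alpha>"
    "Dom (C2 B) h = F1 P (Dom (C2 E) \<gamma>)" "Cod (C2 B) h = F1 P (Dom (C2 E) \<alpha>)" "F2 P \<alpha> \<bullet>\<^bsub>B\<^esub> h = F2 P \<gamma>"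
  shows "\<exists>!k. k \<in> hom2 E (Dom (C2 E) \<gamma>) (Dom (C2 E) \<alpha>) \<and> F2 P k = h \<and> \<alpha> \<bullet>\<^bsub>E\<^esub> k = \<gamma>"
  by (rule assms(1) [unfolded cartesian2_iff, THEN conjunct2, rule_format, OF assms(2-7)])

lemma cartesian2I:
  assumes "\<alpha> \<in> Arr (C2 E)"
    and "\<And>\<gamma> h. \<lbrakk>\<gamma> \<in> Arr (C2 E); h \<in> Arr (C2 B); Cod (C2 E) \<gamma> = Cod (C2 E) \<alpha>;
      Dom (C2 B) h = F1 P (Dom (C2 E) \<gamma>); Cod (C2 B) h = F1 P (Dom (C2 E) \<alpha>); F2 P \<alpha> \<bullet>\<^bsub>B\<^esub> h = F2 P \<gamma>\<rbrakk>
      \<Longrightarrow> \<exists>k. k \<in> hom2 E (Dom (C2 E) \<gamma>) (Dom (C2 E) \<alpha>) \<and> F2 P k = h \<and> \<alpha> \<bullet>\<^bsub>E\<^esub> k = \<gamma>"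
    and "\<And>k k'. \<lbrakk>k \<in> Arr (C2 E); k' \<in> Arr (C2 E); Dom (C2 E) k = Dom (C2 E) k';
      Cod (C2 E) k = Dom (C2 E) \<alpha>; Cod (C2 E) k' = Dom (C2 E) \<alpha>; F2 P k = F2 P k';
      \<alpha> \<bullet>\<^bsub>E\<^esub> k = \<alpha> \<bullet>\<^bsub>E\<^esub> k'\<rbrakk> \<Longrightarrow> k = k'"
  shows "cartesian2 E B P \<alpha>"
  unfolding cartesian2_iff
proof (intro conjI ballI impI ex_ex1I assms(1))
  fix \<gamma> h k k'
  assume "k \<in> hom2 E (Dom (C2 E) \<gamma>) (Dom (C2 E) \<alpha>) \<and> F2 P k = h \<and> \<alpha> \<bullet>\<^bsub>E\<^esub> k = \<gamma>"
    and "k' \<in> hom2 E (Dom (C2 E) \<gamma>) (Dom (C2 E) \<alpha>) \<and> F2 P k' = h \<and> \<alpha> \<bullet>\<^bsub>E\<^esub> k' = \<gamma>"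
  then show "k = k'" by (elim conjE) (rule assms(3), simp_all)
qed (rule assms(2))

lemma cartesian2_monic:
  assumes "cartesian2 E B P \<alpha>" "k \<in> Arr (C2 E)" "k' \<in> Arr (C2 E)" "Dom (C2 E) k = Dom (C2 E) k'"
    "Cod (C2 E) k = Dom (C2 E) \<alpha>" "Cod (C2 E) k' = Dom (C2 E) \<alpha>" "F2 P k = F2 P k'"
    "\<alpha> \<bullet>\<^bsub>E\<^esub> k = \<alpha> \<bullet>\<^bsub>E\<^esub> k'"
  shows "k = k'"
  using assms cartesian2_arr [OF assms(1)]
  by (intro ex1_eq [OF cartesian2_ex1 [OF assms(1), of "\<alpha> \<bullet>\<^bsub>E\<^esub> k'" "F2 P k'"]]) simp_all

lemma cartesian2_comp:
  assumes \<alpha>: "cartesian2 E B P \<alpha>" and \<beta>: "cartesian2 E B P \<beta>" and c: "Cod (C2 E) \<beta> = Dom (C2 E) \<alpha>"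
  shows "cartesian2 E B P (\<alpha> \<bullet>\<^bsub>E\<^esub> \<beta>)"
proof (rule cartesian2I)
  note [simp] = cartesian2_arr [OF \<alpha>] cartesian2_arr [OF \<beta>] c
  show "\<alpha> \<bullet>\<^bsub>E\<^esub> \<beta> \<in> Arr (C2 E)" by simp
  {
    fix \<gamma> h assume *: "\<gamma> \<in> Arr (C2 E)" "h \<in> Arr (C2 B)" "Cod (C2 E) \<gamma> = Cod (C2 E) (\<alpha> \<bullet>\<^bsub>E\<^esub> \<beta>)"
      "Dom (C2 B) h = F1 P (Dom (C2 E) \<gamma>)" "Cod (C2 B) h = F1 P (Dom (C2 E) (\<alpha> \<bullet>\<^bsub>E\<^esub> \<beta>))"
      "F2 P (\<alpha> \<bullet>\<^bsub>E\<^esub> \<beta>) \<bullet>\<^bsub>B\<^esub> h = F2 P \<gamma>"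
    obtain k1 where k1: "k1 \<in> hom2 E (Dom (C2 E) \<gamma>) (Dom (C2 E) \<alpha>)" "F2 P k1 = F2 P \<beta> \<bullet>\<^bsub>B\<^esub> h" "\<alpha> \<bullet>\<^bsub>E\<^esub> k1 = \<gamma>"
      using cartesian2_ex1 [OF \<alpha>, of \<gamma> "F2 P \<beta> \<bullet>\<^bsub>B\<^esub> h"] * by auto
    obtain k where "k \<in> hom2 E (Dom (C2 E) k1) (Dom (C2 E) \<beta>)" "F2 P k = h" "\<beta> \<bullet>\<^bsub>E\<^esub> k = k1"
      using cartesian2_ex1 [OF \<beta>, of k1 h] * k1 by auto
    then show "\<exists>k. k \<in> hom2 E (Dom (C2 E) \<gamma>) (Dom (C2 E) (\<alpha> \<bullet>\<^bsub>E\<^esub> \<beta>)) \<and> F2 P k = h \<and> (\<alpha> \<bullet>\<^bsub>E\<^esub> \<beta>) \<bullet>\<^bsub>E\<^esub> k = \<gamma>"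
      using k1 by (intro exI [of _ k]) simp
  }
  fix k k' assume *: "k \<in> Arr (C2 E)" "k' \<in> Arr (C2 E)" "Dom (C2 E) k = Dom (C2 E) k'"
      "Cod (C2 E) k = Dom (C2 E) (\<alpha> \<bullet>\<^bsub>E\<^esub> \<beta>)" "Cod (C2 E) k' = Dom (C2 E) (\<alpha> \<bullet>\<^bsub>E\<^esub> \<beta>)" "F2 P k = F2 P k'"
      "(\<alpha> \<bullet>\<^bsub>E\<^esub> \<beta>) \<bullet>\<^bsub>E\<^esub> k = (\<alpha> \<bullet>\<^bsub>E\<^esub> \<beta>) \<bullet>\<^bsub>E\<^esub> k'"
  then have eq: "\<beta> \<bullet>\<^bsub>E\<^esub> k = \<beta> \<bullet>\<^bsub>E\<^esub> k'"
    by (intro cartesian2_monic [OF \<alpha>, of "\<beta> \<bullet>\<^bsub>E\<^esub> k" "\<beta> \<bullet>\<^bsub>E\<^esub> k'"]) simp_all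
  show "k = k'"
    using * by (intro cartesian2_monic [OF \<beta> _ _ _ _ _ _ eq]) simp_all
qed

lemma cartesian2_iso:
  assumes "iso (C2 E) \<alpha>"
  shows "cartesian2 E B P \<alpha>"
proof (rule cartesian2I)
  note [simp] = assms E.V.iso_arr [OF assms]
  show "\<alpha> \<in> Arr (C2 E)" by simp
  {
    fix \<gamma> h assume "\<gamma> \<in> Arr (C2 E)" "h \<in> Arr (C2 B)" "Cod (C2 E) \<gamma> = Cod (C2 E) \<alpha>"
      "Dom (C2 B) h = F1 P (Dom (C2 E) \<gamma>)" "Cod (C2 B) h = F1 P (Dom (C2 E) \<alpha>)" "F2 P \<alpha> \<bullet>\<^bsub>B\<^esub> h = F2 P \<gamma>"
    then show "\<exists>k. k \<in> hom2 E (Dom (C2 E) \<gamma>) (Dom (C2 E) \<alpha>) \<and> F2 P k = h \<and> \<alpha> \<bullet>\<^bsub>E\<^esub> k = \<gamma>"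
      by (intro exI [of _ "inv_arr (C2 E) \<alpha> \<bullet>\<^bsub>E\<^esub> \<gamma>"]) (simp add: B.V.inv_comp_eq)
  }
  fix k k' assume "k \<in> Arr (C2 E)" "k' \<in> Arr (C2 E)"
      "Cod (C2 E) k = Dom (C2 E) \<alpha>" "Cod (C2 E) k' = Dom (C2 E) \<alpha>" "\<alpha> \<bullet>\<^bsub>E\<^esub> k = \<alpha> \<bullet>\<^bsub>E\<^esub> k'"
  then show "k = k'" using E.V.iso_cancel_left [OF assms] by blast
qed

text \<open>Cartesianness only depends on a 2-cell up to isomorphism of its domain and codomain.\<close>

lemma cartesian2_transport:
  assumes \<alpha>: "cartesian2 E B P \<alpha>" and pq: "iso (C2 E) p" "iso (C2 E) q"
    and \<beta>: "\<beta> \<in> Arr (C2 E)" "Cod (C2 E) \<alpha> = Dom (C2 E) p" "Dom (C2 E) q = Dom (C2 E) \<alpha>"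
      "Cod (C2 E) q = Dom (C2 E) \<beta>" "p \<bullet>\<^bsub>E\<^esub> \<alpha> = \<beta> \<bullet>\<^bsub>E\<^esub> q"
  shows "cartesian2 E B P \<beta>"
proof -
  note [simp] = cartesian2_arr [OF \<alpha>] E.V.iso_arr pq \<beta>(1-4)
  have "\<beta> = (p \<bullet>\<^bsub>E\<^esub> \<alpha>) \<bullet>\<^bsub>E\<^esub> inv_arr (C2 E) q"
    unfolding \<beta>(5) by simp
  moreover have "cartesian2 E B P ((p \<bullet>\<^bsub>E\<^esub> \<alpha>) \<bullet>\<^bsub>E\<^esub> inv_arr (C2 E) q)"
    by (intro cartesian2_comp \<alpha> cartesian2_iso) simp_all
  ultimately show ?thesis by simp
qed

text \<open>The uniqueness of cartesian lifts up to a vertical isomorphism. The isomorphisms \<open>\<tau>\<close> and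
  \<open>\<sigma>\<close> of the criterion are obtained by lifting such comparisons along a cartesian 1-cell.\<close>

lemma cartesian2_compare:
  assumes \<alpha>: "cartesian2 E B P \<alpha>" and \<alpha>': "cartesian2 E B P \<alpha>'"
    and "Cod (C2 E) \<alpha> = Cod (C2 E) \<alpha>'" "F1 P (Dom (C2 E) \<alpha>) = F1 P (Dom (C2 E) \<alpha>')" "F2 P \<alpha> = F2 P \<alpha>'"
  obtains \<tau> where "\<tau> \<in> hom2 E (Dom (C2 E) \<alpha>) (Dom (C2 E) \<alpha>')" "iso (C2 E) \<tau>"
    "F2 P \<tau> = id2 B (F1 P (Dom (C2 E) \<alpha>'))" "\<alpha>' \<bullet>\<^bsub>E\<^esub> \<tau> = \<alpha>"
proof -
  note [simp] = cartesian2_arr [OF \<alpha>] cartesian2_arr [OF \<alpha>'] assms(3-5)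
  have [simp]: "F2 P \<alpha>' \<bullet>\<^bsub>B\<^esub> id2 B (F1 P (Dom (C2 E) \<alpha>')) = F2 P \<alpha>'"
    by (rule B.V.comp_ide') simp_all
  obtain \<tau> where \<tau>: "\<tau> \<in> hom2 E (Dom (C2 E) \<alpha>) (Dom (C2 E) \<alpha>')"
    "F2 P \<tau> = id2 B (F1 P (Dom (C2 E) \<alpha>'))" "\<alpha>' \<bullet>\<^bsub>E\<^esub> \<tau> = \<alpha>"
    using cartesian2_ex1 [OF \<alpha>', of \<alpha> "id2 B (F1 P (Dom (C2 E) \<alpha>'))"] by auto
  obtain \<sigma> where \<sigma>: "\<sigma> \<in> hom2 E (Dom (C2 E) \<alpha>') (Dom (C2 E) \<alpha>)"
    "F2 P \<sigma> = id2 B (F1 P (Dom (C2 E) \<alpha>'))" "\<alpha> \<bullet>\<^bsub>E\<^esub> \<sigma> = \<alpha>'"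
    using cartesian2_ex1 [OF \<alpha>, of \<alpha>' "id2 B (F1 P (Dom (C2 E) \<alpha>'))"] by auto
  have [simp]: "\<tau> \<in> Arr (C2 E)" "Dom (C2 E) \<tau> = Dom (C2 E) \<alpha>" "Cod (C2 E) \<tau> = Dom (C2 E) \<alpha>'"
    "\<sigma> \<in> Arr (C2 E)" "Dom (C2 E) \<sigma> = Dom (C2 E) \<alpha>'" "Cod (C2 E) \<sigma> = Dom (C2 E) \<alpha>"
    using \<tau> \<sigma> by simp_all
  have "\<sigma> \<bullet>\<^bsub>E\<^esub> \<tau> = id2 E (Dom (C2 E) \<alpha>)"
    by (rule cartesian2_monic [OF \<alpha>])
      (use \<tau> \<sigma> in \<open>simp_all add: E.V.comp_extend1 [of \<alpha> \<sigma> \<alpha>']\<close>)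
  moreover have "\<tau> \<bullet>\<^bsub>E\<^esub> \<sigma> = id2 E (Dom (C2 E) \<alpha>')"
    by (rule cartesian2_monic [OF \<alpha>'])
      (use \<tau> \<sigma> in \<open>simp_all add: E.V.comp_extend1 [of \<alpha>' \<tau> \<alpha>]\<close>)
  ultimately have "iso (C2 E) \<tau>"
    by (intro E.V.isoI [of _ \<sigma>]) simp_all
  with \<tau> show ?thesis by (intro that [of \<tau>])
qed

end

text \<open>Cartesianness of a 1-cell, being stated with isocomma categories, provides factorizations that
  lie over the prescribed 1-cell only up to isomorphism, whereas vertical 1-cells lie over an
  identity strictly. Lifting invertible 2-cells bridges this gap.\<close>

locale locally_isofibrant = two_functor +
  assumes iso_lift: "\<lbrakk>k \<in> Arr (C1 E); iso (C2 B) u; Dom (C2 B) u = F1 P k\<rbrakk>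
    \<Longrightarrow> \<exists>m. iso (C2 E) m \<and> Dom (C2 E) m = k \<and> F2 P m = u"
begin

text \<open>Cartesianness gives a factorization \<open>s\<close> together with an isomorphism \<open>u\<close> from \<open>P s\<close> to \<open>h\<close>.
  Lifting \<open>u\<close> replaces \<open>s\<close> by an isomorphic 1-cell lying over \<open>h\<close> itself, and the correction
  makes the remaining isomorphism vertical.\<close>

lemma cartesian1_factor:
  assumes f: "cartesian1 E B P f" and c: "c \<in> hom1 E w (Cod (C1 E) f)"
    and h: "h \<in> hom1 B (F0 P w) (F0 P (Dom (C1 E) f))" and eq: "F1 P c = F1 P f \<cdot>\<^bsub>B\<^esub> h"
  obtains k \<theta> where "k \<in> hom1 E w (Dom (C1 E) f)" "F1 P k = h" "\<theta> \<in> hom2 E (f \<cdot>\<^bsub>E\<^esub> k) c"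
    "iso (C2 E) \<theta>" "F2 P \<theta> = id2 B (F1 P c)"
proof -
  have [simp]: "f \<in> Arr (C1 E)" "c \<in> Arr (C1 E)" "Dom (C1 E) c = w" "Cod (C1 E) c = Cod (C1 E) f"
    "h \<in> Arr (C1 B)" "Dom (C1 B) h = F0 P w" "Cod (C1 B) h = F0 P (Dom (C1 E) f)"
    "F1 P c = F1 P f \<cdot>\<^bsub>B\<^esub> h"
    using c h cartesian1_arr [OF f] eq by simp_all
  obtain s u v where suv: "s \<in> hom1 E w (Dom (C1 E) f)" "u \<in> hom2 B (F1 P s) h"
    "v \<in> hom2 E (f \<cdot>\<^bsub>E\<^esub> s) c" "iso (C2 B) u" "iso (C2 E) v"
    and v: "F2 P v = id2 B (F1 P c) \<bullet>\<^bsub>B\<^esub> (F1 P f \<lhd>\<^bsub>B\<^esub> u)"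
    by (rule cartesian1_lift [OF f h c, of "id2 B (F1 P c)"]) simp_all
  have [simp]: "s \<in> Arr (C1 E)" "Dom (C1 E) s = w" "Cod (C1 E) s = Dom (C1 E) f"
    "u \<in> Arr (C2 B)" "Dom (C2 B) u = F1 P s" "Cod (C2 B) u = h" "iso (C2 B) u"
    "v \<in> Arr (C2 E)" "Dom (C2 E) v = f \<cdot>\<^bsub>E\<^esub> s" "Cod (C2 E) v = c" "iso (C2 E) v"
    using suv by simp_all
  obtain m where m: "iso (C2 E) m" "Dom (C2 E) m = s" "F2 P m = u"
    using iso_lift [of s u] by auto
  have [simp]: "m \<in> Arr (C2 E)" "iso (C2 E) m" "Dom (C2 E) m = s" "F2 P m = u"
    using m E.V.iso_arr by simp_all
  have k: "Cod (C2 E) m \<in> hom1 E w (Dom (C1 E) f)" "F1 P (Cod (C2 E) m) = h"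
    using E.parallel' [of m] F2_cod [of m, symmetric] by simp_all
  show ?thesis
  proof (rule that [OF k, of "v \<bullet>\<^bsub>E\<^esub> (f \<lhd>\<^bsub>E\<^esub> inv_arr (C2 E) m)"])
    have "F2 P (v \<bullet>\<^bsub>E\<^esub> (f \<lhd>\<^bsub>E\<^esub> inv_arr (C2 E) m)) = (F1 P f \<lhd>\<^bsub>B\<^esub> u) \<bullet>\<^bsub>B\<^esub> inv_arr (C2 B) (F1 P f \<lhd>\<^bsub>B\<^esub> u)"
      using v by simp
    then show "F2 P (v \<bullet>\<^bsub>E\<^esub> (f \<lhd>\<^bsub>E\<^esub> inv_arr (C2 E) m)) = id2 B (F1 P c)"
      by (simp del: B.postwhisker_iso(2))
  qed simp_all
qed

end

section \<open>From the Johnstone criterion to a fibrational object\<close>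

text \<open>The assigned data concern cartesian 1-cells that are already given; that every 1-cell of the base
  has a cartesian lift is a separate assumption.\<close>

locale johnstone_lifting = locally_isofibrant E B P + johnstone_data E B P x r A
  for E :: "('o1, 'a1, 't1) two_cat" and B :: "('o2, 'a2, 't2) two_cat"
    and P :: "('o1, 'a1, 't1, 'o2, 'a2, 't2) two_fctr" and x r A +
  assumes lifts: "\<lbrakk>f \<in> Arr (C1 B); Cod (C1 B) f = F0 P x\<rbrakk> \<Longrightarrow> \<exists>g\<in>cart_to E B P x. F1 P g = f"
begin

lemma assigned_typing:
  assumes "f \<in> cart_to E B P x" "g \<in> cart_to E B P x" "a \<in> hom2 B (F1 P f) (F1 P g)"
  shows "r f g a \<in> Arr (C1 E)" "Dom (C1 E) (r f g a) = Dom (C1 E) g" "Cod (C1 E) (r f g a) = Dom (C1 E) f"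
    "F1 P (r f g a) = id1 B (F0 P (Dom (C1 E) f))"
    "A f g a \<in> Arr (C2 E)" "Dom (C2 E) (A f g a) = f \<cdot>\<^bsub>E\<^esub> r f g a" "Cod (C2 E) (A f g a) = g"
    "F2 P (A f g a) = a"
  using J0 [OF assms] J1 [OF assms] by (simp_all add: vert_hom1_iff)

text \<open>Let \<open>\<gamma> : c \<Rightarrow> g v\<close> lie over \<open>a b\<close>. Choose a cartesian \<open>e\<close> over the same 1-cell as \<open>c\<close>, so that \<open>c\<close> is
  \<open>e u\<close> for a vertical \<open>u\<close>, up to a vertical isomorphism \<open>\<theta>\<close>. By \<open>J5\<close> for the 2-cell \<open>b\<close>,
  the 2-cells \<open>c \<Rightarrow> f R v\<close> over \<open>b\<close> correspond to the vertical 2-cells \<open>u \<Rightarrow> R\<^sub>b R v\<close>; by \<open>J5\<close> for \<open>a b\<close>,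
  the given \<open>\<gamma>\<close> corresponds to one vertical 2-cell \<open>u \<Rightarrow> R\<^sub>a\<^sub>b v\<close>. The isomorphism \<open>\<tau>\<close> of \<open>J2\<close> matches
  the two kinds of vertical 2-cells, and it turns composition with \<open>\<alpha> \<rhd> v\<close> into this matching.\<close>

lemma cartesian2_assigned_vertical:
  assumes f: "f \<in> cart_to E B P x" and g: "g \<in> cart_to E B P x" and a: "a \<in> hom2 B (F1 P f) (F1 P g)"
    and v: "v \<in> vert_hom1 E B P y (Dom (C1 E) g)"
  shows "cartesian2 E B P (A f g a \<rhd>\<^bsub>E\<^esub> v)"
proof -
  obtain p q z where pqz: "Dom (C1 E) f = p" "Dom (C1 E) g = q" "F0 P y = z" by simp
  have [simp]: "F0 P q = z" "v \<in> Arr (C1 E)" "Dom (C1 E) v = y" "Cod (C1 E) v = q" "F1 P v = id1 B z"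
    using v pqz by (simp_all add: vert_hom1_iff)
  have "F0 P p = z"
  proof -
    have "Dom (C1 B) (F1 P f) = Dom (C1 B) (F1 P g)" using a B.parallel' [of a] by simp
    then show ?thesis using cart_to_simps [OF f] cart_to_simps [OF g] pqz by simp
  qed
  note [simp] = this pqz cart_to_simps(2,3) [OF f] cart_to_simps(2,3) [OF g]
    assigned_typing [OF f g a, unfolded pqz]
  have a' [simp]: "a \<in> Arr (C2 B)" "Dom (C2 B) a = F1 P f" "Cod (C2 B) a = F1 P g"
    using a by simp_all
  have [simp]: "y \<in> Obj (C1 E)"
    using E.H.dom_Obj [of v] by simp
  then have [simp]: "z \<in> Obj (C1 B)"
    using F0_Obj [of y] pqz(3) by simp
  let ?R = "r f g a" and ?\<alpha> = "A f g a"
  have main: "\<exists>!k. k \<in> hom2 E c (f \<cdot>\<^bsub>E\<^esub> ?R \<cdot>\<^bsub>E\<^esub> v) \<and> F2 P k = b \<and> (?\<alpha> \<rhd>\<^bsub>E\<^esub> v) \<bullet>\<^bsub>E\<^esub> k = \<gamma>"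
    if \<gamma>0: "\<gamma> \<in> hom2 E c (g \<cdot>\<^bsub>E\<^esub> v)" and b0: "b \<in> hom2 B (F1 P c) (F1 P f)" and ab: "a \<bullet>\<^bsub>B\<^esub> b = F2 P \<gamma>"
    for c \<gamma> b
  proof -
    have [simp]: "\<gamma> \<in> Arr (C2 E)" "Dom (C2 E) \<gamma> = c" "Cod (C2 E) \<gamma> = g \<cdot>\<^bsub>E\<^esub> v"
      "b \<in> Arr (C2 B)" "Dom (C2 B) b = F1 P c" "Cod (C2 B) b = F1 P f" "F2 P \<gamma> = a \<bullet>\<^bsub>B\<^esub> b"
      using \<gamma>0 b0 ab by simp_all
    have [simp]: "c \<in> Arr (C1 E)" "Dom (C1 E) c = y" "Cod (C1 E) c = x"
      using E.parallel' [of \<gamma>] E.arr_dom2 [of \<gamma>] by simp_all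
    obtain e where e: "e \<in> cart_to E B P x" "F1 P e = F1 P c"
      using lifts [of "F1 P c"] by auto
    obtain s where s: "Dom (C1 E) e = s" by simp
    note [simp] = e(2) cart_to_simps(2,3) [OF e(1)] s
    have [simp]: "F0 P s = z"
      using F1_dom [of e] by (simp add: pqz)
    have ab': "a \<bullet>\<^bsub>B\<^esub> b \<in> hom2 B (F1 P e) (F1 P g)" and b': "b \<in> hom2 B (F1 P e) (F1 P f)"
      by simp_all
    obtain u \<theta> where u\<theta>: "u \<in> hom1 E y s" "F1 P u = id1 B z"
      "\<theta> \<in> hom2 E (e \<cdot>\<^bsub>E\<^esub> u) c" "iso (C2 E) \<theta>" "F2 P \<theta> = id2 B (F1 P c)"
      by (rule cartesian1_factor [OF cart_to_simps(1) [OF e(1)], of c y "id1 B z"]) (simp_all add: pqz)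
    have [simp]: "u \<in> Arr (C1 E)" "Dom (C1 E) u = y" "Cod (C1 E) u = s" "F1 P u = id1 B z"
      "\<theta> \<in> Arr (C2 E)" "Dom (C2 E) \<theta> = e \<cdot>\<^bsub>E\<^esub> u" "Cod (C2 E) \<theta> = c" "iso (C2 E) \<theta>"
      "F2 P \<theta> = id2 B (F1 P c)"
      using u\<theta> by simp_all
    note [simp] = assigned_typing [OF e(1) g ab', unfolded s pqz] assigned_typing [OF e(1) f b', unfolded s pqz]
    let ?Rb = "r e f b" and ?\<beta> = "A e f b" and ?Rab = "r e g (a \<bullet>\<^bsub>B\<^esub> b)" and ?\<delta> = "A e g (a \<bullet>\<^bsub>B\<^esub> b)"
    obtain \<tau> where \<tau>: "\<tau> \<in> vert_iso2 E B P (?Rb \<cdot>\<^bsub>E\<^esub> ?R) ?Rab"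
      and \<alpha>\<tau>: "?\<alpha> \<bullet>\<^bsub>E\<^esub> (?\<beta> \<rhd>\<^bsub>E\<^esub> ?R) \<bullet>\<^bsub>E\<^esub> (e \<lhd>\<^bsub>E\<^esub> inv_arr (C2 E) \<tau>) = ?\<delta>"
      using J2 [OF e(1) f g b' a] by blast
    have [simp]: "\<tau> \<in> Arr (C2 E)" "Dom (C2 E) \<tau> = ?Rb \<cdot>\<^bsub>E\<^esub> ?R" "Cod (C2 E) \<tau> = ?Rab" "iso (C2 E) \<tau>"
      "F2 P \<tau> = id2 B (id1 B z)"
      using \<tau> by (simp_all add: vert_iso2_iff)
    have "(?\<alpha> \<bullet>\<^bsub>E\<^esub> (?\<beta> \<rhd>\<^bsub>E\<^esub> ?R) \<bullet>\<^bsub>E\<^esub> (e \<lhd>\<^bsub>E\<^esub> inv_arr (C2 E) \<tau>)) \<bullet>\<^bsub>E\<^esub> (e \<lhd>\<^bsub>E\<^esub> \<tau>) = ?\<alpha> \<bullet>\<^bsub>E\<^esub> (?\<beta> \<rhd>\<^bsub>E\<^esub> ?R)"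
      by (simp flip: E.postwhisker_iso(2))
    then have "?\<alpha> \<bullet>\<^bsub>E\<^esub> (?\<beta> \<rhd>\<^bsub>E\<^esub> ?R) = ?\<delta> \<bullet>\<^bsub>E\<^esub> (e \<lhd>\<^bsub>E\<^esub> \<tau>)"
      unfolding \<alpha>\<tau> by simp
    from arg_cong [OF this, of "\<lambda>\<omega>. \<omega> \<rhd>\<^bsub>E\<^esub> v"]
    have \<alpha>\<beta>: "(?\<alpha> \<rhd>\<^bsub>E\<^esub> v) \<bullet>\<^bsub>E\<^esub> (?\<beta> \<rhd>\<^bsub>E\<^esub> (?R \<cdot>\<^bsub>E\<^esub> v)) = (?\<delta> \<rhd>\<^bsub>E\<^esub> v) \<bullet>\<^bsub>E\<^esub> (e \<lhd>\<^bsub>E\<^esub> (\<tau> \<rhd>\<^bsub>E\<^esub> v))"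
      by simp
    have \<nu>: "\<exists>!\<nu>. \<nu> \<in> vert_hom2 E B P u (?Rb \<cdot>\<^bsub>E\<^esub> ?R \<cdot>\<^bsub>E\<^esub> v) \<and> (?\<beta> \<rhd>\<^bsub>E\<^esub> (?R \<cdot>\<^bsub>E\<^esub> v)) \<bullet>\<^bsub>E\<^esub> (e \<lhd>\<^bsub>E\<^esub> \<nu>) = k \<bullet>\<^bsub>E\<^esub> \<theta>"
      if "k \<in> hom2 E c (f \<cdot>\<^bsub>E\<^esub> ?R \<cdot>\<^bsub>E\<^esub> v)" "F2 P k = b" for k
      by (rule J5 [OF e(1) f b', where y = y]) (use that in \<open>simp_all add: vert_hom1_iff pqz\<close>)
    have \<mu>: "\<exists>!\<mu>. \<mu> \<in> vert_hom2 E B P u (?Rab \<cdot>\<^bsub>E\<^esub> v) \<and> (?\<delta> \<rhd>\<^bsub>E\<^esub> v) \<bullet>\<^bsub>E\<^esub> (e \<lhd>\<^bsub>E\<^esub> \<mu>) = \<gamma> \<bullet>\<^bsub>E\<^esub> \<theta>"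
      by (rule J5 [OF e(1) g ab', where y = y]) (simp_all add: vert_hom1_iff pqz)
    show ?thesis
    proof (rule ex_ex1I)
      obtain \<mu> where \<mu>: "\<mu> \<in> vert_hom2 E B P u (?Rab \<cdot>\<^bsub>E\<^esub> v)" "(?\<delta> \<rhd>\<^bsub>E\<^esub> v) \<bullet>\<^bsub>E\<^esub> (e \<lhd>\<^bsub>E\<^esub> \<mu>) = \<gamma> \<bullet>\<^bsub>E\<^esub> \<theta>"
        using \<mu> by blast
      have [simp]: "\<mu> \<in> Arr (C2 E)" "Dom (C2 E) \<mu> = u" "Cod (C2 E) \<mu> = ?Rab \<cdot>\<^bsub>E\<^esub> v"
        "F2 P \<mu> = id2 B (id1 B z)"
        using \<mu>(1) by (simp_all add: vert_hom2_iff)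
      let ?\<nu> = "inv_arr (C2 E) (\<tau> \<rhd>\<^bsub>E\<^esub> v) \<bullet>\<^bsub>E\<^esub> \<mu>"
      let ?k = "(?\<beta> \<rhd>\<^bsub>E\<^esub> (?R \<cdot>\<^bsub>E\<^esub> v)) \<bullet>\<^bsub>E\<^esub> (e \<lhd>\<^bsub>E\<^esub> ?\<nu>) \<bullet>\<^bsub>E\<^esub> inv_arr (C2 E) \<theta>"
      have "(?\<alpha> \<rhd>\<^bsub>E\<^esub> v) \<bullet>\<^bsub>E\<^esub> ?k = ((?\<alpha> \<rhd>\<^bsub>E\<^esub> v) \<bullet>\<^bsub>E\<^esub> (?\<beta> \<rhd>\<^bsub>E\<^esub> (?R \<cdot>\<^bsub>E\<^esub> v))) \<bullet>\<^bsub>E\<^esub> (e \<lhd>\<^bsub>E\<^esub> ?\<nu>) \<bullet>\<^bsub>E\<^esub> inv_arr (C2 E) \<theta>"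
        by simp
      also have "\<dots> = (?\<delta> \<rhd>\<^bsub>E\<^esub> v) \<bullet>\<^bsub>E\<^esub> (e \<lhd>\<^bsub>E\<^esub> ((\<tau> \<rhd>\<^bsub>E\<^esub> v) \<bullet>\<^bsub>E\<^esub> ?\<nu>)) \<bullet>\<^bsub>E\<^esub> inv_arr (C2 E) \<theta>"
        unfolding \<alpha>\<beta> by simp
      also have "\<dots> = ((?\<delta> \<rhd>\<^bsub>E\<^esub> v) \<bullet>\<^bsub>E\<^esub> (e \<lhd>\<^bsub>E\<^esub> \<mu>)) \<bullet>\<^bsub>E\<^esub> inv_arr (C2 E) \<theta>"
        by (simp del: E.prewhisker_iso(2))
      also have "\<dots> = \<gamma>"
        unfolding \<mu>(2) by simp
      finally show "\<exists>k. k \<in> hom2 E c (f \<cdot>\<^bsub>E\<^esub> ?R \<cdot>\<^bsub>E\<^esub> v) \<and> F2 P k = b \<and> (?\<alpha> \<rhd>\<^bsub>E\<^esub> v) \<bullet>\<^bsub>E\<^esub> k = \<gamma>"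
        by (intro exI [of _ ?k]) simp
    next
      fix k k'
      assume k: "k \<in> hom2 E c (f \<cdot>\<^bsub>E\<^esub> ?R \<cdot>\<^bsub>E\<^esub> v) \<and> F2 P k = b \<and> (?\<alpha> \<rhd>\<^bsub>E\<^esub> v) \<bullet>\<^bsub>E\<^esub> k = \<gamma>"
        and k': "k' \<in> hom2 E c (f \<cdot>\<^bsub>E\<^esub> ?R \<cdot>\<^bsub>E\<^esub> v) \<and> F2 P k' = b \<and> (?\<alpha> \<rhd>\<^bsub>E\<^esub> v) \<bullet>\<^bsub>E\<^esub> k' = \<gamma>"
      obtain \<nu> where \<nu>1: "\<nu> \<in> vert_hom2 E B P u (?Rb \<cdot>\<^bsub>E\<^esub> ?R \<cdot>\<^bsub>E\<^esub> v)"
        "(?\<beta> \<rhd>\<^bsub>E\<^esub> (?R \<cdot>\<^bsub>E\<^esub> v)) \<bullet>\<^bsub>E\<^esub> (e \<lhd>\<^bsub>E\<^esub> \<nu>) = k \<bullet>\<^bsub>E\<^esub> \<theta>"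
        using \<nu> [of k] k by blast
      obtain \<nu>' where \<nu>2: "\<nu>' \<in> vert_hom2 E B P u (?Rb \<cdot>\<^bsub>E\<^esub> ?R \<cdot>\<^bsub>E\<^esub> v)"
        "(?\<beta> \<rhd>\<^bsub>E\<^esub> (?R \<cdot>\<^bsub>E\<^esub> v)) \<bullet>\<^bsub>E\<^esub> (e \<lhd>\<^bsub>E\<^esub> \<nu>') = k' \<bullet>\<^bsub>E\<^esub> \<theta>"
        using \<nu> [of k'] k' by blast
      have tr: "(\<tau> \<rhd>\<^bsub>E\<^esub> v) \<bullet>\<^bsub>E\<^esub> n \<in> vert_hom2 E B P u (?Rab \<cdot>\<^bsub>E\<^esub> v) \<and>
          (?\<delta> \<rhd>\<^bsub>E\<^esub> v) \<bullet>\<^bsub>E\<^esub> (e \<lhd>\<^bsub>E\<^esub> ((\<tau> \<rhd>\<^bsub>E\<^esub> v) \<bullet>\<^bsub>E\<^esub> n)) = \<gamma> \<bullet>\<^bsub>E\<^esub> \<theta>"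
        if n: "n \<in> vert_hom2 E B P u (?Rb \<cdot>\<^bsub>E\<^esub> ?R \<cdot>\<^bsub>E\<^esub> v)" "(?\<beta> \<rhd>\<^bsub>E\<^esub> (?R \<cdot>\<^bsub>E\<^esub> v)) \<bullet>\<^bsub>E\<^esub> (e \<lhd>\<^bsub>E\<^esub> n) = l \<bullet>\<^bsub>E\<^esub> \<theta>"
          and l: "l \<in> hom2 E c (f \<cdot>\<^bsub>E\<^esub> ?R \<cdot>\<^bsub>E\<^esub> v) \<and> F2 P l = b \<and> (?\<alpha> \<rhd>\<^bsub>E\<^esub> v) \<bullet>\<^bsub>E\<^esub> l = \<gamma>" for n l
      proof
        have [simp]: "n \<in> Arr (C2 E)" "Dom (C2 E) n = u" "Cod (C2 E) n = ?Rb \<cdot>\<^bsub>E\<^esub> ?R \<cdot>\<^bsub>E\<^esub> v"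
          "F2 P n = id2 B (id1 B z)" "l \<in> Arr (C2 E)" "Dom (C2 E) l = c" "Cod (C2 E) l = f \<cdot>\<^bsub>E\<^esub> ?R \<cdot>\<^bsub>E\<^esub> v"
          using n(1) l by (simp_all add: vert_hom2_iff)
        show "(\<tau> \<rhd>\<^bsub>E\<^esub> v) \<bullet>\<^bsub>E\<^esub> n \<in> vert_hom2 E B P u (?Rab \<cdot>\<^bsub>E\<^esub> v)"
          by (simp add: vert_hom2_iff)
        have "(?\<delta> \<rhd>\<^bsub>E\<^esub> v) \<bullet>\<^bsub>E\<^esub> (e \<lhd>\<^bsub>E\<^esub> ((\<tau> \<rhd>\<^bsub>E\<^esub> v) \<bullet>\<^bsub>E\<^esub> n)) = ((?\<delta> \<rhd>\<^bsub>E\<^esub> v) \<bullet>\<^bsub>E\<^esub> (e \<lhd>\<^bsub>E\<^esub> (\<tau> \<rhd>\<^bsub>E\<^esub> v))) \<bullet>\<^bsub>E\<^esub> (e \<lhd>\<^bsub>E\<^esub> n)"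
          by simp
        also have "\<dots> = (?\<alpha> \<rhd>\<^bsub>E\<^esub> v) \<bullet>\<^bsub>E\<^esub> ((?\<beta> \<rhd>\<^bsub>E\<^esub> (?R \<cdot>\<^bsub>E\<^esub> v)) \<bullet>\<^bsub>E\<^esub> (e \<lhd>\<^bsub>E\<^esub> n))"
          by (simp flip: \<alpha>\<beta>)
        also have "\<dots> = ((?\<alpha> \<rhd>\<^bsub>E\<^esub> v) \<bullet>\<^bsub>E\<^esub> l) \<bullet>\<^bsub>E\<^esub> \<theta>"
          unfolding n(2) by simp
        also have "\<dots> = \<gamma> \<bullet>\<^bsub>E\<^esub> \<theta>"
          using l by simp
        finally show "(?\<delta> \<rhd>\<^bsub>E\<^esub> v) \<bullet>\<^bsub>E\<^esub> (e \<lhd>\<^bsub>E\<^esub> ((\<tau> \<rhd>\<^bsub>E\<^esub> v) \<bullet>\<^bsub>E\<^esub> n)) = \<gamma> \<bullet>\<^bsub>E\<^esub> \<theta>" .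
      qed
      have "(\<tau> \<rhd>\<^bsub>E\<^esub> v) \<bullet>\<^bsub>E\<^esub> \<nu> = (\<tau> \<rhd>\<^bsub>E\<^esub> v) \<bullet>\<^bsub>E\<^esub> \<nu>'"
        by (rule ex1_eq [OF \<mu> tr [OF \<nu>1 k] tr [OF \<nu>2 k']])
      then have "\<nu> = \<nu>'"
        using \<nu>1(1) \<nu>2(1) by (intro E.V.iso_cancel_left [of "\<tau> \<rhd>\<^bsub>E\<^esub> v" \<nu> \<nu>']) (simp_all add: vert_hom2_iff)
      then have "k \<bullet>\<^bsub>E\<^esub> \<theta> = k' \<bullet>\<^bsub>E\<^esub> \<theta>"
        using \<nu>1(2) \<nu>2(2) by simp
      then show "k = k'"
        using k k' by (intro E.V.iso_cancel_right [of \<theta> k k']) simp_all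
    qed
  qed
  show ?thesis
    unfolding cartesian2_iff
  proof (intro conjI ballI impI)
    fix \<gamma> b assume "\<gamma> \<in> Arr (C2 E)" "b \<in> Arr (C2 B)" "Cod (C2 E) \<gamma> = Cod (C2 E) (?\<alpha> \<rhd>\<^bsub>E\<^esub> v)"
      "Dom (C2 B) b = F1 P (Dom (C2 E) \<gamma>)" "Cod (C2 B) b = F1 P (Dom (C2 E) (?\<alpha> \<rhd>\<^bsub>E\<^esub> v))"
      "F2 P (?\<alpha> \<rhd>\<^bsub>E\<^esub> v) \<bullet>\<^bsub>B\<^esub> b = F2 P \<gamma>"
    then show "\<exists>!k. k \<in> hom2 E (Dom (C2 E) \<gamma>) (Dom (C2 E) (?\<alpha> \<rhd>\<^bsub>E\<^esub> v)) \<and> F2 P k = b \<and> (?\<alpha> \<rhd>\<^bsub>E\<^esub> v) \<bullet>\<^bsub>E\<^esub> k = \<gamma>"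
      using main [of \<gamma> "Dom (C2 E) \<gamma>" b] by simp
  qed simp
qed

text \<open>Let \<open>m\<close> lie over \<open>k\<close>. With \<open>g'\<close> cartesian over \<open>P g k\<close>, the composite \<open>g m\<close> factors through \<open>g'\<close> by a
  vertical \<open>v\<close>, and so \<open>m\<close> is isomorphic to \<open>kg v\<close>. Now \<open>J4\<close> identifies \<open>\<alpha> \<rhd> kg\<close>, up to isomorphism,
  with the 2-cell \<open>\<alpha>'\<close> assigned to \<open>a \<rhd> k\<close>, and \<open>\<alpha>' \<rhd> v\<close> is cartesian by the case of vertical 1-cells.\<close>

lemma cartesian2_assigned:
  assumes f: "f \<in> cart_to E B P x" and g: "g \<in> cart_to E B P x" and a: "a \<in> hom2 B (F1 P f) (F1 P g)"
    and m: "m \<in> hom1 E w (Dom (C1 E) g)"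
  shows "cartesian2 E B P (A f g a \<rhd>\<^bsub>E\<^esub> m)"
proof -
  obtain p q z where pqz: "Dom (C1 E) f = p" "Dom (C1 E) g = q" "F0 P q = z" by simp
  have "F0 P p = z"
  proof -
    have "Dom (C1 B) (F1 P f) = Dom (C1 B) (F1 P g)" using a B.parallel' [of a] by simp
    then show ?thesis using cart_to_simps [OF f] cart_to_simps [OF g] pqz by simp
  qed
  note [simp] = this pqz cart_to_simps(2,3) [OF f] cart_to_simps(2,3) [OF g]
    assigned_typing [OF f g a, unfolded pqz]
  have [simp]: "a \<in> Arr (C2 B)" "Dom (C2 B) a = F1 P f" "Cod (C2 B) a = F1 P g"
    "m \<in> Arr (C1 E)" "Dom (C1 E) m = w" "Cod (C1 E) m = q"
    using a m by simp_all
  have [simp]: "w \<in> Obj (C1 E)"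
    using E.H.dom_Obj [of m] by simp
  define k where "k = F1 P m"
  have k [simp]: "k \<in> Arr (C1 B)" "Dom (C1 B) k = F0 P w" "Cod (C1 B) k = z" "F1 P m = k"
    by (simp_all add: k_def)
  obtain f' where f': "f' \<in> cart_to E B P x" "F1 P f' = F1 P f \<cdot>\<^bsub>B\<^esub> k"
    using lifts [of "F1 P f \<cdot>\<^bsub>B\<^esub> k"] by auto
  obtain g' where g': "g' \<in> cart_to E B P x" "F1 P g' = F1 P g \<cdot>\<^bsub>B\<^esub> k"
    using lifts [of "F1 P g \<cdot>\<^bsub>B\<^esub> k"] by auto
  obtain p' q' where pq': "Dom (C1 E) f' = p'" "Dom (C1 E) g' = q'" by simp
  note [simp] = pq' f'(2) g'(2) cart_to_simps(2,3) [OF f'(1)] cart_to_simps(2,3) [OF g'(1)]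
  have [simp]: "F0 P p' = F0 P w" "F0 P q' = F0 P w"
    using F1_dom [of f'] F1_dom [of g'] by simp_all
  obtain kf \<rho> where kf: "kf \<in> hom1 E p' p" "F1 P kf = k"
    and \<rho>: "\<rho> \<in> hom2 E (f \<cdot>\<^bsub>E\<^esub> kf) f'" "iso (C2 E) \<rho>" "F2 P \<rho> = id2 B (F1 P f')"
    by (rule cartesian1_factor [OF cart_to_simps(1) [OF f], of f' p' k]) simp_all
  obtain kg \<pi> where kg: "kg \<in> hom1 E q' q" "F1 P kg = k"
    and \<pi>: "\<pi> \<in> hom2 E (g \<cdot>\<^bsub>E\<^esub> kg) g'" "iso (C2 E) \<pi>" "F2 P \<pi> = id2 B (F1 P g')"
    by (rule cartesian1_factor [OF cart_to_simps(1) [OF g], of g' q' k]) simp_all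
  obtain v \<theta> where v: "v \<in> hom1 E w q'" "F1 P v = id1 B (F0 P w)"
    and \<theta>: "\<theta> \<in> hom2 E (g' \<cdot>\<^bsub>E\<^esub> v) (g \<cdot>\<^bsub>E\<^esub> m)" "iso (C2 E) \<theta>" "F2 P \<theta> = id2 B (F1 P (g \<cdot>\<^bsub>E\<^esub> m))"
    by (rule cartesian1_factor [OF cart_to_simps(1) [OF g'(1)], of "g \<cdot>\<^bsub>E\<^esub> m" w "id1 B (F0 P w)"]) simp_all
  have [simp]: "kf \<in> Arr (C1 E)" "Dom (C1 E) kf = p'" "Cod (C1 E) kf = p" "F1 P kf = k"
    "kg \<in> Arr (C1 E)" "Dom (C1 E) kg = q'" "Cod (C1 E) kg = q" "F1 P kg = k"
    "v \<in> Arr (C1 E)" "Dom (C1 E) v = w" "Cod (C1 E) v = q'" "F1 P v = id1 B (F0 P w)"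
    "\<rho> \<in> Arr (C2 E)" "Dom (C2 E) \<rho> = f \<cdot>\<^bsub>E\<^esub> kf" "Cod (C2 E) \<rho> = f'" "iso (C2 E) \<rho>"
    "\<pi> \<in> Arr (C2 E)" "Dom (C2 E) \<pi> = g \<cdot>\<^bsub>E\<^esub> kg" "Cod (C2 E) \<pi> = g'" "iso (C2 E) \<pi>"
    "\<theta> \<in> Arr (C2 E)" "Dom (C2 E) \<theta> = g' \<cdot>\<^bsub>E\<^esub> v" "Cod (C2 E) \<theta> = g \<cdot>\<^bsub>E\<^esub> m" "iso (C2 E) \<theta>"
    "F2 P \<rho> = id2 B (F1 P f \<cdot>\<^bsub>B\<^esub> k)" "F2 P \<pi> = id2 B (F1 P g \<cdot>\<^bsub>B\<^esub> k)" "F2 P \<theta> = id2 B (F1 P g \<cdot>\<^bsub>B\<^esub> k)"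
    using kf kg v \<rho> \<pi> \<theta> by simp_all
  obtain \<psi> where \<psi>: "\<psi> \<in> hom2 E (kg \<cdot>\<^bsub>E\<^esub> v) m" "g \<lhd>\<^bsub>E\<^esub> \<psi> = \<theta> \<bullet>\<^bsub>E\<^esub> (\<pi> \<rhd>\<^bsub>E\<^esub> v)" "iso (C2 E) \<psi>"
    by (rule cartesian1_lift_vertical_iso [OF cart_to_simps(1) [OF g], of "kg \<cdot>\<^bsub>E\<^esub> v" w m "\<theta> \<bullet>\<^bsub>E\<^esub> (\<pi> \<rhd>\<^bsub>E\<^esub> v)"])
      simp_all
  have [simp]: "\<psi> \<in> Arr (C2 E)" "Dom (C2 E) \<psi> = kg \<cdot>\<^bsub>E\<^esub> v" "Cod (C2 E) \<psi> = m" "iso (C2 E) \<psi>"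
    using \<psi> by simp_all
  have ak: "a \<rhd>\<^bsub>B\<^esub> k \<in> hom2 B (F1 P f') (F1 P g')" by simp
  note [simp] = assigned_typing [OF f'(1) g'(1) ak, unfolded pq']
  let ?R = "r f g a" and ?\<alpha> = "A f g a" and ?R' = "r f' g' (a \<rhd>\<^bsub>B\<^esub> k)" and ?\<alpha>' = "A f' g' (a \<rhd>\<^bsub>B\<^esub> k)"
  have "\<exists>\<sigma>\<in>vert_iso2 E B P (kf \<cdot>\<^bsub>E\<^esub> ?R') (?R \<cdot>\<^bsub>E\<^esub> kg).
      \<pi> \<bullet>\<^bsub>E\<^esub> (?\<alpha> \<rhd>\<^bsub>E\<^esub> kg) \<bullet>\<^bsub>E\<^esub> (f \<lhd>\<^bsub>E\<^esub> \<sigma>) = ?\<alpha>' \<bullet>\<^bsub>E\<^esub> (\<rho> \<rhd>\<^bsub>E\<^esub> ?R')"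
    by (rule J4 [OF f g a _ f'(1) _ g'(1), of k "F0 P w" kf kg \<rho> \<pi>]) (simp_all add: vert_iso2_iff)
  then obtain \<sigma> where \<sigma>: "\<sigma> \<in> vert_iso2 E B P (kf \<cdot>\<^bsub>E\<^esub> ?R') (?R \<cdot>\<^bsub>E\<^esub> kg)"
    and eq: "\<pi> \<bullet>\<^bsub>E\<^esub> (?\<alpha> \<rhd>\<^bsub>E\<^esub> kg) \<bullet>\<^bsub>E\<^esub> (f \<lhd>\<^bsub>E\<^esub> \<sigma>) = ?\<alpha>' \<bullet>\<^bsub>E\<^esub> (\<rho> \<rhd>\<^bsub>E\<^esub> ?R')" ..
  have [simp]: "\<sigma> \<in> Arr (C2 E)" "Dom (C2 E) \<sigma> = kf \<cdot>\<^bsub>E\<^esub> ?R'" "Cod (C2 E) \<sigma> = ?R \<cdot>\<^bsub>E\<^esub> kg" "iso (C2 E) \<sigma>"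
    using \<sigma> by (simp_all add: vert_iso2_iff)
  have eqv: "(\<pi> \<rhd>\<^bsub>E\<^esub> v) \<bullet>\<^bsub>E\<^esub> (?\<alpha> \<rhd>\<^bsub>E\<^esub> (kg \<cdot>\<^bsub>E\<^esub> v)) \<bullet>\<^bsub>E\<^esub> (f \<lhd>\<^bsub>E\<^esub> (\<sigma> \<rhd>\<^bsub>E\<^esub> v)) = (?\<alpha>' \<rhd>\<^bsub>E\<^esub> v) \<bullet>\<^bsub>E\<^esub> (\<rho> \<rhd>\<^bsub>E\<^esub> (?R' \<cdot>\<^bsub>E\<^esub> v))"
    using arg_cong [OF eq, of "\<lambda>\<omega>. \<omega> \<rhd>\<^bsub>E\<^esub> v"] by simp
  have "cartesian2 E B P (?\<alpha>' \<rhd>\<^bsub>E\<^esub> v)"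
    by (rule cartesian2_assigned_vertical [OF f'(1) g'(1) ak]) (simp add: vert_hom1_iff)
  then have "cartesian2 E B P (?\<alpha> \<rhd>\<^bsub>E\<^esub> (kg \<cdot>\<^bsub>E\<^esub> v))"
  proof (rule cartesian2_transport)
    let ?q = "(f \<lhd>\<^bsub>E\<^esub> (\<sigma> \<rhd>\<^bsub>E\<^esub> v)) \<bullet>\<^bsub>E\<^esub> inv_arr (C2 E) (\<rho> \<rhd>\<^bsub>E\<^esub> (?R' \<cdot>\<^bsub>E\<^esub> v))"
    have "inv_arr (C2 E) (\<pi> \<rhd>\<^bsub>E\<^esub> v) \<bullet>\<^bsub>E\<^esub> (?\<alpha>' \<rhd>\<^bsub>E\<^esub> v)
        = inv_arr (C2 E) (\<pi> \<rhd>\<^bsub>E\<^esub> v) \<bullet>\<^bsub>E\<^esub> ((?\<alpha>' \<rhd>\<^bsub>E\<^esub> v) \<bullet>\<^bsub>E\<^esub> (\<rho> \<rhd>\<^bsub>E\<^esub> (?R' \<cdot>\<^bsub>E\<^esub> v))) \<bullet>\<^bsub>E\<^esub> inv_arr (C2 E) (\<rho> \<rhd>\<^bsub>E\<^esub> (?R' \<cdot>\<^bsub>E\<^esub> v))"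
      by (simp del: E.prewhisker_iso(2))
    also have "\<dots> = (?\<alpha> \<rhd>\<^bsub>E\<^esub> (kg \<cdot>\<^bsub>E\<^esub> v)) \<bullet>\<^bsub>E\<^esub> ?q"
      by (simp flip: eqv del: E.prewhisker_iso(2))
    finally show "inv_arr (C2 E) (\<pi> \<rhd>\<^bsub>E\<^esub> v) \<bullet>\<^bsub>E\<^esub> (?\<alpha>' \<rhd>\<^bsub>E\<^esub> v) = (?\<alpha> \<rhd>\<^bsub>E\<^esub> (kg \<cdot>\<^bsub>E\<^esub> v)) \<bullet>\<^bsub>E\<^esub> ?q" .
  qed simp_all
  then show ?thesis
  proof (rule cartesian2_transport)
    show "(g \<lhd>\<^bsub>E\<^esub> \<psi>) \<bullet>\<^bsub>E\<^esub> (?\<alpha> \<rhd>\<^bsub>E\<^esub> (kg \<cdot>\<^bsub>E\<^esub> v)) = (?\<alpha> \<rhd>\<^bsub>E\<^esub> m) \<bullet>\<^bsub>E\<^esub> ((f \<cdot>\<^bsub>E\<^esub> ?R) \<lhd>\<^bsub>E\<^esub> \<psi>)"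
      by (rule E.whisker_exchange [symmetric]) simp_all
  qed simp_all
qed

text \<open>A 1-cell into \<open>x\<close> factors as a cartesian 1-cell after a vertical one, so the assigned 2-cells,
  whiskered with vertical 1-cells, provide cartesian lifts along every 1-cell into \<open>x\<close>.\<close>

lemma chosen_cartesian_lift:
  assumes g: "g \<in> hom1 E y x" and a: "a \<in> hom2 B b (F1 P g)"
  obtains f' g' v \<theta> where "f' \<in> cart_to E B P x" "F1 P f' = b" "g' \<in> cart_to E B P x" "F1 P g' = F1 P g"
    "v \<in> vert_hom1 E B P y (Dom (C1 E) g')" "\<theta> \<in> hom2 E (g' \<cdot>\<^bsub>E\<^esub> v) g" "iso (C2 E) \<theta>"
    "F2 P \<theta> = id2 B (F1 P g)" "a \<in> hom2 B (F1 P f') (F1 P g')"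
    "cartesian2 E B P (\<theta> \<bullet>\<^bsub>E\<^esub> (A f' g' a \<rhd>\<^bsub>E\<^esub> v))" "F2 P (\<theta> \<bullet>\<^bsub>E\<^esub> (A f' g' a \<rhd>\<^bsub>E\<^esub> v)) = a"
proof -
  have [simp]: "g \<in> Arr (C1 E)" "Dom (C1 E) g = y" "Cod (C1 E) g = x"
    "a \<in> Arr (C2 B)" "Dom (C2 B) a = b" "Cod (C2 B) a = F1 P g"
    using g a by simp_all
  have [simp]: "b \<in> Arr (C1 B)" "Dom (C1 B) b = F0 P y" "Cod (C1 B) b = F0 P x"
    using B.parallel' [of a] B.arr_dom2 [of a] by simp_all
  have [simp]: "y \<in> Obj (C1 E)" using E.H.dom_Obj [of g] by simp
  obtain f' where f': "f' \<in> cart_to E B P x" "F1 P f' = b" using lifts [of b] by auto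
  obtain g' where g': "g' \<in> cart_to E B P x" "F1 P g' = F1 P g" using lifts [of "F1 P g"] by auto
  obtain q where q: "Dom (C1 E) g' = q" by simp
  note [simp] = cart_to_simps(2,3) [OF f'(1)] cart_to_simps(2,3) [OF g'(1)] f'(2) g'(2) q
  have [simp]: "F0 P q = F0 P y" "F0 P (Dom (C1 E) f') = F0 P y"
    using F1_dom [of g'] F1_dom [of f'] by simp_all
  have a': "a \<in> hom2 B (F1 P f') (F1 P g')" by simp
  note [simp] = assigned_typing [OF f'(1) g'(1) a', unfolded q]
  obtain v \<theta> where *: "v \<in> hom1 E y q" "F1 P v = id1 B (F0 P y)" "\<theta> \<in> hom2 E (g' \<cdot>\<^bsub>E\<^esub> v) g"
    "iso (C2 E) \<theta>" "F2 P \<theta> = id2 B (F1 P g)"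
    by (rule cartesian1_factor [OF cart_to_simps(1) [OF g'(1)], of g y "id1 B (F0 P y)"]) simp_all
  then have v: "v \<in> vert_hom1 E B P y (Dom (C1 E) g')" by (simp add: vert_hom1_iff)
  have [simp]: "v \<in> Arr (C1 E)" "Dom (C1 E) v = y" "Cod (C1 E) v = q" "F1 P v = id1 B (F0 P y)"
    "\<theta> \<in> Arr (C2 E)" "Dom (C2 E) \<theta> = g' \<cdot>\<^bsub>E\<^esub> v" "Cod (C2 E) \<theta> = g" "F2 P \<theta> = id2 B (F1 P g)"
    using * by simp_all
  show ?thesis
  proof (rule that [OF f' g' v *(3-5) a'])
    show "cartesian2 E B P (\<theta> \<bullet>\<^bsub>E\<^esub> (A f' g' a \<rhd>\<^bsub>E\<^esub> v))"
      by (rule cartesian2_comp [OF cartesian2_iso [OF *(4)]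
            cartesian2_assigned_vertical [OF f'(1) g'(1) a' v]]) simp
  qed simp
qed

text \<open>Whiskering preserves cartesianness: a cartesian \<open>\<alpha>\<close> agrees up to isomorphism with the chosen
  lift of \<open>P \<alpha>\<close>, which is an assigned 2-cell whiskered with some \<open>v\<close>, and whiskering that with \<open>k\<close> gives
  the same assigned 2-cell whiskered with \<open>v k\<close>.\<close>

theorem fibrational:
  assumes x: "x \<in> Obj (C1 E)"
  shows "fibrational E B P x"
  unfolding fibrational_def
proof (intro conjI ballI impI allI x)
  fix f assume "f \<in> Arr (C1 B)" "Cod (C1 B) f = F0 P x"
  then obtain g where "g \<in> cart_to E B P x" "F1 P g = f" using lifts by blast
  then show "\<exists>g. cartesian1 E B P g \<and> Cod (C1 E) g = x \<and> F1 P g = f"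
    by (auto simp: cart_to_def)
next
  fix y assume y: "y \<in> Obj (C1 E)"
  show "grothendieck_fibration (homcat E y x) (homcat B (F0 P y) (F0 P x)) (hom_fctr P)"
    unfolding grothendieck_fibration_def
  proof (intro conjI ballI impI hom_functor)
    fix g a assume "g \<in> Obj (homcat E y x)" "a \<in> Arr (homcat B (F0 P y) (F0 P x))"
      "Cod (homcat B (F0 P y) (F0 P x)) a = FO (hom_fctr P) g"
    then have g: "g \<in> hom1 E y x" and a: "a \<in> hom2 B (Dom (C2 B) a) (F1 P g)"
      by (simp_all add: hom_fctr_def)
    obtain f' g' v \<theta> where f': "f' \<in> cart_to E B P x" "F1 P f' = Dom (C2 B) a"
      and g': "g' \<in> cart_to E B P x"
      and v: "v \<in> vert_hom1 E B P y (Dom (C1 E) g')"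
      and \<theta>: "\<theta> \<in> hom2 E (g' \<cdot>\<^bsub>E\<^esub> v) g" and a': "a \<in> hom2 B (F1 P f') (F1 P g')"
      and c: "cartesian2 E B P (\<theta> \<bullet>\<^bsub>E\<^esub> (A f' g' a \<rhd>\<^bsub>E\<^esub> v))" "F2 P (\<theta> \<bullet>\<^bsub>E\<^esub> (A f' g' a \<rhd>\<^bsub>E\<^esub> v)) = a"
      by (rule chosen_cartesian_lift [OF g a])
    let ?l = "\<theta> \<bullet>\<^bsub>E\<^esub> (A f' g' a \<rhd>\<^bsub>E\<^esub> v)"
    have "?l \<in> hom2 E (f' \<cdot>\<^bsub>E\<^esub> r f' g' a \<cdot>\<^bsub>E\<^esub> v) g"
      using assigned_typing [OF f'(1) g' a'] cart_to_simps(2,3) [OF f'(1)] cart_to_simps(2,3) [OF g'] v \<theta>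
      by (simp add: vert_hom1_iff)
    then have "cartesian_arr (homcat E y x) (homcat B (F0 P y) (F0 P x)) (hom_fctr P) ?l
        \<and> Cod (C2 E) ?l = g \<and> F2 P ?l = a"
      using c g E.parallel' [of ?l] unfolding cartesian2_def Let_def by simp
    then show "\<exists>l. cartesian_arr (homcat E y x) (homcat B (F0 P y) (F0 P x)) (hom_fctr P) l
        \<and> Cod (homcat E y x) l = g \<and> FA (hom_fctr P) l = a"
      by (auto simp: hom_fctr_def)
  qed
next
  fix y w f g \<alpha> k
  assume f: "f \<in> hom1 E y x" and g: "g \<in> hom1 E y x" and \<alpha>: "\<alpha> \<in> hom2 E f g"
    and k: "k \<in> hom1 E w y" and c: "cartesian2 E B P \<alpha>"
  have [simp]: "\<alpha> \<in> Arr (C2 E)" "Dom (C2 E) \<alpha> = f" "Cod (C2 E) \<alpha> = g"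
    "f \<in> Arr (C1 E)" "Dom (C1 E) f = y" "Cod (C1 E) f = x"
    "g \<in> Arr (C1 E)" "Dom (C1 E) g = y" "Cod (C1 E) g = x"
    "k \<in> Arr (C1 E)" "Dom (C1 E) k = w" "Cod (C1 E) k = y"
    using f g \<alpha> k by simp_all
  have a: "F2 P \<alpha> \<in> hom2 B (F1 P f) (F1 P g)" by simp
  obtain f' g' v \<theta> where f': "f' \<in> cart_to E B P x" "F1 P f' = F1 P f"
    and g': "g' \<in> cart_to E B P x" "F1 P g' = F1 P g"
    and v: "v \<in> vert_hom1 E B P y (Dom (C1 E) g')"
    and \<theta>: "\<theta> \<in> hom2 E (g' \<cdot>\<^bsub>E\<^esub> v) g" "iso (C2 E) \<theta>" and a': "F2 P \<alpha> \<in> hom2 B (F1 P f') (F1 P g')"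
    and c': "cartesian2 E B P (\<theta> \<bullet>\<^bsub>E\<^esub> (A f' g' (F2 P \<alpha>) \<rhd>\<^bsub>E\<^esub> v))"
      "F2 P (\<theta> \<bullet>\<^bsub>E\<^esub> (A f' g' (F2 P \<alpha>) \<rhd>\<^bsub>E\<^esub> v)) = F2 P \<alpha>"
    by (rule chosen_cartesian_lift [OF g a])
  let ?R = "r f' g' (F2 P \<alpha>)" and ?A = "A f' g' (F2 P \<alpha>)"
  obtain q where q: "Dom (C1 E) g' = q" by simp
  note [simp] = cart_to_simps(2,3) [OF f'(1)] cart_to_simps(2,3) [OF g'(1)] f'(2) g'(2)
    assigned_typing [OF f'(1) g'(1) a', unfolded q] q
  have [simp]: "v \<in> Arr (C1 E)" "Dom (C1 E) v = y" "Cod (C1 E) v = q"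
    "F1 P v = id1 B (F0 P (Dom (C1 E) f'))" "F0 P q = F0 P y"
    "\<theta> \<in> Arr (C2 E)" "Dom (C2 E) \<theta> = g' \<cdot>\<^bsub>E\<^esub> v" "Cod (C2 E) \<theta> = g" "iso (C2 E) \<theta>"
    "F0 P (Dom (C1 E) f') = F0 P y"
    using v \<theta> F1_dom [of f'] by (simp_all add: vert_hom1_iff)
  have [simp]: "y \<in> Obj (C1 E)" using E.H.dom_Obj [of f] by simp
  obtain \<tau> where \<tau>: "\<tau> \<in> hom2 E f (f' \<cdot>\<^bsub>E\<^esub> ?R \<cdot>\<^bsub>E\<^esub> v)" "iso (C2 E) \<tau>" "(\<theta> \<bullet>\<^bsub>E\<^esub> (?A \<rhd>\<^bsub>E\<^esub> v)) \<bullet>\<^bsub>E\<^esub> \<tau> = \<alpha>"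
    by (rule cartesian2_compare [OF c c'(1)]) (use c'(2) in simp_all)
  have [simp]: "\<tau> \<in> Arr (C2 E)" "Dom (C2 E) \<tau> = f" "Cod (C2 E) \<tau> = f' \<cdot>\<^bsub>E\<^esub> ?R \<cdot>\<^bsub>E\<^esub> v" "iso (C2 E) \<tau>"
    using \<tau> by simp_all
  have "cartesian2 E B P (?A \<rhd>\<^bsub>E\<^esub> (v \<cdot>\<^bsub>E\<^esub> k))"
    by (rule cartesian2_assigned [OF f'(1) g'(1) a', of _ w]) simp
  from cartesian2_comp [OF cartesian2_iso [of "\<theta> \<rhd>\<^bsub>E\<^esub> k"]
      cartesian2_comp [OF this cartesian2_iso [of "\<tau> \<rhd>\<^bsub>E\<^esub> k"]]]
  have "cartesian2 E B P ((\<theta> \<rhd>\<^bsub>E\<^esub> k) \<bullet>\<^bsub>E\<^esub> (?A \<rhd>\<^bsub>E\<^esub> (v \<cdot>\<^bsub>E\<^esub> k)) \<bullet>\<^bsub>E\<^esub> (\<tau> \<rhd>\<^bsub>E\<^esub> k))"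
    by simp
  also have "(\<theta> \<rhd>\<^bsub>E\<^esub> k) \<bullet>\<^bsub>E\<^esub> (?A \<rhd>\<^bsub>E\<^esub> (v \<cdot>\<^bsub>E\<^esub> k)) \<bullet>\<^bsub>E\<^esub> (\<tau> \<rhd>\<^bsub>E\<^esub> k) = \<alpha> \<rhd>\<^bsub>E\<^esub> k"
    using arg_cong [OF \<tau>(3), of "\<lambda>\<omega>. \<omega> \<rhd>\<^bsub>E\<^esub> k"] by simp
  finally show "cartesian2 E B P (\<alpha> \<rhd>\<^bsub>E\<^esub> k)" .
qed

end

section \<open>From a fibrational object to the Johnstone criterion\<close>

context locally_isofibrant
begin

text \<open>Assign to \<open>a\<close> a cartesian lift along \<open>g\<close>, its domain replaced by the isomorphic \<open>f R\<close> with \<open>R\<close>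
  vertical. The 2-cells compared in \<open>J2\<close>, \<open>J3\<close> and \<open>J4\<close> are composites of assigned 2-cells, whiskered
  assigned 2-cells and isomorphisms, hence cartesian, and they lie over the same 2-cell. So they
  differ by a vertical isomorphism between 1-cells of the form \<open>f s\<close>, and this lifts along the cartesian \<open>f\<close>.
  \<open>J5\<close> combines the universal property of \<open>\<alpha> \<rhd> v1\<close> with that of \<open>f\<close>.\<close>

lemma fibrational_imp_johnstone_data:
  assumes fib: "fibrational E B P x"
  shows "\<exists>r A. johnstone_data E B P x r A"
proof -
  have lift: "\<exists>R \<alpha>. R \<in> vert_hom1 E B P (Dom (C1 E) g) (Dom (C1 E) f) \<and> \<alpha> \<in> hom2 E (f \<cdot>\<^bsub>E\<^esub> R) g \<and>
      F2 P \<alpha> = a \<and> cartesian2 E B P \<alpha>"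
    if f: "f \<in> cart_to E B P x" and g: "g \<in> cart_to E B P x" and a: "a \<in> hom2 B (F1 P f) (F1 P g)"
    for f g a
  proof -
    obtain q where q: "Dom (C1 E) g = q" by simp
    note [simp] = cart_to_simps(2,3) [OF f] cart_to_simps(2,3) [OF g] q
    have [simp]: "q \<in> Obj (C1 E)" using E.H.dom_Obj [of g] by simp
    have [simp]: "a \<in> Arr (C2 B)" "Dom (C2 B) a = F1 P f" "Cod (C2 B) a = F1 P g"
      using a by simp_all
    have [simp]: "F0 P (Dom (C1 E) f) = F0 P q"
      using B.parallel' [of a] by simp
    have "grothendieck_fibration (homcat E q x) (homcat B (F0 P q) (F0 P x)) (hom_fctr P)"
      using fib unfolding fibrational_def by simp
    note this [unfolded grothendieck_fibration_def, THEN conjunct2, rule_format, of g a]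
    then have "\<exists>\<alpha>. cartesian_arr (homcat E q x) (homcat B (F0 P q) (F0 P x)) (hom_fctr P) \<alpha>
        \<and> Cod (homcat E q x) \<alpha> = g \<and> FA (hom_fctr P) \<alpha> = a"
      by (simp add: hom_fctr_def)
    then obtain \<alpha> where \<alpha>: "cartesian_arr (homcat E q x) (homcat B (F0 P q) (F0 P x)) (hom_fctr P) \<alpha>"
      "Cod (C2 E) \<alpha> = g" "F2 P \<alpha> = a"
      by (auto simp: hom_fctr_def)
    then have typed: "\<alpha> \<in> Arr (C2 E)" "Dom (C1 E) (Dom (C2 E) \<alpha>) = q" "Cod (C1 E) (Dom (C2 E) \<alpha>) = x"
      unfolding cartesian_arr_def by simp_all
    note [simp] = typed \<alpha>(2,3)
    have c: "cartesian2 E B P \<alpha>"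
      using \<alpha>(1) unfolding cartesian2_def by simp
    obtain R \<theta> where *: "R \<in> hom1 E q (Dom (C1 E) f)" "F1 P R = id1 B (F0 P q)"
      "\<theta> \<in> hom2 E (f \<cdot>\<^bsub>E\<^esub> R) (Dom (C2 E) \<alpha>)" "iso (C2 E) \<theta>" "F2 P \<theta> = id2 B (F1 P (Dom (C2 E) \<alpha>))"
      by (rule cartesian1_factor [OF cart_to_simps(1) [OF f], of "Dom (C2 E) \<alpha>" q "id1 B (F0 P q)"])
        (use F2_dom [of \<alpha>] in simp_all)
    have "cartesian2 E B P (\<alpha> \<bullet>\<^bsub>E\<^esub> \<theta>)"
      by (rule cartesian2_comp [OF c cartesian2_iso [OF *(4)]]) (use * in simp)
    moreover have "F2 P (\<alpha> \<bullet>\<^bsub>E\<^esub> \<theta>) = a"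
      using * F2_dom [of \<alpha>] by simp
    ultimately show ?thesis
      using * by (intro exI [of _ R] exI [of _ "\<alpha> \<bullet>\<^bsub>E\<^esub> \<theta>"]) (simp add: vert_hom1_iff)
  qed
  define pair where "pair f g a = (SOME p. fst p \<in> vert_hom1 E B P (Dom (C1 E) g) (Dom (C1 E) f) \<and>
      snd p \<in> hom2 E (f \<cdot>\<^bsub>E\<^esub> fst p) g \<and> F2 P (snd p) = a \<and> cartesian2 E B P (snd p))" for f g a
  define r where "r f g a = fst (pair f g a)" for f g a
  define A where "A f g a = snd (pair f g a)" for f g a
  have rA: "r f g a \<in> vert_hom1 E B P (Dom (C1 E) g) (Dom (C1 E) f)" "A f g a \<in> hom2 E (f \<cdot>\<^bsub>E\<^esub> r f g a) g"
      "F2 P (A f g a) = a" "cartesian2 E B P (A f g a)"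
    if "f \<in> cart_to E B P x" "g \<in> cart_to E B P x" "a \<in> hom2 B (F1 P f) (F1 P g)" for f g a
  proof -
    have "\<exists>p. fst p \<in> vert_hom1 E B P (Dom (C1 E) g) (Dom (C1 E) f) \<and>
      snd p \<in> hom2 E (f \<cdot>\<^bsub>E\<^esub> fst p) g \<and> F2 P (snd p) = a \<and> cartesian2 E B P (snd p)"
      using lift [OF that] by auto
    from someI_ex [OF this] show "r f g a \<in> vert_hom1 E B P (Dom (C1 E) g) (Dom (C1 E) f)"
      "A f g a \<in> hom2 E (f \<cdot>\<^bsub>E\<^esub> r f g a) g" "F2 P (A f g a) = a" "cartesian2 E B P (A f g a)"
      unfolding r_def A_def pair_def by blast+
  qed
  have rs: "r f g a \<in> Arr (C1 E)" "Dom (C1 E) (r f g a) = Dom (C1 E) g" "Cod (C1 E) (r f g a) = Dom (C1 E) f"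
      "F1 P (r f g a) = id1 B (F0 P (Dom (C1 E) g))" "F0 P (Dom (C1 E) f) = F0 P (Dom (C1 E) g)"
      "A f g a \<in> Arr (C2 E)" "Dom (C2 E) (A f g a) = f \<cdot>\<^bsub>E\<^esub> r f g a" "Cod (C2 E) (A f g a) = g"
      "F2 P (A f g a) = a" "a \<in> Arr (C2 B)" "Dom (C2 B) a = F1 P f" "Cod (C2 B) a = F1 P g"
    if "f \<in> cart_to E B P x" "g \<in> cart_to E B P x" "a \<in> hom2 B (F1 P f) (F1 P g)" for f g a
    using rA [OF that] that(3) by (simp_all add: vert_hom1_iff)
  have whisker: "cartesian2 E B P (A f g a \<rhd>\<^bsub>E\<^esub> k)"
    if "f \<in> cart_to E B P x" "g \<in> cart_to E B P x" "a \<in> hom2 B (F1 P f) (F1 P g)"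
      "k \<in> hom1 E y (Dom (C1 E) g)" for f g a k y
  proof -
    note [simp] = rs [OF that(1-3)] cart_to_simps(2,3) [OF that(1)] cart_to_simps(2,3) [OF that(2)]
    have "f \<cdot>\<^bsub>E\<^esub> r f g a \<in> hom1 E (Dom (C1 E) g) x" "g \<in> hom1 E (Dom (C1 E) g) x"
      "A f g a \<in> hom2 E (f \<cdot>\<^bsub>E\<^esub> r f g a) g"
      by simp_all
    then show ?thesis
      using fib rA(4) [OF that(1-3)] that(4) unfolding fibrational_def by blast
  qed
  have "johnstone_data E B P x r A"
  proof
    fix f g a assume fga: "f \<in> cart_to E B P x" "g \<in> cart_to E B P x" "a \<in> hom2 B (F1 P f) (F1 P g)"
    show "r f g a \<in> vert_hom1 E B P (Dom (C1 E) g) (Dom (C1 E) f)" by (rule rA(1) [OF fga])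
    show "A f g a \<in> hom2 E (f \<cdot>\<^bsub>E\<^esub> r f g a) g \<and> F2 P (A f g a) = a"
      using rA(2,3) [OF fga] by blast
  next
    fix f g h a b
    assume f: "f \<in> cart_to E B P x" and g: "g \<in> cart_to E B P x" and h: "h \<in> cart_to E B P x"
      and a: "a \<in> hom2 B (F1 P f) (F1 P g)" and b: "b \<in> hom2 B (F1 P g) (F1 P h)"
    have ba: "b \<bullet>\<^bsub>B\<^esub> a \<in> hom2 B (F1 P f) (F1 P h)" using a b by simp
    obtain s where s: "Dom (C1 E) h = s" by simp
    note [simp] = cart_to_simps(2,3) [OF f] cart_to_simps(2,3) [OF g] cart_to_simps(2,3) [OF h]
      rs [OF f g a] rs [OF g h b, unfolded s] rs(1-9) [OF f h ba, unfolded s] s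
    have [simp]: "s \<in> Obj (C1 E)" using E.H.dom_Obj [of h] by simp
    have c: "cartesian2 E B P (A g h b \<bullet>\<^bsub>E\<^esub> (A f g a \<rhd>\<^bsub>E\<^esub> r g h b))"
      by (rule cartesian2_comp [OF rA(4) [OF g h b] whisker [OF f g a, of _ s]]) simp_all
    obtain n where n: "n \<in> hom2 E (f \<cdot>\<^bsub>E\<^esub> r f g a \<cdot>\<^bsub>E\<^esub> r g h b) (f \<cdot>\<^bsub>E\<^esub> r f h (b \<bullet>\<^bsub>B\<^esub> a))" "iso (C2 E) n"
      "F2 P n = id2 B (F1 P f)" "A f h (b \<bullet>\<^bsub>B\<^esub> a) \<bullet>\<^bsub>E\<^esub> n = A g h b \<bullet>\<^bsub>E\<^esub> (A f g a \<rhd>\<^bsub>E\<^esub> r g h b)"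
      by (rule cartesian2_compare [OF c rA(4) [OF f h ba]]) simp_all
    obtain \<tau> where \<tau>: "\<tau> \<in> hom2 E (r f g a \<cdot>\<^bsub>E\<^esub> r g h b) (r f h (b \<bullet>\<^bsub>B\<^esub> a))"
      "F2 P \<tau> = id2 B (F1 P (r f h (b \<bullet>\<^bsub>B\<^esub> a)))" "f \<lhd>\<^bsub>E\<^esub> \<tau> = n" "iso (C2 E) \<tau>"
      by (rule cartesian1_lift_vertical_iso [OF cart_to_simps(1) [OF f],
            of "r f g a \<cdot>\<^bsub>E\<^esub> r g h b" s "r f h (b \<bullet>\<^bsub>B\<^esub> a)" n]) (use n in simp_all)
    have [simp]: "\<tau> \<in> Arr (C2 E)" "Dom (C2 E) \<tau> = r f g a \<cdot>\<^bsub>E\<^esub> r g h b" "Cod (C2 E) \<tau> = r f h (b \<bullet>\<^bsub>B\<^esub> a)"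
      "iso (C2 E) \<tau>" "n \<in> Arr (C2 E)" "Dom (C2 E) n = f \<cdot>\<^bsub>E\<^esub> r f g a \<cdot>\<^bsub>E\<^esub> r g h b"
      "Cod (C2 E) n = f \<cdot>\<^bsub>E\<^esub> r f h (b \<bullet>\<^bsub>B\<^esub> a)" "iso (C2 E) n"
      using \<tau> n by simp_all
    have "A g h b \<bullet>\<^bsub>E\<^esub> (A f g a \<rhd>\<^bsub>E\<^esub> r g h b) \<bullet>\<^bsub>E\<^esub> (f \<lhd>\<^bsub>E\<^esub> inv_arr (C2 E) \<tau>)
        = (A g h b \<bullet>\<^bsub>E\<^esub> (A f g a \<rhd>\<^bsub>E\<^esub> r g h b)) \<bullet>\<^bsub>E\<^esub> inv_arr (C2 E) n"
      by (simp flip: \<tau>(3))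
    also have "\<dots> = A f h (b \<bullet>\<^bsub>B\<^esub> a)"
      by (simp flip: n(4))
    finally show "\<exists>\<tau>\<in>vert_iso2 E B P (r f g a \<cdot>\<^bsub>E\<^esub> r g h b) (r f h (b \<bullet>\<^bsub>B\<^esub> a)).
        A g h b \<bullet>\<^bsub>E\<^esub> (A f g a \<rhd>\<^bsub>E\<^esub> r g h b) \<bullet>\<^bsub>E\<^esub> (f \<lhd>\<^bsub>E\<^esub> inv_arr (C2 E) \<tau>) = A f h (b \<bullet>\<^bsub>B\<^esub> a)"
      using \<tau> by (intro bexI [of _ \<tau>]) (simp_all add: vert_iso2_iff)
  next
    fix f assume f: "f \<in> cart_to E B P x"
    note [simp] = cart_to_simps(2,3) [OF f]
    obtain p where p: "Dom (C1 E) f = p" by simp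
    let ?i = "id2 B (F1 P f)"
    have i: "?i \<in> hom2 B (F1 P f) (F1 P f)" by simp
    note [simp] = rs(1-4,6-9) [OF f f i, unfolded p] p
    have [simp]: "p \<in> Obj (C1 E)" using E.H.dom_Obj [of f] by simp
    have c: "cartesian2 E B P (id2 E f)" by (rule cartesian2_iso) simp
    obtain n where n: "n \<in> hom2 E f (f \<cdot>\<^bsub>E\<^esub> r f f ?i)" "iso (C2 E) n"
      "F2 P n = id2 B (F1 P f)" "A f f ?i \<bullet>\<^bsub>E\<^esub> n = id2 E f"
      by (rule cartesian2_compare [OF c rA(4) [OF f f i]]) simp_all
    obtain \<tau> where \<tau>: "\<tau> \<in> hom2 E (id1 E p) (r f f ?i)"
      "F2 P \<tau> = id2 B (F1 P (r f f ?i))" "f \<lhd>\<^bsub>E\<^esub> \<tau> = n" "iso (C2 E) \<tau>"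
      by (rule cartesian1_lift_vertical_iso [OF cart_to_simps(1) [OF f],
            of "id1 E p" p "r f f ?i" n]) (use n in simp_all)
    have [simp]: "\<tau> \<in> Arr (C2 E)" "Dom (C2 E) \<tau> = id1 E p" "Cod (C2 E) \<tau> = r f f ?i"
      "iso (C2 E) \<tau>" "n \<in> Arr (C2 E)" "Dom (C2 E) n = f"
      "Cod (C2 E) n = f \<cdot>\<^bsub>E\<^esub> r f f ?i" "iso (C2 E) n"
      using \<tau> n by simp_all
    have "f \<lhd>\<^bsub>E\<^esub> inv_arr (C2 E) \<tau> = (A f f ?i \<bullet>\<^bsub>E\<^esub> n) \<bullet>\<^bsub>E\<^esub> inv_arr (C2 E) n"
      unfolding n(4) by (simp flip: \<tau>(3))
    also have "\<dots> = A f f ?i" by simp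
    finally show "\<exists>\<tau>\<in>vert_iso2 E B P (id1 E (Dom (C1 E) f)) (r f f ?i).
        f \<lhd>\<^bsub>E\<^esub> inv_arr (C2 E) \<tau> = A f f ?i"
      using \<tau> by (intro bexI [of _ \<tau>]) (simp_all add: vert_iso2_iff)
  next
    fix f g a k z f' g' kf kg \<rho> \<pi>
    assume f: "f \<in> cart_to E B P x" and g: "g \<in> cart_to E B P x" and a: "a \<in> hom2 B (F1 P f) (F1 P g)"
      and k: "k \<in> hom1 B z (Dom (C1 B) (F1 P f))"
      and f': "f' \<in> cart_to E B P x" "F1 P f' = F1 P f \<cdot>\<^bsub>B\<^esub> k"
      and g': "g' \<in> cart_to E B P x" "F1 P g' = F1 P g \<cdot>\<^bsub>B\<^esub> k"
      and kf: "kf \<in> hom1 E (Dom (C1 E) f') (Dom (C1 E) f)" "F1 P kf = k"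
      and kg: "kg \<in> hom1 E (Dom (C1 E) g') (Dom (C1 E) g)" "F1 P kg = k"
      and \<rho>: "\<rho> \<in> vert_iso2 E B P (f \<cdot>\<^bsub>E\<^esub> kf) f'" and \<pi>: "\<pi> \<in> vert_iso2 E B P (g \<cdot>\<^bsub>E\<^esub> kg) g'"
    obtain q' where q': "Dom (C1 E) g' = q'" by simp
    note [simp] = cart_to_simps(2,3) [OF f] cart_to_simps(2,3) [OF g] cart_to_simps(2,3) [OF f'(1)]
      cart_to_simps(2,3) [OF g'(1)] rs [OF f g a] f'(2) g'(2) q'
    have [simp]: "k \<in> Arr (C1 B)" "Dom (C1 B) k = z" "Cod (C1 B) k = F0 P (Dom (C1 E) g)"
      using k by simp_all
    have ak: "a \<rhd>\<^bsub>B\<^esub> k \<in> hom2 B (F1 P f') (F1 P g')" by simp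
    note [simp] = rs(1-9) [OF f'(1) g'(1) ak, unfolded q']
    have [simp]: "F0 P q' = z" using F1_dom [of g'] by simp
    have [simp]: "q' \<in> Obj (C1 E)" using E.H.dom_Obj [of g'] by simp
    then have [simp]: "z \<in> Obj (C1 B)" using F0_Obj [of q'] by simp
    have [simp]: "kf \<in> Arr (C1 E)" "Dom (C1 E) kf = Dom (C1 E) f'" "Cod (C1 E) kf = Dom (C1 E) f" "F1 P kf = k"
      "kg \<in> Arr (C1 E)" "Dom (C1 E) kg = q'" "Cod (C1 E) kg = Dom (C1 E) g" "F1 P kg = k"
      "\<rho> \<in> Arr (C2 E)" "Dom (C2 E) \<rho> = f \<cdot>\<^bsub>E\<^esub> kf" "Cod (C2 E) \<rho> = f'" "iso (C2 E) \<rho>"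
      "\<pi> \<in> Arr (C2 E)" "Dom (C2 E) \<pi> = g \<cdot>\<^bsub>E\<^esub> kg" "Cod (C2 E) \<pi> = g'" "iso (C2 E) \<pi>"
      "F2 P \<rho> = id2 B (F1 P f \<cdot>\<^bsub>B\<^esub> k)" "F2 P \<pi> = id2 B (F1 P g \<cdot>\<^bsub>B\<^esub> k)"
      using kf kg \<rho> \<pi> by (simp_all add: vert_iso2_iff)
    let ?R = "r f g a" and ?\<alpha> = "A f g a" and ?R' = "r f' g' (a \<rhd>\<^bsub>B\<^esub> k)" and ?\<alpha>' = "A f' g' (a \<rhd>\<^bsub>B\<^esub> k)"
    have c: "cartesian2 E B P (\<pi> \<bullet>\<^bsub>E\<^esub> (?\<alpha> \<rhd>\<^bsub>E\<^esub> kg))"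
      by (rule cartesian2_comp [OF cartesian2_iso whisker [OF f g a, of _ q']]) simp_all
    have c': "cartesian2 E B P (?\<alpha>' \<bullet>\<^bsub>E\<^esub> (\<rho> \<rhd>\<^bsub>E\<^esub> ?R'))"
      by (rule cartesian2_comp [OF rA(4) [OF f'(1) g'(1) ak] cartesian2_iso]) simp_all
    obtain n where n: "n \<in> hom2 E (f \<cdot>\<^bsub>E\<^esub> kf \<cdot>\<^bsub>E\<^esub> ?R') (f \<cdot>\<^bsub>E\<^esub> ?R \<cdot>\<^bsub>E\<^esub> kg)" "iso (C2 E) n"
      "F2 P n = id2 B (F1 P f \<cdot>\<^bsub>B\<^esub> k)" "(\<pi> \<bullet>\<^bsub>E\<^esub> (?\<alpha> \<rhd>\<^bsub>E\<^esub> kg)) \<bullet>\<^bsub>E\<^esub> n = ?\<alpha>' \<bullet>\<^bsub>E\<^esub> (\<rho> \<rhd>\<^bsub>E\<^esub> ?R')"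
      by (rule cartesian2_compare [OF c' c]) simp_all
    obtain \<sigma> where \<sigma>: "\<sigma> \<in> hom2 E (kf \<cdot>\<^bsub>E\<^esub> ?R') (?R \<cdot>\<^bsub>E\<^esub> kg)"
      "F2 P \<sigma> = id2 B (F1 P (?R \<cdot>\<^bsub>E\<^esub> kg))" "f \<lhd>\<^bsub>E\<^esub> \<sigma> = n" "iso (C2 E) \<sigma>"
      by (rule cartesian1_lift_vertical_iso [OF cart_to_simps(1) [OF f],
            of "kf \<cdot>\<^bsub>E\<^esub> ?R'" q' "?R \<cdot>\<^bsub>E\<^esub> kg" n]) (use n in simp_all)
    then show "\<exists>\<sigma>\<in>vert_iso2 E B P (kf \<cdot>\<^bsub>E\<^esub> ?R') (?R \<cdot>\<^bsub>E\<^esub> kg).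
        \<pi> \<bullet>\<^bsub>E\<^esub> (?\<alpha> \<rhd>\<^bsub>E\<^esub> kg) \<bullet>\<^bsub>E\<^esub> (f \<lhd>\<^bsub>E\<^esub> \<sigma>) = ?\<alpha>' \<bullet>\<^bsub>E\<^esub> (\<rho> \<rhd>\<^bsub>E\<^esub> ?R')"
      using n by (intro bexI [of _ \<sigma>]) (simp_all add: vert_iso2_iff)
  next
    fix f g a v0 v1 y \<alpha>0
    assume f: "f \<in> cart_to E B P x" and g: "g \<in> cart_to E B P x" and a: "a \<in> hom2 B (F1 P f) (F1 P g)"
      and v0: "v0 \<in> vert_hom1 E B P y (Dom (C1 E) f)" and v1: "v1 \<in> vert_hom1 E B P y (Dom (C1 E) g)"
      and \<alpha>0: "\<alpha>0 \<in> hom2 E (f \<cdot>\<^bsub>E\<^esub> v0) (g \<cdot>\<^bsub>E\<^esub> v1)" "F2 P \<alpha>0 = a"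
    obtain z where z: "F0 P (Dom (C1 E) g) = z" by simp
    note [simp] = cart_to_simps(2,3) [OF f] cart_to_simps(2,3) [OF g] rs [OF f g a, unfolded z] z
    have [simp]: "v0 \<in> Arr (C1 E)" "Dom (C1 E) v0 = y" "Cod (C1 E) v0 = Dom (C1 E) f" "F1 P v0 = id1 B z"
      "v1 \<in> Arr (C1 E)" "Dom (C1 E) v1 = y" "Cod (C1 E) v1 = Dom (C1 E) g" "F1 P v1 = id1 B z"
      "\<alpha>0 \<in> Arr (C2 E)" "Dom (C2 E) \<alpha>0 = f \<cdot>\<^bsub>E\<^esub> v0" "Cod (C2 E) \<alpha>0 = g \<cdot>\<^bsub>E\<^esub> v1" "F2 P \<alpha>0 = a" "F0 P y = z"
      using v0 v1 \<alpha>0 by (simp_all add: vert_hom1_iff)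
    have [simp]: "z \<in> Obj (C1 B)" using F0_Obj [OF E.H.dom_Obj [of v0]] by simp
    let ?R = "r f g a" and ?\<alpha> = "A f g a"
    have c: "cartesian2 E B P (?\<alpha> \<rhd>\<^bsub>E\<^esub> v1)" by (rule whisker [OF f g a, of _ y]) simp
    have "\<exists>!n. n \<in> hom2 E (Dom (C2 E) \<alpha>0) (Dom (C2 E) (?\<alpha> \<rhd>\<^bsub>E\<^esub> v1)) \<and> F2 P n = id2 B (F1 P f)
        \<and> (?\<alpha> \<rhd>\<^bsub>E\<^esub> v1) \<bullet>\<^bsub>E\<^esub> n = \<alpha>0"
      by (rule cartesian2_ex1 [OF c]) simp_all
    then have n: "\<exists>!n. n \<in> hom2 E (f \<cdot>\<^bsub>E\<^esub> v0) (f \<cdot>\<^bsub>E\<^esub> ?R \<cdot>\<^bsub>E\<^esub> v1) \<and> F2 P n = id2 B (F1 P f)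
        \<and> (?\<alpha> \<rhd>\<^bsub>E\<^esub> v1) \<bullet>\<^bsub>E\<^esub> n = \<alpha>0" by simp
    then obtain n where n1: "n \<in> hom2 E (f \<cdot>\<^bsub>E\<^esub> v0) (f \<cdot>\<^bsub>E\<^esub> ?R \<cdot>\<^bsub>E\<^esub> v1)" "F2 P n = id2 B (F1 P f)"
        "(?\<alpha> \<rhd>\<^bsub>E\<^esub> v1) \<bullet>\<^bsub>E\<^esub> n = \<alpha>0" by blast
    have m: "\<exists>!\<mu>. \<mu> \<in> hom2 E v0 (?R \<cdot>\<^bsub>E\<^esub> v1) \<and> F2 P \<mu> = id2 B (F1 P (?R \<cdot>\<^bsub>E\<^esub> v1)) \<and> f \<lhd>\<^bsub>E\<^esub> \<mu> = n"
      by (rule cartesian1_lift_vertical_ex1 [OF cart_to_simps(1) [OF f], of _ y]) (use n1 in simp_all)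
    show "\<exists>!\<mu>. \<mu> \<in> vert_hom2 E B P v0 (?R \<cdot>\<^bsub>E\<^esub> v1) \<and> (?\<alpha> \<rhd>\<^bsub>E\<^esub> v1) \<bullet>\<^bsub>E\<^esub> (f \<lhd>\<^bsub>E\<^esub> \<mu>) = \<alpha>0"
    proof (rule ex_ex1I)
      obtain \<mu> where "\<mu> \<in> hom2 E v0 (?R \<cdot>\<^bsub>E\<^esub> v1)" "F2 P \<mu> = id2 B (F1 P (?R \<cdot>\<^bsub>E\<^esub> v1))" "f \<lhd>\<^bsub>E\<^esub> \<mu> = n"
        using m by blast
      then show "\<exists>\<mu>. \<mu> \<in> vert_hom2 E B P v0 (?R \<cdot>\<^bsub>E\<^esub> v1) \<and> (?\<alpha> \<rhd>\<^bsub>E\<^esub> v1) \<bullet>\<^bsub>E\<^esub> (f \<lhd>\<^bsub>E\<^esub> \<mu>) = \<alpha>0"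
        using n1 by (intro exI [of _ \<mu>]) (simp add: vert_hom2_iff)
    next
      have *: "\<mu> \<in> hom2 E v0 (?R \<cdot>\<^bsub>E\<^esub> v1) \<and> F2 P \<mu> = id2 B (F1 P (?R \<cdot>\<^bsub>E\<^esub> v1)) \<and> f \<lhd>\<^bsub>E\<^esub> \<mu> = n"
        if \<mu>: "\<mu> \<in> vert_hom2 E B P v0 (?R \<cdot>\<^bsub>E\<^esub> v1) \<and> (?\<alpha> \<rhd>\<^bsub>E\<^esub> v1) \<bullet>\<^bsub>E\<^esub> (f \<lhd>\<^bsub>E\<^esub> \<mu>) = \<alpha>0" for \<mu>
      proof -
        have "f \<lhd>\<^bsub>E\<^esub> \<mu> = n"
          by (rule ex1_eq [OF n]) (use \<mu> n1 in \<open>simp_all add: vert_hom2_iff\<close>)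
        then show ?thesis using \<mu> by (simp add: vert_hom2_iff)
      qed
      fix \<mu> \<mu>'
      assume "\<mu> \<in> vert_hom2 E B P v0 (?R \<cdot>\<^bsub>E\<^esub> v1) \<and> (?\<alpha> \<rhd>\<^bsub>E\<^esub> v1) \<bullet>\<^bsub>E\<^esub> (f \<lhd>\<^bsub>E\<^esub> \<mu>) = \<alpha>0"
        and "\<mu>' \<in> vert_hom2 E B P v0 (?R \<cdot>\<^bsub>E\<^esub> v1) \<and> (?\<alpha> \<rhd>\<^bsub>E\<^esub> v1) \<bullet>\<^bsub>E\<^esub> (f \<lhd>\<^bsub>E\<^esub> \<mu>') = \<alpha>0"
      then show "\<mu> = \<mu>'" by (intro ex1_eq [OF m] *)
    qed
  qed
  then show ?thesis by blast
qed

end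

section \<open>The codomain 2-functor\<close>

context display_cells
begin

lemma KD2_isoI:
  assumes \<alpha>: "Cyl f g a b \<in> Arr (KD2 K D)" and ab: "iso (C2 K) a" "iso (C2 K) b"
  shows "iso (C2 E) (Cyl f g a b)"
proof -
  interpret V2: category "KD2 K D" by (rule category_KD2)
  obtain y x where yx: "sq_dom f = y" "sq_cod f = x" by simp
  note f = KD2_arrD [OF \<alpha>, unfolded cyl.sel, OF refl refl yx]
  note [simp] = yx ab f KD1_arrD [OF f(1) yx] KD1_arrD [OF f(2,3,4)] KD1_arrD(1,2) [THEN D_arr, OF f(1) yx]
  have "(inv_arr (C2 K) (b \<rhd>\<^bsub>K\<^esub> y)) \<bullet>\<^bsub>K\<^esub> tri g
      = inv_arr (C2 K) (b \<rhd>\<^bsub>K\<^esub> y) \<bullet>\<^bsub>K\<^esub> (tri g \<bullet>\<^bsub>K\<^esub> (x \<lhd>\<^bsub>K\<^esub> a)) \<bullet>\<^bsub>K\<^esub> inv_arr (C2 K) (x \<lhd>\<^bsub>K\<^esub> a)"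
    by (simp del: prewhisker_iso(2) postwhisker_iso(2))
  also have "\<dots> = tri f \<bullet>\<^bsub>K\<^esub> inv_arr (C2 K) (x \<lhd>\<^bsub>K\<^esub> a)"
    by (simp flip: f(11) del: f(11) prewhisker_iso(2) postwhisker_iso(2))
  finally have "Cyl g f (inv_arr (C2 K) a) (inv_arr (C2 K) b) \<in> Arr (KD2 K D)"
    by (intro KD2_arrI) simp_all
  then show ?thesis
    using \<alpha> by (simp, intro V2.isoI [of _ "Cyl g f (inv_arr (C2 K) a) (inv_arr (C2 K) b)"]) simp_all
qed

lemma two_functor_cod: "two_functor E K (cod_fctr K)"
proof (intro two_functor.intro two_functor_axioms.intro, goal_cases)
  case 1 show ?case by (rule two_category_KD)
next
  case 2 show ?case by (rule two_category_axioms)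
qed (auto simp: cod_fctr_def KD1_arr KD2_arr)

text \<open>A 1-cell of \<open>KD K D\<close> can be changed along an isomorphism \<open>u\<close> of its lower part: \<open>u\<close> is absorbed
  into the invertible 2-cell that fills the square.\<close>

lemma locally_isofibrant_cod: "locally_isofibrant E K (cod_fctr K)"
proof (intro locally_isofibrant.intro locally_isofibrant_axioms.intro two_functor_cod)
  fix k u
  assume "k \<in> Arr (C1 E)" and u: "iso (C2 K) u" "Dom (C2 K) u = F1 (cod_fctr K) k"
  then have k: "k \<in> Arr (KD1 K D)" and [simp]: "Dom (C2 K) u = under1 k" by (simp_all add: cod_fctr_def)
  obtain y x where yx: "sq_dom k = y" "sq_cod k = x" by simp
  note [simp] = u(1) yx k KD1_arrD [OF k yx] V.iso_arr KD1_arrD(1,2) [THEN D_arr, OF k yx]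
  let ?k = "Sq y x (over1 k) ((u \<rhd>\<^bsub>K\<^esub> y) \<bullet>\<^bsub>K\<^esub> tri k) (Cod (C2 K) u)"
  have "?k \<in> Arr (KD1 K D)"
    by (simp add: KD1_arr)
  then have "Cyl k ?k (id2 K (over1 k)) u \<in> Arr (KD2 K D)"
    by (intro KD2_arrI) simp_all
  then have "iso (C2 E) (Cyl k ?k (id2 K (over1 k)) u)"
    by (intro KD2_isoI) simp_all
  then show "\<exists>m. iso (C2 E) m \<and> Dom (C2 E) m = k \<and> F2 (cod_fctr K) m = u"
    by (intro exI [of _ "Cyl k ?k (id2 K (over1 k)) u"]) (simp add: cod_fctr_def)
qed

text \<open>A 1-cell \<open>w \<rightarrow> d1\<close> of \<open>KD K D\<close> over \<open>h\<close> is a 1-cell into \<open>p\<close> whose second projection is isomorphic to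
  \<open>h w\<close>. Given \<open>g : w \<rightarrow> x\<close> over a 1-cell isomorphic to \<open>f h\<close>, the square of \<open>g\<close> is, up to this
  isomorphism, a cone on \<open>over1 g\<close> and \<open>h w\<close>, and the bipullback lifts it. For 2-cells, the cylinder
  condition prescribes the second projection of the sought 2-cell into \<open>p\<close>, and its composite with
  the square prescribes the first.\<close>

lemma bipullback_cartesian1:
  assumes bp: "bipullback K x f p d0 d1 \<phi>" and D: "x \<in> D" "d1 \<in> D"
  shows "cartesian1 E K (cod_fctr K) (Sq d1 x d0 \<phi> f)"
proof -
  interpret P: two_functor E K "cod_fctr K" by (rule two_functor_cod)
  note bt [simp] = bipullback_typing [OF bp]
  let ?F = "Sq d1 x d0 \<phi> f"
  have F: "?F \<in> Arr (KD1 K D)"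
    using D by (simp add: KD1_arr)
  show ?thesis
  proof (rule P.cartesian1I)
    show "?F \<in> Arr (C1 E)" using F by simp
  next
    fix w h g \<theta>
    assume h: "h \<in> hom1 K (F0 (cod_fctr K) w) (F0 (cod_fctr K) (Dom (C1 E) ?F))"
      and g: "g \<in> hom1 E w (Cod (C1 E) ?F)"
      and \<theta>: "\<theta> \<in> hom2 K (F1 (cod_fctr K) ?F \<cdot>\<^bsub>K\<^esub> h) (F1 (cod_fctr K) g)" "iso (C2 K) \<theta>"
    have g': "g \<in> Arr (KD1 K D)" "sq_dom g = w" "sq_cod g = x" using g by simp_all
    note [simp] = g' KD1_arrD [OF g'] KD1_arrD(1) [THEN D_arr, OF g']
    have [simp]: "h \<in> Arr (C1 K)" "Dom (C1 K) h = Cod (C1 K) w" "Cod (C1 K) h = Dom (C1 K) f"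
      "\<theta> \<in> Arr (C2 K)" "Dom (C2 K) \<theta> = f \<cdot>\<^bsub>K\<^esub> h" "Cod (C2 K) \<theta> = under1 g" "iso (C2 K) \<theta>"
      using h \<theta> by (simp_all add: cod_fctr_def)
    obtain k u v where k: "k \<in> hom1 K (Dom (C1 K) w) p" "u \<in> hom2 K (d0 \<cdot>\<^bsub>K\<^esub> k) (over1 g)" "iso (C2 K) u"
      "v \<in> hom2 K (d1 \<cdot>\<^bsub>K\<^esub> k) (h \<cdot>\<^bsub>K\<^esub> w)" "iso (C2 K) v"
      and uv: "(f \<lhd>\<^bsub>K\<^esub> v) \<bullet>\<^bsub>K\<^esub> (\<phi> \<rhd>\<^bsub>K\<^esub> k) = (inv_arr (C2 K) (\<theta> \<rhd>\<^bsub>K\<^esub> w) \<bullet>\<^bsub>K\<^esub> tri g) \<bullet>\<^bsub>K\<^esub> (x \<lhd>\<^bsub>K\<^esub> u)"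
      by (rule bipullback_lift [OF bp, of "over1 g" "Dom (C1 K) w" "h \<cdot>\<^bsub>K\<^esub> w"
            "inv_arr (C2 K) (\<theta> \<rhd>\<^bsub>K\<^esub> w) \<bullet>\<^bsub>K\<^esub> tri g"]) simp_all
    have [simp]: "k \<in> Arr (C1 K)" "Dom (C1 K) k = Dom (C1 K) w" "Cod (C1 K) k = p"
      "u \<in> Arr (C2 K)" "Dom (C2 K) u = d0 \<cdot>\<^bsub>K\<^esub> k" "Cod (C2 K) u = over1 g" "iso (C2 K) u"
      "v \<in> Arr (C2 K)" "Dom (C2 K) v = d1 \<cdot>\<^bsub>K\<^esub> k" "Cod (C2 K) v = h \<cdot>\<^bsub>K\<^esub> w" "iso (C2 K) v"
      using k by simp_all
    let ?k = "Sq w d1 k v h"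
    have k': "?k \<in> Arr (KD1 K D)"
      using D by (simp add: KD1_arr)
    have Fk: "Comp (KD1 K D) ?F ?k \<in> Arr (KD1 K D)"
      using P.E.H.comp_simps(1) [of ?k ?F] k' F by simp
    have "(\<theta> \<rhd>\<^bsub>K\<^esub> w) \<bullet>\<^bsub>K\<^esub> (f \<lhd>\<^bsub>K\<^esub> v) \<bullet>\<^bsub>K\<^esub> (\<phi> \<rhd>\<^bsub>K\<^esub> k) = tri g \<bullet>\<^bsub>K\<^esub> (x \<lhd>\<^bsub>K\<^esub> u)"
      unfolding uv by (simp del: prewhisker_iso(2))
    then have "Cyl (Comp (KD1 K D) ?F ?k) g u \<theta> \<in> Arr (KD2 K D)"
      using Fk by (intro KD2_arrI) simp_all
    moreover from this have "iso (C2 E) (Cyl (Comp (KD1 K D) ?F ?k) g u \<theta>)"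
      by (rule KD2_isoI) simp_all
    ultimately show "\<exists>s\<in>hom1 E w (Dom (C1 E) ?F). \<exists>u\<in>hom2 K (F1 (cod_fctr K) s) h.
        \<exists>v\<in>hom2 E (?F \<cdot>\<^bsub>E\<^esub> s) g. iso (C2 K) u \<and> iso (C2 E) v \<and>
          F2 (cod_fctr K) v = \<theta> \<bullet>\<^bsub>K\<^esub> (F1 (cod_fctr K) ?F \<lhd>\<^bsub>K\<^esub> u)"
      using k' by (intro bexI [of _ ?k] bexI [of _ "id2 K h"]
          bexI [of _ "Cyl (Comp (KD1 K D) ?F ?k) g u \<theta>"]) (simp_all add: cod_fctr_def)
  next
    fix w k k' u v
    assume k0: "k \<in> hom1 E w (Dom (C1 E) ?F)" "k' \<in> hom1 E w (Dom (C1 E) ?F)"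
      and u: "u \<in> hom2 K (F1 (cod_fctr K) k) (F1 (cod_fctr K) k')"
      and v: "v \<in> hom2 E (?F \<cdot>\<^bsub>E\<^esub> k) (?F \<cdot>\<^bsub>E\<^esub> k')"
      and uv: "F2 (cod_fctr K) v = F1 (cod_fctr K) ?F \<lhd>\<^bsub>K\<^esub> u"
    have k: "k \<in> Arr (KD1 K D)" "sq_dom k = w" "sq_cod k = d1"
      and k': "k' \<in> Arr (KD1 K D)" "sq_dom k' = w" "sq_cod k' = d1"
      using k0 by simp_all
    note [simp] = k k' KD1_arrD [OF k] KD1_arrD [OF k'] KD1_arrD(1) [THEN D_arr, OF k]
    have v': "v \<in> Arr (KD2 K D)" "cyl_dom v = Comp (KD1 K D) ?F k" "cyl_cod v = Comp (KD1 K D) ?F k'"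
      "under2 v = f \<lhd>\<^bsub>K\<^esub> u"
      using v uv by (simp_all add: cod_fctr_def)
    have [simp]: "u \<in> Arr (C2 K)" "Dom (C2 K) u = under1 k" "Cod (C2 K) u = under1 k'"
      using u by (simp_all add: cod_fctr_def)
    have vt [simp]: "over2 v \<in> Arr (C2 K)" "Dom (C2 K) (over2 v) = d0 \<cdot>\<^bsub>K\<^esub> over1 k"
      "Cod (C2 K) (over2 v) = d0 \<cdot>\<^bsub>K\<^esub> over1 k'"
      and veq: "((f \<lhd>\<^bsub>K\<^esub> u) \<rhd>\<^bsub>K\<^esub> w) \<bullet>\<^bsub>K\<^esub> (f \<lhd>\<^bsub>K\<^esub> tri k) \<bullet>\<^bsub>K\<^esub> (\<phi> \<rhd>\<^bsub>K\<^esub> over1 k)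
        = ((f \<lhd>\<^bsub>K\<^esub> tri k') \<bullet>\<^bsub>K\<^esub> (\<phi> \<rhd>\<^bsub>K\<^esub> over1 k')) \<bullet>\<^bsub>K\<^esub> (x \<lhd>\<^bsub>K\<^esub> over2 v)"
      using KD2_arrD [OF v'(1-3), of w x] by (simp_all add: v'(4))
    \<comment> \<open>The value of \<open>d1 \<lhd> m\<close> that the cylinder condition forces.\<close>
    define n where "n = inv_arr (C2 K) (tri k') \<bullet>\<^bsub>K\<^esub> (u \<rhd>\<^bsub>K\<^esub> w) \<bullet>\<^bsub>K\<^esub> tri k"
    have [simp]: "n \<in> Arr (C2 K)" "Dom (C2 K) n = d1 \<cdot>\<^bsub>K\<^esub> over1 k" "Cod (C2 K) n = d1 \<cdot>\<^bsub>K\<^esub> over1 k'"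
      by (simp_all add: n_def)
    have "(f \<lhd>\<^bsub>K\<^esub> n) \<bullet>\<^bsub>K\<^esub> (\<phi> \<rhd>\<^bsub>K\<^esub> over1 k)
        = inv_arr (C2 K) (f \<lhd>\<^bsub>K\<^esub> tri k') \<bullet>\<^bsub>K\<^esub> ((f \<lhd>\<^bsub>K\<^esub> u) \<rhd>\<^bsub>K\<^esub> w) \<bullet>\<^bsub>K\<^esub> (f \<lhd>\<^bsub>K\<^esub> tri k) \<bullet>\<^bsub>K\<^esub> (\<phi> \<rhd>\<^bsub>K\<^esub> over1 k)"
      by (simp add: n_def)
    also have "\<dots> = (\<phi> \<rhd>\<^bsub>K\<^esub> over1 k') \<bullet>\<^bsub>K\<^esub> (x \<lhd>\<^bsub>K\<^esub> over2 v)"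
      unfolding veq by (simp del: postwhisker_iso(2))
    finally have ex: "\<exists>!m. m \<in> hom2 K (over1 k) (over1 k') \<and> d0 \<lhd>\<^bsub>K\<^esub> m = over2 v \<and> d1 \<lhd>\<^bsub>K\<^esub> m = n"
      by (intro bipullback_ex1 [OF bp, of _ "Dom (C1 K) w"]) simp_all
    have n_iff: "(u \<rhd>\<^bsub>K\<^esub> w) \<bullet>\<^bsub>K\<^esub> tri k = tri k' \<bullet>\<^bsub>K\<^esub> (d1 \<lhd>\<^bsub>K\<^esub> m) \<longleftrightarrow> d1 \<lhd>\<^bsub>K\<^esub> m = n"
      if "m \<in> hom2 K (over1 k) (over1 k')" for m
      using V.inv_comp_eq [of "tri k'" "(u \<rhd>\<^bsub>K\<^esub> w) \<bullet>\<^bsub>K\<^esub> tri k" "d1 \<lhd>\<^bsub>K\<^esub> m"] that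
      by (auto simp: n_def)
    have iff: "l \<in> hom2 E k k' \<and> F2 (cod_fctr K) l = u \<and> ?F \<lhd>\<^bsub>E\<^esub> l = v \<longleftrightarrow>
        (\<exists>m. l = Cyl k k' m u \<and> m \<in> hom2 K (over1 k) (over1 k') \<and> d0 \<lhd>\<^bsub>K\<^esub> m = over2 v \<and> d1 \<lhd>\<^bsub>K\<^esub> m = n)" for l
    proof
      assume l: "l \<in> hom2 E k k' \<and> F2 (cod_fctr K) l = u \<and> ?F \<lhd>\<^bsub>E\<^esub> l = v"
      then have l': "l \<in> Arr (KD2 K D)" "cyl_dom l = k" "cyl_cod l = k'" "under2 l = u" "d0 \<lhd>\<^bsub>K\<^esub> over2 l = over2 v"
        by (auto simp: cod_fctr_def)
      note t = KD2_arrD [OF l'(1-3) k(2,3)]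
      show "\<exists>m. l = Cyl k k' m u \<and> m \<in> hom2 K (over1 k) (over1 k') \<and> d0 \<lhd>\<^bsub>K\<^esub> m = over2 v \<and> d1 \<lhd>\<^bsub>K\<^esub> m = n"
        using l' t n_iff [of "over2 l"]
        by (intro exI [of _ "over2 l"]) (auto intro: cyl.expand)
    next
      assume "\<exists>m. l = Cyl k k' m u \<and> m \<in> hom2 K (over1 k) (over1 k') \<and> d0 \<lhd>\<^bsub>K\<^esub> m = over2 v \<and> d1 \<lhd>\<^bsub>K\<^esub> m = n"
      then obtain m where m: "l = Cyl k k' m u" "m \<in> hom2 K (over1 k) (over1 k')"
        "d0 \<lhd>\<^bsub>K\<^esub> m = over2 v" "d1 \<lhd>\<^bsub>K\<^esub> m = n" by blast
      have "l \<in> Arr (KD2 K D)"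
        unfolding m(1) by (rule KD2_arrI) (use m n_iff [of m] in simp_all)
      moreover have "?F \<lhd>\<^bsub>E\<^esub> l = v"
        using v' m by (intro cyl.expand) simp
      ultimately show "l \<in> hom2 E k k' \<and> F2 (cod_fctr K) l = u \<and> ?F \<lhd>\<^bsub>E\<^esub> l = v"
        using m by (simp add: cod_fctr_def)
    qed
    show "\<exists>!l. l \<in> hom2 E k k' \<and> F2 (cod_fctr K) l = u \<and> ?F \<lhd>\<^bsub>E\<^esub> l = v"
      unfolding iff using ex by (auto simp del: hom_iff)
  qed
qed

end

theorem proposition8p6:
  fixes K :: "('o, 'a, 't) two_cat" and D :: "'a set" and x :: 'a
  assumes "two_category K"
    and "D = {y. bicarrable K y} \<or> display_class K D"
    and "x \<in> D"
  shows "johnstone_fibration K D x \<longleftrightarrow> fibrational (KD K D) K (cod_fctr K) x"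
proof -
  interpret two_category K by fact
  have bic: "bicarrable K y" if "y \<in> D" for y
    using assms(2) that by (auto simp: display_class_def)
  interpret display_cells K D
    by unfold_locales (use bic in \<open>auto simp: bicarrable_def\<close>)
  interpret P: locally_isofibrant "KD K D" K "cod_fctr K"
    by (rule locally_isofibrant_cod)
  have stable: "\<exists>p d0 d1 \<phi>. bipullback K x f p d0 d1 \<phi> \<and> d1 \<in> D"
    if f: "f \<in> Arr (C1 K)" "Cod (C1 K) f = Cod (C1 K) x" for f
    using assms(2)
  proof
    assume D: "D = {y. bicarrable K y}"
    obtain p d0 d1 \<phi> where "bipullback K x f p d0 d1 \<phi>"
      using bic [OF assms(3)] f unfolding bicarrable_def by blast
    with bicarrable_stable [OF bic [OF assms(3)] this] D show ?thesis by blast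
  qed (use assms(3) f in \<open>auto simp: display_class_def\<close>)
  have lifts: "\<exists>g\<in>cart_to (KD K D) K (cod_fctr K) x. F1 (cod_fctr K) g = f"
    if f: "f \<in> Arr (C1 K)" "Cod (C1 K) f = F0 (cod_fctr K) x" for f
  proof -
    obtain p d0 d1 \<phi> where "bipullback K x f p d0 d1 \<phi>" "d1 \<in> D"
      using stable [of f] f by (auto simp: cod_fctr_def)
    then show ?thesis
      using bipullback_cartesian1 [of x f p d0 d1 \<phi>] assms(3)
      by (intro bexI [of _ "Sq d1 x d0 \<phi> f"]) (simp_all add: cod_fctr_def cart_to_def)
  qed
  show ?thesis
  proof
    assume "johnstone_fibration K D x"
    then obtain r A where "johnstone_data (KD K D) K (cod_fctr K) x r A"
      unfolding johnstone_fibration_def by blast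
    then interpret J: johnstone_lifting "KD K D" K "cod_fctr K" x r A
      using lifts by (intro johnstone_lifting.intro johnstone_lifting_axioms.intro
          P.locally_isofibrant_axioms) auto
    show "fibrational (KD K D) K (cod_fctr K) x"
      using assms(3) by (intro J.fibrational) simp
  next
    assume "fibrational (KD K D) K (cod_fctr K) x"
    then show "johnstone_fibration K D x"
      using P.fibrational_imp_johnstone_data bic [OF assms(3)]
      unfolding johnstone_fibration_def by blast
  qed
qed

end
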